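(* Let $n$ be a positive integer, let $a_1,\dots,a_n\in\mathbb{R}$ satisfy $\sum_{i=1}^n a_i^2=1$, let $g_1,\dots,g_n$ be independent standard Gaussian variables, and let \[ Q_a=\sum_{i=1}^n a_i(g_i^2-1),\qquad \delta=\sum_{i=1}^n a_i^3\in[-1,1]. \] Let $Z_\delta$ be the centered Gamma difference with parameter $\delta$ (defined in the context). Let $f\in C^2(\mathbb{R})$ be such that $f''$ is convex, and suppose that there are constants $C>0$ and $m>0$ such that, for all $x\in\mathbb{R}$, \[ |f(x)|+|f'(x)|+|f''(x)|\le C(1+|x|^m). \] Then $\mathbb{E} f(Q_a)\le\mathbb{E} f(Z_\delta)$. Moreover, \[ \mathbb{E} Q_a=\mathbb{E} Z_\delta=0,\qquad \mathbb{E} Q_a^2=\mathbb{E} Z_\delta^2=2,\qquad \mathbb{E} Q_a^3=\mathbb{E} Z_\delta^3=8\delta. \] In particular, for every real $p\ge3$, $\mathbb{E}|Q_a|^p\le\mathbb{E}|Z_\delta|^p$.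
   Context: $\operatorname{Gamma}(\alpha,\beta)$ denotes the Gamma distribution with shape $\alpha$ and rate $\beta$; a Gamma variable with shape zero is understood to be identically zero. For $-1\le\delta\le1$, let $A$ and $B$ be independent with $A\sim\operatorname{Gamma}(\tfrac14(1+\delta),\tfrac12)$ and $B\sim\operatorname{Gamma}(\tfrac14(1-\delta),\tfrac12)$, and define $Z_\delta=A-B-\delta$. *)

theory Defs
  imports "HOL-Probability.Probability"
begin

definition gamma_density :: "real \<Rightarrow> real \<Rightarrow> real \<Rightarrow> real" where
  "gamma_density \<alpha> \<beta> x =
     (if x \<le> 0 then 0 else \<beta> powr \<alpha> / Gamma \<alpha> * x powr (\<alpha> - 1) * exp (- \<beta> * x))"

(* Shape alpha and rate beta, meaningful for alpha >= 0 and beta > 0.  Shape zero is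
   the point mass at 0, the law of the variable that is identically zero. *)
definition gamma_distribution :: "real \<Rightarrow> real \<Rightarrow> real measure" where
  "gamma_distribution \<alpha> \<beta> =
     (if \<alpha> = 0 then return borel 0
      else density lborel (\<lambda>x. ennreal (gamma_density \<alpha> \<beta> x)))"

end

theory Submission
  imports Defs "HOL-Real_Asymp.Real_Asymp"
begin

text \<open>
  The Levy measure of \<open>Q\<close>, weighted by \<open>x\<^sup>2\<close>, is a mixture over the scales \<open>a\<^sub>i \<in> [-1, 1]\<close>. Pushing the
  scales to the end points \<open>\<plusminus>1\<close> while keeping the second and third moments fixed gives the law of
  \<open>Z\<close>, and spreads the mixing measure in convex order.

  Concretely, Gamma additivity splits \<open>Z\<close> into one centred Gamma difference per coordinate, so it
  suffices to compare \<open>a (g\<^sup>2 - 1)\<close> with its counterpart. For \<open>0 < a < 1\<close> write the former as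
  \<open>x X\<^sub>0 + y X\<^sub>1 + z X\<^sub>2\<close> with independent centred Gammas at \<open>(x, y, z) = (a, a, 0)\<close>; the latter is
  the same combination at \<open>(0, 1, -1)\<close>. Along a path joining the two scale vectors on which the
  second and third moments are constant, the Stein identity
  \<open>\<bbbE> (X - \<bbbE> X) h(X) = 4 \<alpha> \<bbbE> h'(X + V)\<close> (\<open>V\<close> exponential with rate \<open>1/2\<close>) expresses the derivative
  of the expectation of \<open>f\<close> through \<open>f''\<close>, and Jensen's inequality determines its sign.
\<close>

section \<open>Polynomial growth and averaging\<close>

text \<open>The shapes are forced. At \<open>(a, a, 0)\<close> the shapes of
  \<open>X\<^sub>0\<close> and \<open>X\<^sub>1\<close> must add up to 1/2, the shape of
  \<open>g\<^sup>2\<close>; at \<open>(0, 1, -1)\<close> the variance \<open>2 a\<^sup>2\<close> and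
  the third moment \<open>8 a^3\<close> of \<open>a (g\<^sup>2 - 1)\<close> determine
  \<open>\<alpha> = a\<^sup>2 (1 + a) / 4\<close> and
  \<open>\<gamma> = a\<^sup>2 (1 - a) / 4\<close>, which leaves \<open>k = 1/2 - \<alpha>\<close>
  for \<open>X\<^sub>0\<close>. Three scales under two constraints leave a curve, and the scale
  \<open>x\<close> serves as its parameter. The derivative of the expectation evaluates a convex
  function at the scales with weights shape * scale * speed. Constancy of the second moment says
  that these weights have total mass zero, constancy of the third that they have mean zero. The
  weight of the middle scale \<open>x\<close> is positive and the outer two are not, so the
  derivative is minus a Jensen gap. Since \<open>f''\<close> is merely convex, only one integration
  by parts is affordable: Stein is applied to \<open>f'\<close>. The path is differentiated only in
  its interior, so its ends are reached by continuity.\<close>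

definition poly_growth :: "(real \<Rightarrow> real) \<Rightarrow> bool" where
  "poly_growth f \<longleftrightarrow> (\<exists>C r. \<forall>x. \<bar>f x\<bar> \<le> C * (1 + \<bar>x\<bar>) ^ r)"

definition all_moments :: "real measure \<Rightarrow> bool" where
  "all_moments \<mu> \<longleftrightarrow>
     prob_space \<mu> \<and> sets \<mu> = sets borel \<and> (\<forall>r. integrable \<mu> (\<lambda>x. (1 + \<bar>x\<bar>) ^ r))"

text \<open>The derivatives are explicit arguments so that averages and affine substitutions can
  name the derivatives of their results.\<close>

definition convex_C2 :: "(real \<Rightarrow> real) \<Rightarrow> (real \<Rightarrow> real) \<Rightarrow> (real \<Rightarrow> real) \<Rightarrow> bool" where
  "convex_C2 f f' f'' \<longleftrightarrow>
     (\<forall>x. (f has_real_derivative f' x) (at x)) \<and>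
     (\<forall>x. (f' has_real_derivative f'' x) (at x)) \<and>
     convex_on UNIV f'' \<and> poly_growth f \<and> poly_growth f' \<and> poly_growth f''"

lemma poly_growthE:
  assumes "poly_growth f"
  obtains C r where "C \<ge> 0" "\<And>x. \<bar>f x\<bar> \<le> C * (1 + \<bar>x\<bar>) ^ r"
proof -
  obtain C r where *: "\<And>x. \<bar>f x\<bar> \<le> C * (1 + \<bar>x\<bar>) ^ r"
    using assms by (auto simp: poly_growth_def)
  have "C \<ge> 0" using *[of 0] by simp
  with * show ?thesis by (rule that[rotated])
qed

text \<open>Submultiplicativity of the weight \<open>1 + \<bar>x\<bar>\<close> splits a growth bound
  at \<open>x + y\<close> into a product of one-variable bounds, which Fubini can integrate.\<close>

lemma one_plus_abs_add_le: "1 + \<bar>x + y\<bar> \<le> (1 + \<bar>x\<bar>) * (1 + \<bar>y :: real\<bar>)"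
  using abs_triangle_ineq[of x y] by (auto simp: algebra_simps intro: order_trans[of _ "\<bar>x\<bar> + \<bar>y\<bar>"])

lemma one_plus_abs_mult_le: "1 + \<bar>c * x\<bar> \<le> (1 + \<bar>c\<bar>) * (1 + \<bar>x :: real\<bar>)"
  by (auto simp: algebra_simps abs_mult)

lemma poly_growth_affine_le:
  assumes "\<And>x. \<bar>f x\<bar> \<le> C * (1 + \<bar>x :: real\<bar>) ^ r" "C \<ge> 0"
  shows "\<bar>f (y + c * x) :: real\<bar> \<le> C * ((1 + \<bar>y\<bar>) * ((1 + \<bar>c\<bar>) * (1 + \<bar>x\<bar>))) ^ r"
proof -
  have "1 + \<bar>y + c * x\<bar> \<le> (1 + \<bar>y\<bar>) * (1 + \<bar>c * x\<bar>)" by (rule one_plus_abs_add_le)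
  also have "\<dots> \<le> (1 + \<bar>y\<bar>) * ((1 + \<bar>c\<bar>) * (1 + \<bar>x\<bar>))"
    by (intro mult_left_mono one_plus_abs_mult_le) auto
  finally have "(1 + \<bar>y + c * x\<bar>) ^ r \<le> ((1 + \<bar>y\<bar>) * ((1 + \<bar>c\<bar>) * (1 + \<bar>x\<bar>))) ^ r"
    by (intro power_mono) auto
  then show ?thesis
    using assms(1)[of "y + c * x"] assms(2) by (meson mult_left_mono order_trans)
qed

lemma poly_growth_affine:
  assumes "poly_growth f"
  shows "poly_growth (\<lambda>x. f (d + c * x))"
proof -
  obtain C r where C: "C \<ge> 0" "\<And>x. \<bar>f x\<bar> \<le> C * (1 + \<bar>x\<bar>) ^ r"
    using poly_growthE[OF assms] by metis
  have "\<bar>f (d + c * x)\<bar> \<le> (C * ((1 + \<bar>d\<bar>) * (1 + \<bar>c\<bar>)) ^ r) * (1 + \<bar>x\<bar>) ^ r" for x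
    using poly_growth_affine_le[OF C(2,1), of d c x]
    by (simp add: power_mult_distrib mult_ac)
  then show ?thesis by (auto simp: poly_growth_def)
qed

lemma poly_growth_cmult: "poly_growth f \<Longrightarrow> poly_growth (\<lambda>x. c * f x)"
proof -
  assume "poly_growth f"
  then obtain C r where C: "C \<ge> 0" "\<And>x. \<bar>f x\<bar> \<le> C * (1 + \<bar>x\<bar>) ^ r"
    using poly_growthE by metis
  have "\<bar>c * f x\<bar> \<le> (\<bar>c\<bar> * C) * (1 + \<bar>x\<bar>) ^ r" for x
    using mult_left_mono[OF C(2)[of x], of "\<bar>c\<bar>"] by (simp add: abs_mult mult_ac)
  then show ?thesis by (auto simp: poly_growth_def)
qed

lemma poly_growth_mult:
  assumes "poly_growth f" "poly_growth h"
  shows "poly_growth (\<lambda>x. f x * h x)"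
proof -
  obtain C r where C: "C \<ge> 0" "\<And>x. \<bar>f x\<bar> \<le> C * (1 + \<bar>x\<bar>) ^ r"
    using poly_growthE[OF assms(1)] by metis
  obtain D s where D: "D \<ge> 0" "\<And>x. \<bar>h x\<bar> \<le> D * (1 + \<bar>x\<bar>) ^ s"
    using poly_growthE[OF assms(2)] by metis
  have "\<bar>f x * h x\<bar> \<le> (C * D) * (1 + \<bar>x\<bar>) ^ (r + s)" for x
    using mult_mono[OF C(2)[of x] D(2)[of x]] C(1) by (simp add: abs_mult power_add mult_ac)
  then show ?thesis unfolding poly_growth_def by blast
qed

lemma poly_growth_const: "poly_growth (\<lambda>x. c)"
  unfolding poly_growth_def by (rule exI[of _ "\<bar>c\<bar>"], rule exI[of _ 0]) simp

lemma poly_growth_ident: "poly_growth (\<lambda>x. x)"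
  unfolding poly_growth_def by (rule exI[of _ 1], rule exI[of _ 1]) simp

lemma poly_growth_power: "poly_growth (\<lambda>x. x ^ k)"
  by (induction k) (auto intro!: poly_growth_mult poly_growth_const poly_growth_ident)

section \<open>Integrability and convolution of laws with all moments\<close>

lemma all_moments_integrable:
  assumes "all_moments \<mu>" "poly_growth f" "f \<in> borel_measurable borel"
  shows "integrable \<mu> f"
proof -
  obtain C r where C: "C \<ge> 0" "\<And>x. \<bar>f x\<bar> \<le> C * (1 + \<bar>x\<bar>) ^ r"
    using poly_growthE[OF assms(2)] by metis
  have s: "sets \<mu> = sets borel" and i: "integrable \<mu> (\<lambda>x. (1 + \<bar>x\<bar>) ^ r)"
    using assms(1) by (auto simp: all_moments_def)
  have "f \<in> borel_measurable \<mu>" using assms(3) s by (simp cong: measurable_cong_sets)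
  then show ?thesis
    using C by (intro Bochner_Integration.integrable_bound[OF integrable_mult_right[OF i, of C]])
      (auto intro: order_trans[OF C(2)])
qed

lemma all_moments_distr:
  assumes "all_moments \<mu>"
  shows "all_moments (distr \<mu> borel (\<lambda>x. d + c * x))"
proof -
  have s: "sets \<mu> = sets borel" and p: "prob_space \<mu>"
    using assms by (auto simp: all_moments_def)
  have [measurable]: "(\<lambda>x. d + c * x) \<in> borel_measurable \<mu>"
    using s by (simp cong: measurable_cong_sets)
  have "poly_growth (\<lambda>x. (1 + \<bar>x\<bar>) ^ r)" for r
    unfolding poly_growth_def by (rule exI[of _ 1], rule exI[of _ r]) simp
  from poly_growth_affine[OF this]
  have "integrable (distr \<mu> borel (\<lambda>x. d + c * x)) (\<lambda>x. (1 + \<bar>x\<bar>) ^ r)" for r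
    by (subst integrable_distr_eq) (auto intro!: all_moments_integrable[OF assms])
  then show ?thesis
    using prob_space.prob_space_distr[OF p, of "\<lambda>x. d + c * x" borel]
    by (auto simp: all_moments_def)
qed

lemma integrable_pair_poly_growth:
  assumes \<mu>: "all_moments \<mu>" and \<nu>: "all_moments \<nu>"
    and f: "poly_growth f" "f \<in> borel_measurable borel"
  shows "integrable (\<mu> \<Otimes>\<^sub>M \<nu>) (\<lambda>(x, y). f (x + y))"
proof -
  interpret M: prob_space \<mu> using \<mu> by (simp add: all_moments_def)
  interpret N: prob_space \<nu> using \<nu> by (simp add: all_moments_def)
  interpret P: pair_sigma_finite \<mu> \<nu> ..
  have [measurable_cong]: "sets \<mu> = sets borel" "sets \<nu> = sets borel"
    using \<mu> \<nu> by (auto simp: all_moments_def)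
  note f(2)[measurable]
  obtain C r where C: "C \<ge> 0" "\<And>x. \<bar>f x\<bar> \<le> C * (1 + \<bar>x\<bar>) ^ r"
    using poly_growthE[OF f(1)] by metis
  have "integrable \<mu> (\<lambda>x. (1 + \<bar>x\<bar>) ^ r)" "integrable \<nu> (\<lambda>y. (1 + \<bar>y\<bar>) ^ r)"
    using \<mu> \<nu> by (auto simp: all_moments_def)
  then have "integrable (\<mu> \<Otimes>\<^sub>M \<nu>) (\<lambda>(x, y). (C * (1 + \<bar>x\<bar>) ^ r) * (1 + \<bar>y\<bar>) ^ r)"
    by (intro P.Fubini_integrable) (auto simp: abs_mult C(1))
  then show ?thesis
  proof (rule Bochner_Integration.integrable_bound)
    have "\<bar>f (x + y)\<bar> \<le> C * (1 + \<bar>x\<bar>) ^ r * (1 + \<bar>y\<bar>) ^ r" for x y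
      using C(2)[of "x + y"] power_mono[OF one_plus_abs_add_le[of x y], of r] C(1)
      by (auto simp: power_mult_distrib mult.assoc intro: order_trans mult_left_mono)
    then show "AE x in \<mu> \<Otimes>\<^sub>M \<nu>. norm (case x of (x, y) \<Rightarrow> f (x + y)) \<le>
       norm (case x of (x, y) \<Rightarrow> C * (1 + \<bar>x\<bar>) ^ r * (1 + \<bar>y\<bar>) ^ r)"
      using C(1) by (auto intro: order_trans)
  qed measurable
qed

lemma integral_convolution:
  assumes \<mu>: "all_moments \<mu>" and \<nu>: "all_moments \<nu>"
    and f: "poly_growth f" "f \<in> borel_measurable borel"
  shows "integral\<^sup>L (\<mu> \<star> \<nu>) f = (\<integral>x. (\<integral>y. f (x + y) \<partial>\<nu>) \<partial>\<mu>)"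
proof -
  interpret M: prob_space \<mu> using \<mu> by (simp add: all_moments_def)
  interpret N: prob_space \<nu> using \<nu> by (simp add: all_moments_def)
  interpret P: pair_sigma_finite \<mu> \<nu> ..
  have [measurable_cong]: "sets \<mu> = sets borel" "sets \<nu> = sets borel"
    using \<mu> \<nu> by (auto simp: all_moments_def)
  note f(2)[measurable]
  have "integral\<^sup>L (\<mu> \<star> \<nu>) f = integral\<^sup>L (\<mu> \<Otimes>\<^sub>M \<nu>) (\<lambda>(x, y). f (x + y))"
    unfolding convolution_def by (subst integral_distr) (auto simp: case_prod_beta')
  also have "\<dots> = (\<integral>x. (\<integral>y. f (x + y) \<partial>\<nu>) \<partial>\<mu>)"
    using integrable_pair_poly_growth[OF assms] by (subst P.integral_fst'[symmetric]) auto
  finally show ?thesis .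
qed

lemma all_moments_convolution:
  assumes \<mu>: "all_moments \<mu>" and \<nu>: "all_moments \<nu>"
  shows "all_moments (\<mu> \<star> \<nu>)"
proof -
  interpret M: prob_space \<mu> using \<mu> by (simp add: all_moments_def)
  interpret N: prob_space \<nu> using \<nu> by (simp add: all_moments_def)
  interpret P: pair_prob_space \<mu> \<nu> ..
  have [measurable_cong]: "sets \<mu> = sets borel" "sets \<nu> = sets borel"
    using \<mu> \<nu> by (auto simp: all_moments_def)
  have pg: "poly_growth (\<lambda>x. (1 + \<bar>x\<bar>) ^ r)" for r
    unfolding poly_growth_def by (rule exI[of _ 1], rule exI[of _ r]) simp
  have "integrable (\<mu> \<star> \<nu>) (\<lambda>x. (1 + \<bar>x\<bar>) ^ r)" for r
    unfolding convolution_def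
    using integrable_pair_poly_growth[OF \<mu> \<nu> pg[of r]]
    by (subst integrable_distr_eq) (auto simp: case_prod_beta')
  moreover have "prob_space (\<mu> \<star> \<nu>)"
    unfolding convolution_def by (rule P.prob_space_distr) measurable
  ultimately show ?thesis by (simp add: all_moments_def)
qed

text \<open>Dominated convergence for difference quotients. The Lipschitz bound compares only with
  the base point \<open>t0\<close>, so nothing is asked of derivatives at neighbouring points; this
  suits scale paths whose derivative is known at \<open>t0\<close> alone.\<close>

lemma has_real_derivative_integral:
  fixes F :: "real \<Rightarrow> 'a \<Rightarrow> real"
  assumes int: "\<And>t. t \<in> T \<Longrightarrow> integrable M (F t)"
    and T: "open T" "t0 \<in> T"
    and D: "\<And>w. w \<in> space M \<Longrightarrow> ((\<lambda>t. F t w) has_real_derivative D w) (at t0)"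
    and lip: "\<And>t w. t \<in> T \<Longrightarrow> w \<in> space M \<Longrightarrow> \<bar>F t w - F t0 w\<bar> \<le> \<bar>t - t0\<bar> * W w"
    and W: "integrable M W"
  shows "integrable M D"
    and "((\<lambda>t. integral\<^sup>L M (F t)) has_real_derivative integral\<^sup>L M D) (at t0)"
proof -
  have seq: "integrable M D \<and> (\<lambda>i. (integral\<^sup>L M (F (X i)) - integral\<^sup>L M (F t0)) / (X i - t0)) \<longlonglongrightarrow> integral\<^sup>L M D"
    if X: "\<And>i. X i \<in> T - {t0}" "X \<longlonglongrightarrow> t0" for X
  proof -
    have t: "(\<lambda>i. (F (X i) w - F t0 w) / (X i - t0)) \<longlonglongrightarrow> D w" if "w \<in> space M" for w
      using D[OF that] X unfolding has_field_derivative_iff tendsto_at_iff_sequentially comp_def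
      by auto
    have meas: "(\<lambda>w. (F (X i) w - F t0 w) / (X i - t0)) \<in> borel_measurable M" for i
      using int[of "X i"] int[of t0] X(1)[of i] T by (auto intro!: borel_measurable_divide borel_measurable_diff)
    have Dm: "D \<in> borel_measurable M"
      by (rule borel_measurable_LIMSEQ_metric[OF meas t])
    have b: "AE w in M. norm ((F (X i) w - F t0 w) / (X i - t0)) \<le> W w" for i
      using lip[of "X i"] X(1)[of i] by (auto simp: divide_le_eq mult.commute)
    have t': "AE w in M. (\<lambda>i. (F (X i) w - F t0 w) / (X i - t0)) \<longlonglongrightarrow> D w"
      using t by auto
    have "(\<lambda>i. integral\<^sup>L M (\<lambda>w. (F (X i) w - F t0 w) / (X i - t0))) \<longlonglongrightarrow> integral\<^sup>L M D"
      by (rule integral_dominated_convergence[OF Dm meas W t' b])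
    moreover have eq: "integral\<^sup>L M (\<lambda>w. (F (X i) w - F t0 w) / (X i - t0))
       = (integral\<^sup>L M (F (X i)) - integral\<^sup>L M (F t0)) / (X i - t0)" for i
      using int[of "X i"] int[of t0] X(1)[of i] T
      by (subst integral_divide_zero, subst Bochner_Integration.integral_diff) auto
    moreover have "integrable M D"
      by (rule integrable_dominated_convergence[OF Dm meas W t' b])
    ultimately show ?thesis by (simp only: eq simp_thms)
  qed
  obtain e where e: "e > 0" "ball t0 e \<subseteq> T" using T open_contains_ball by blast
  \<comment> \<open>\<open>seq\<close> yields integrability of \<open>D\<close> only once some
    admissible sequence is exhibited. The 2 keeps all terms strictly inside the ball.\<close>
  define X where "X n = t0 + e / (real n + 2)" for n
  have "X i \<in> T - {t0}" for i
  proof -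
    have "e / (real i + 2) < e" using e(1) by (simp add: divide_less_eq)
    then show ?thesis using e by (auto simp: X_def dist_real_def subset_iff)
  qed
  moreover have "X \<longlonglongrightarrow> t0"
  proof -
    have "(\<lambda>n. e / (real n + 2)) \<longlonglongrightarrow> 0" by real_asymp
    from tendsto_add[OF tendsto_const this, of t0] show ?thesis by (simp add: X_def[abs_def])
  qed
  ultimately show "integrable M D" using seq by blast
  have "((\<lambda>t. (integral\<^sup>L M (F t) - integral\<^sup>L M (F t0)) / (t - t0)) \<longlongrightarrow> integral\<^sup>L M D) (at t0 within T)"
    unfolding tendsto_at_iff_sequentially comp_def using seq by blast
  then show "((\<lambda>t. integral\<^sup>L M (F t)) has_real_derivative integral\<^sup>L M D) (at t0)"
    unfolding has_field_derivative_iff using at_within_open[OF T(2,1)] by simp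
qed

text \<open>Mean value theorem: the intermediate point is bounded in absolute value by
  \<open>\<bar>u\<bar> + \<bar>v\<bar>\<close>. This weight is symmetric in \<open>u\<close> and
  \<open>v\<close>, so one order of the points suffices.\<close>

lemma poly_growth_lipschitz:
  assumes d: "\<And>x. (f has_real_derivative f' x) (at x)"
    and C: "C \<ge> 0" "\<And>x. \<bar>f' x\<bar> \<le> C * (1 + \<bar>x\<bar>) ^ r"
  shows "\<bar>f u - f v\<bar> \<le> \<bar>u - v\<bar> * (C * (1 + \<bar>u\<bar> + \<bar>v\<bar>) ^ r)"
proof -
  have "\<bar>f u - f v\<bar> \<le> \<bar>u - v\<bar> * (C * (1 + \<bar>u\<bar> + \<bar>v\<bar>) ^ r)" if "v < u" for u v
  proof -
    obtain z where z: "v < z" "z < u" "f u - f v = (u - v) * f' z"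
      using MVT2[of v u f f'] \<open>v < u\<close> d by blast
    have "\<bar>f' z\<bar> \<le> C * (1 + \<bar>u\<bar> + \<bar>v\<bar>) ^ r"
      using z C(1) by (intro order_trans[OF C(2)] mult_left_mono power_mono) auto
    then show ?thesis using z by (simp add: abs_mult mult_left_mono)
  qed
  from this[of u v] this[of v u] show ?thesis
    by (cases u v rule: linorder_cases) (auto simp: abs_minus_commute add_ac)
qed

lemma poly_growth_average:
  assumes \<mu>: "all_moments \<mu>" and f: "poly_growth f" "f \<in> borel_measurable borel"
  shows "poly_growth (\<lambda>y. \<integral>x. f (y + c * x) \<partial>\<mu>)"
proof -
  obtain C r where C: "C \<ge> 0" "\<And>x. \<bar>f x\<bar> \<le> C * (1 + \<bar>x\<bar>) ^ r"
    using poly_growthE[OF f(1)] by metis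
  have i: "integrable \<mu> (\<lambda>x. (1 + \<bar>x\<bar>) ^ r)" using \<mu> by (auto simp: all_moments_def)
  note f(2)[measurable]
  have "\<bar>\<integral>x. f (y + c * x) \<partial>\<mu>\<bar> \<le> (C * (1 + \<bar>c\<bar>) ^ r * (\<integral>x. (1 + \<bar>x\<bar>) ^ r \<partial>\<mu>)) * (1 + \<bar>y\<bar>) ^ r" for y
  proof -
    have "integrable \<mu> (\<lambda>x. f (y + c * x))"
      using f(1) by (intro all_moments_integrable[OF \<mu>] poly_growth_affine) measurable
    then have "\<bar>\<integral>x. f (y + c * x) \<partial>\<mu>\<bar> \<le> (\<integral>x. C * ((1 + \<bar>y\<bar>) * ((1 + \<bar>c\<bar>) * (1 + \<bar>x\<bar>))) ^ r \<partial>\<mu>)"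
      using i by (intro order_trans[OF integral_abs_bound] integral_mono
         poly_growth_affine_le[OF C(2,1)]) (auto simp: power_mult_distrib)
    also have "\<dots> = (C * (1 + \<bar>c\<bar>) ^ r * (\<integral>x. (1 + \<bar>x\<bar>) ^ r \<partial>\<mu>)) * (1 + \<bar>y\<bar>) ^ r"
      by (simp add: power_mult_distrib mult_ac)
    finally show ?thesis .
  qed
  then show ?thesis unfolding poly_growth_def by blast
qed

lemma convex_on_affine_comp:
  fixes h :: "real \<Rightarrow> real"
  assumes "convex_on UNIV h"
  shows "convex_on UNIV (\<lambda>x. h (d + c * x))"
proof (rule convex_onI)
  fix t x y :: real assume t: "0 < t" "t < 1"
  have "d + c * ((1 - t) *\<^sub>R x + t *\<^sub>R y) = (1 - t) *\<^sub>R (d + c * x) + t *\<^sub>R (d + c * y)"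
    by (simp add: algebra_simps)
  then show "h (d + c * ((1 - t) *\<^sub>R x + t *\<^sub>R y)) \<le> (1 - t) * h (d + c * x) + t * h (d + c * y)"
    using convex_onD[OF assms, of t "d + c * x" "d + c * y"] t by simp
qed simp

text \<open>Convexity in the position \<open>y\<close> keeps averages inside the test class;
  convexity in the scale \<open>c\<close> supplies the function to which Jensen's inequality is
  applied along the path.\<close>

lemma convex_on_average:
  assumes \<mu>: "all_moments \<mu>" and f: "poly_growth f" "convex_on UNIV f"
  shows "convex_on UNIV (\<lambda>y. \<integral>x. f (y + c * x) \<partial>\<mu>)"
    and "convex_on UNIV (\<lambda>c. \<integral>x. f (y + c * x) \<partial>\<mu>)"
proof -
  have m[measurable]: "f \<in> borel_measurable borel"
    using convex_on_continuous[OF open_UNIV f(2)] by (rule borel_measurable_continuous_onI)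
  have i: "integrable \<mu> (\<lambda>x. f (y + c * x))" for c y
    using f m by (intro all_moments_integrable[OF \<mu>] poly_growth_affine) measurable
  show "convex_on UNIV (\<lambda>y. \<integral>x. f (y + c * x) \<partial>\<mu>)"
  proof (rule convex_onI)
    fix t y z :: real assume t: "0 < t" "t < 1"
    have "(\<integral>x. f ((1 - t) *\<^sub>R y + t *\<^sub>R z + c * x) \<partial>\<mu>) \<le> (\<integral>x. (1 - t) * f (y + c * x) + t * f (z + c * x) \<partial>\<mu>)"
    proof (rule integral_mono)
      fix x
      have "(1 - t) *\<^sub>R y + t *\<^sub>R z + c * x = (1 - t) *\<^sub>R (y + c * x) + t *\<^sub>R (z + c * x)"
        by (simp add: algebra_simps)
      then show "f ((1 - t) *\<^sub>R y + t *\<^sub>R z + c * x) \<le> (1 - t) * f (y + c * x) + t * f (z + c * x)"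
        using convex_onD[OF f(2), of t "y + c * x" "z + c * x"] t by simp
    qed (use i in auto)
    also have "\<dots> = (1 - t) * (\<integral>x. f (y + c * x) \<partial>\<mu>) + t * (\<integral>x. f (z + c * x) \<partial>\<mu>)"
      using i by simp
    finally show "(\<integral>x. f ((1 - t) *\<^sub>R y + t *\<^sub>R z + c * x) \<partial>\<mu>) \<le> \<dots>" .
  qed simp
  show "convex_on UNIV (\<lambda>c. \<integral>x. f (y + c * x) \<partial>\<mu>)"
  proof (rule convex_onI)
    fix t b c :: real assume t: "0 < t" "t < 1"
    have "(\<integral>x. f (y + ((1 - t) *\<^sub>R b + t *\<^sub>R c) * x) \<partial>\<mu>) \<le> (\<integral>x. (1 - t) * f (y + b * x) + t * f (y + c * x) \<partial>\<mu>)"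
    proof (rule integral_mono)
      fix x
      have "y + ((1 - t) *\<^sub>R b + t *\<^sub>R c) * x = (1 - t) *\<^sub>R (y + b * x) + t *\<^sub>R (y + c * x)"
        by (simp add: algebra_simps)
      then show "f (y + ((1 - t) *\<^sub>R b + t *\<^sub>R c) * x) \<le> (1 - t) * f (y + b * x) + t * f (y + c * x)"
        using convex_onD[OF f(2), of t "y + b * x" "y + c * x"] t by simp
    qed (use i in auto)
    also have "\<dots> = (1 - t) * (\<integral>x. f (y + b * x) \<partial>\<mu>) + t * (\<integral>x. f (y + c * x) \<partial>\<mu>)"
      using i by simp
    finally show "(\<integral>x. f (y + ((1 - t) *\<^sub>R b + t *\<^sub>R c) * x) \<partial>\<mu>) \<le> \<dots>" .
  qed simp
qed

section \<open>Closure properties of the test functions\<close>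

lemma convex_C2_measurable:
  assumes "convex_C2 f f' f''"
  shows "f \<in> borel_measurable borel" "f' \<in> borel_measurable borel" "f'' \<in> borel_measurable borel"
    "continuous_on UNIV f" "continuous_on UNIV f'" "continuous_on UNIV f''"
proof -
  show c: "continuous_on UNIV f" "continuous_on UNIV f'" "continuous_on UNIV f''"
    using assms convex_on_continuous[of UNIV f'']
    by (auto simp: convex_C2_def intro!: continuous_at_imp_continuous_on DERIV_isCont)
  then show "f \<in> borel_measurable borel" "f' \<in> borel_measurable borel" "f'' \<in> borel_measurable borel"
    by (auto intro: borel_measurable_continuous_onI)
qed

text \<open>The second derivative picks up \<open>c\<^sup>2\<close>, so convexity survives negative
  \<open>c\<close> as well; the case \<open>c = -1\<close> gives the reflection used for negative
  coefficients.\<close>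

lemma convex_C2_affine:
  assumes "convex_C2 f f' f''"
  shows "convex_C2 (\<lambda>x. f (d + c * x)) (\<lambda>x. c * f' (d + c * x)) (\<lambda>x. c\<^sup>2 * f'' (d + c * x))"
proof -
  have chain: "((\<lambda>x. h (d + c * x)) has_real_derivative c * h' (d + c * x)) (at x)"
    if "\<And>x. (h has_real_derivative h' x) (at x)" for h h' :: "real \<Rightarrow> real" and x
  proof -
    have "((\<lambda>x. d + c * x) has_real_derivative c) (at x)"
      by (auto intro!: derivative_eq_intros)
    from DERIV_chain2[OF that this] show ?thesis by (simp add: mult.commute)
  qed
  have "((\<lambda>x. f (d + c * x)) has_real_derivative c * f' (d + c * x)) (at x)" for x
    using assms unfolding convex_C2_def by (intro chain) auto
  moreover have "((\<lambda>x. c * f' (d + c * x)) has_real_derivative c\<^sup>2 * f'' (d + c * x)) (at x)" for x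
    using assms DERIV_cmult[OF chain[of f' f''], of c x] unfolding convex_C2_def
    by (simp add: power2_eq_square mult.assoc)
  ultimately show ?thesis
    using assms unfolding convex_C2_def
    by (auto intro!: poly_growth_affine poly_growth_cmult convex_on_affine_comp convex_on_cmul)
qed

lemma has_real_derivative_average:
  assumes \<mu>: "all_moments \<mu>"
    and f: "\<And>x. (f has_real_derivative f' x) (at x)" "poly_growth f" "poly_growth f'"
  shows "((\<lambda>y. \<integral>x. f (y + x) \<partial>\<mu>) has_real_derivative (\<integral>x. f' (y + x) \<partial>\<mu>)) (at y)"
proof -
  have [measurable]: "f \<in> borel_measurable borel"
    by (intro borel_measurable_continuous_onI continuous_at_imp_continuous_on ballI DERIV_isCont[OF f(1)])
  obtain C r where C: "C \<ge> 0" "\<And>x. \<bar>f' x\<bar> \<le> C * (1 + \<bar>x\<bar>) ^ r"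
    using poly_growthE[OF f(3)] by metis
  have int: "integrable \<mu> (\<lambda>x. f (t + x))" for t
    using poly_growth_affine[OF f(2), of t 1] by (intro all_moments_integrable[OF \<mu>]) auto
  have lip: "\<bar>f (t + x) - f (y + x)\<bar> \<le> \<bar>t - y\<bar> * ((C * (2 * (1 + \<bar>y\<bar>)) ^ r) * (1 + \<bar>x\<bar>) ^ r)"
    if t: "t \<in> ball y 1" for t x
  proof -
    \<comment> \<open>A bound uniform over \<open>t\<close> within distance 1 of \<open>y\<close>,
      so that the dominating function depends on \<open>x\<close> only.\<close>
    have a: "1 + \<bar>t + x\<bar> + \<bar>y + x\<bar> \<le> (2 * (1 + \<bar>y\<bar>)) * (1 + \<bar>x\<bar>)"
    proof -
      have "\<bar>t + x\<bar> \<le> 1 + \<bar>y\<bar> + \<bar>x\<bar>" "\<bar>y + x\<bar> \<le> \<bar>y\<bar> + \<bar>x\<bar>"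
        using t by (auto simp: dist_real_def)
      moreover have "(2 * (1 + \<bar>y\<bar>)) * (1 + \<bar>x\<bar>) = 2 + 2 * \<bar>y\<bar> + 2 * \<bar>x\<bar> + 2 * (\<bar>y\<bar> * \<bar>x\<bar>)"
        by (simp add: algebra_simps)
      moreover have "0 \<le> \<bar>y\<bar> * \<bar>x\<bar>" by simp
      ultimately show ?thesis by linarith
    qed
    have "\<bar>f (t + x) - f (y + x)\<bar> \<le> \<bar>(t + x) - (y + x)\<bar> * (C * (1 + \<bar>t + x\<bar> + \<bar>y + x\<bar>) ^ r)"
      by (rule poly_growth_lipschitz[OF f(1) C])
    also have "\<dots> \<le> \<bar>(t + x) - (y + x)\<bar> * (C * ((2 * (1 + \<bar>y\<bar>)) * (1 + \<bar>x\<bar>)) ^ r)"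
      using C(1) a by (intro mult_left_mono power_mono) auto
    finally show ?thesis by (simp add: power_mult_distrib mult_ac)
  qed
  have W: "integrable \<mu> (\<lambda>x. (C * (2 * (1 + \<bar>y\<bar>)) ^ r) * (1 + \<bar>x\<bar>) ^ r)"
    using \<mu> by (auto simp: all_moments_def)
  have D: "((\<lambda>t. f (t + x)) has_real_derivative f' (y + x)) (at y)" for x
    using f(1)[of "y + x"] by (simp add: DERIV_shift)
  show ?thesis
    by (rule has_real_derivative_integral(2)[of "ball y 1", OF int _ _ D lip W]) auto
qed

text \<open>Integrating out one independent summand leaves a test function of the other; this makes
  the comparison stable under convolution.\<close>

lemma convex_C2_average:
  assumes \<mu>: "all_moments \<mu>" and f: "convex_C2 f f' f''"
  shows "convex_C2 (\<lambda>y. \<integral>x. f (y + x) \<partial>\<mu>) (\<lambda>y. \<integral>x. f' (y + x) \<partial>\<mu>) (\<lambda>y. \<integral>x. f'' (y + x) \<partial>\<mu>)"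
  using f convex_C2_measurable[OF f] poly_growth_average[OF \<mu>, where c = 1]
    convex_on_average(1)[OF \<mu>, where c = 1] has_real_derivative_average[OF \<mu>]
  unfolding convex_C2_def by auto

text \<open>Formally the tests are the functions with nonnegative fourth derivative, so this is a
  4-convex stochastic order. Cubic polynomials and their negatives are tests, hence comparable laws
  share their first three moments.\<close>

definition C2_convex_le :: "real measure \<Rightarrow> real measure \<Rightarrow> bool" where
  "C2_convex_le \<mu> \<nu> \<longleftrightarrow> all_moments \<mu> \<and> all_moments \<nu> \<and>
     (\<forall>f f' f''. convex_C2 f f' f'' \<longrightarrow> integral\<^sup>L \<mu> f \<le> integral\<^sup>L \<nu> f)"

text \<open>The factors are exchanged one at a time: the first exchange tests with the average of
  \<open>f\<close> over \<open>\<nu>\<close>, the second with the translates of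
  \<open>f\<close>.\<close>

lemma C2_convex_le_convolution:
  assumes 1: "C2_convex_le \<mu> \<mu>'" and 2: "C2_convex_le \<nu> \<nu>'"
  shows "C2_convex_le (\<mu> \<star> \<nu>) (\<mu>' \<star> \<nu>')"
proof -
  have m: "all_moments \<mu>" "all_moments \<mu>'" "all_moments \<nu>" "all_moments \<nu>'"
    using 1 2 by (auto simp: C2_convex_le_def)
  have "integral\<^sup>L (\<mu> \<star> \<nu>) f \<le> integral\<^sup>L (\<mu>' \<star> \<nu>') f" if f: "convex_C2 f f' f''" for f f' f''
  proof -
    have fg: "poly_growth f" "f \<in> borel_measurable borel"
      using f convex_C2_measurable[OF f] by (auto simp: convex_C2_def)
    note a = convex_C2_average[OF m(3) f]  convex_C2_average[OF m(4) f]
    have "integral\<^sup>L (\<mu> \<star> \<nu>) f = (\<integral>x. (\<integral>y. f (x + y) \<partial>\<nu>) \<partial>\<mu>)"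
      by (rule integral_convolution[OF m(1,3) fg])
    also have "\<dots> \<le> (\<integral>x. (\<integral>y. f (x + y) \<partial>\<nu>) \<partial>\<mu>')"
      using 1 a(1) unfolding C2_convex_le_def by blast
    also have "\<dots> \<le> (\<integral>x. (\<integral>y. f (x + y) \<partial>\<nu>') \<partial>\<mu>')"
    proof (rule integral_mono)
      show "integrable \<mu>' (\<lambda>x. \<integral>y. f (x + y) \<partial>\<nu>)" "integrable \<mu>' (\<lambda>x. \<integral>y. f (x + y) \<partial>\<nu>')"
        using a convex_C2_measurable(1)[OF a(1)] convex_C2_measurable(1)[OF a(2)]
        by (auto intro!: all_moments_integrable[OF m(2)] simp: convex_C2_def)
      show "(\<integral>y. f (x + y) \<partial>\<nu>) \<le> (\<integral>y. f (x + y) \<partial>\<nu>')" for x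
        using 2 convex_C2_affine[OF f, of x 1] unfolding C2_convex_le_def by auto
    qed
    also have "\<dots> = integral\<^sup>L (\<mu>' \<star> \<nu>') f"
      by (rule integral_convolution[OF m(2,4) fg, symmetric])
    finally show ?thesis .
  qed
  then show ?thesis using m by (auto simp: C2_convex_le_def all_moments_convolution)
qed

section \<open>Gamma distributions\<close>

lemma gamma_density_nonneg: "\<alpha> > 0 \<Longrightarrow> gamma_density \<alpha> \<beta> x \<ge> 0"
  by (auto simp: gamma_density_def intro!: mult_nonneg_nonneg divide_nonneg_nonneg Gamma_real_nonneg)

lemma gamma_density_measurable[measurable]: "gamma_density \<alpha> \<beta> \<in> borel_measurable borel"
  unfolding gamma_density_def[abs_def] by measurable

lemma sets_gamma_distribution[simp, measurable_cong]: "sets (gamma_distribution \<alpha> \<beta>) = sets borel"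
  by (simp add: gamma_distribution_def)

lemma nn_integral_gamma_density:
  assumes \<alpha>: "\<alpha> > 0" and \<beta>: "\<beta> > 0"
  shows "(\<integral>\<^sup>+x. ennreal (gamma_density \<alpha> \<beta> x) \<partial>lborel) = 1"
proof -
  let ?f = "\<lambda>t. ennreal (indicator {0..} t * t powr (\<alpha> - 1) / exp t)"
  have G: "Gamma \<alpha> > 0" using \<alpha> by (rule Gamma_real_pos)
  \<comment> \<open>The density is rewritten as Euler's integrand at \<open>\<beta> * x\<close>; the
    summand \<open>0 +\<close> is kept to match the affine substitution rule with offset 0.\<close>
  have eq: "ennreal (gamma_density \<alpha> \<beta> x) = ennreal (\<beta> / Gamma \<alpha>) * ?f (0 + \<beta> * x)" for x
  proof -
    have "\<beta> powr \<alpha> = \<beta> * \<beta> powr (\<alpha> - 1)"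
      using \<beta> by (simp add: powr_diff)
    then have "gamma_density \<alpha> \<beta> x = (\<beta> / Gamma \<alpha>) * (indicator {0..} (\<beta> * x) * (\<beta> * x) powr (\<alpha> - 1) / exp (\<beta> * x))"
      using \<beta> by (cases "x = 0") (auto simp: gamma_density_def powr_mult exp_minus field_simps indicator_def mult_le_0_iff zero_le_mult_iff)
    moreover have "\<beta> / Gamma \<alpha> \<ge> 0" using G \<beta> by simp
    ultimately show ?thesis
      by (simp only: add_0 ennreal_mult'[of "\<beta> / Gamma \<alpha>", symmetric])
  qed
  have "(\<integral>\<^sup>+x. ennreal (gamma_density \<alpha> \<beta> x) \<partial>lborel) = ennreal (\<beta> / Gamma \<alpha>) * (\<integral>\<^sup>+x. ?f (0 + \<beta> * x) \<partial>lborel)"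
    unfolding eq by (rule nn_integral_cmult) measurable
  also have "\<dots> = ennreal (1 / Gamma \<alpha>) * (ennreal \<bar>\<beta>\<bar> * (\<integral>\<^sup>+x. ?f (0 + \<beta> * x) \<partial>lborel))"
    using \<beta> G by (simp add: mult.assoc[symmetric] ennreal_mult'[symmetric])
  also have "ennreal \<bar>\<beta>\<bar> * (\<integral>\<^sup>+x. ?f (0 + \<beta> * x) \<partial>lborel) = (\<integral>\<^sup>+x. ?f x \<partial>lborel)"
    using \<beta> by (subst nn_integral_real_affine[where c = \<beta> and t = 0, of ?f]) auto
  also have "\<dots> = ennreal (Gamma \<alpha>)"
    using Gamma_conv_nn_integral_real[OF \<alpha>] by simp
  finally show ?thesis using G by (simp add: ennreal_mult'[symmetric])
qed

lemma prob_space_gamma_distribution: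
  assumes "\<alpha> \<ge> 0" "\<beta> > 0"
  shows "prob_space (gamma_distribution \<alpha> \<beta>)"
proof (cases "\<alpha> = 0")
  case False
  then show ?thesis
    using assms nn_integral_gamma_density[of \<alpha> \<beta>]
    by (intro prob_spaceI) (simp add: gamma_distribution_def emeasure_density)
qed (simp add: gamma_distribution_def prob_space_return)

lemma integral_gamma_distribution:
  assumes "\<alpha> > 0" "f \<in> borel_measurable borel"
  shows "integral\<^sup>L (gamma_distribution \<alpha> \<beta>) f = (\<integral>x. gamma_density \<alpha> \<beta> x * f x \<partial>lborel)"
    and "integrable (gamma_distribution \<alpha> \<beta>) f \<longleftrightarrow> integrable lborel (\<lambda>x. gamma_density \<alpha> \<beta> x * f x)"
  using assms gamma_density_nonneg[of \<alpha> \<beta>]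
  by (simp_all add: gamma_distribution_def integral_density integrable_density)

lemma gamma_density_size_bias:
  assumes "\<alpha> > 0" "\<beta> > 0"
  shows "gamma_density \<alpha> \<beta> x * x = \<alpha> / \<beta> * gamma_density (\<alpha> + 1) \<beta> x"
proof (cases "x \<le> 0")
  case False
  have "\<alpha> \<notin> \<int>\<^sub>\<le>\<^sub>0" using assms by (auto elim!: nonpos_Ints_cases)
  then have "Gamma (\<alpha> + 1) = \<alpha> * Gamma \<alpha>" by (rule Gamma_plus1)
  moreover have "Gamma \<alpha> \<noteq> 0" using Gamma_real_pos[OF assms(1)] by simp
  moreover have "\<beta> powr (\<alpha> + 1) = \<beta> * \<beta> powr \<alpha>" using assms by (simp add: powr_add)
  moreover have "x powr \<alpha> = x * x powr (\<alpha> - 1)" using False by (simp add: powr_diff)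
  ultimately show ?thesis using False assms by (simp add: gamma_density_def field_simps)
qed (simp add: gamma_density_def)

text \<open>Multiplying the density by \<open>x\<close> raises the shape by one, because
  \<open>Gamma (\<alpha> + 1) = \<alpha> * Gamma \<alpha>\<close>. At shape zero both sides vanish:
  the point mass sits at 0 and the factor \<open>\<alpha> / \<beta>\<close> is 0.\<close>

lemma gamma_distribution_size_bias:
  assumes \<alpha>: "\<alpha> \<ge> 0" and \<beta>: "\<beta> > 0" and f[measurable]: "f \<in> borel_measurable borel"
  shows "integral\<^sup>L (gamma_distribution \<alpha> \<beta>) (\<lambda>x. x * f x) = \<alpha> / \<beta> * integral\<^sup>L (gamma_distribution (\<alpha> + 1) \<beta>) f"
    and "integrable (gamma_distribution (\<alpha> + 1) \<beta>) f \<Longrightarrow> integrable (gamma_distribution \<alpha> \<beta>) (\<lambda>x. x * f x)"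
proof -
  have *: "gamma_density \<alpha> \<beta> x * (x * f x) = \<alpha> / \<beta> * (gamma_density (\<alpha> + 1) \<beta> x * f x)" if "\<alpha> \<noteq> 0" for x
    using gamma_density_size_bias[of \<alpha> \<beta> x] that \<alpha> \<beta> by (simp add: mult.assoc[symmetric])
  show "integral\<^sup>L (gamma_distribution \<alpha> \<beta>) (\<lambda>x. x * f x) = \<alpha> / \<beta> * integral\<^sup>L (gamma_distribution (\<alpha> + 1) \<beta>) f"
  proof (cases "\<alpha> = 0")
    case True
    then show ?thesis by (simp add: gamma_distribution_def integral_return)
  next
    case False
    then show ?thesis using \<alpha> * by (simp add: integral_gamma_distribution)
  qed
  show "integrable (gamma_distribution \<alpha> \<beta>) (\<lambda>x. x * f x)"
    if "integrable (gamma_distribution (\<alpha> + 1) \<beta>) f"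
  proof (cases "\<alpha> = 0")
    case True
    then show ?thesis
      by (auto simp: gamma_distribution_def integrable_iff_bounded nn_integral_return)
  next
    case False
    then show ?thesis using \<alpha> * that by (simp add: integral_gamma_distribution)
  qed
qed

text \<open>Split off one factor \<open>1 + \<bar>x\<bar>\<close>; size biasing trades the extra
  \<open>x\<close> for a larger shape, so the induction on the exponent must leave the shape
  arbitrary.\<close>

lemma all_moments_gamma_distribution:
  assumes "\<alpha> \<ge> 0" "\<beta> > 0"
  shows "all_moments (gamma_distribution \<alpha> \<beta>)"
proof -
  have "integrable (gamma_distribution \<alpha> \<beta>) (\<lambda>x. (1 + \<bar>x\<bar>) ^ r)" for r
    using assms(1)
  proof (induction r arbitrary: \<alpha>)
    case 0
    then interpret prob_space "gamma_distribution \<alpha> \<beta>"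
      using assms by (intro prob_space_gamma_distribution)
    show ?case by simp
  next
    case (Suc r)
    have "integrable (gamma_distribution \<alpha> \<beta>) (\<lambda>x. x * (1 + \<bar>x\<bar>) ^ r)"
      using Suc assms by (intro gamma_distribution_size_bias(2)) auto
    from integrable_abs[OF this] Suc
    have "integrable (gamma_distribution \<alpha> \<beta>) (\<lambda>x. (1 + \<bar>x\<bar>) ^ r + \<bar>x * (1 + \<bar>x\<bar>) ^ r\<bar>)"
      by (intro Bochner_Integration.integrable_add) auto
    then show ?case by (simp add: abs_mult distrib_right power_abs)
  qed
  with prob_space_gamma_distribution[OF assms] show ?thesis by (simp add: all_moments_def)
qed

lemma convolution_return_0:
  assumes "prob_space \<mu>" "sets \<mu> = sets borel"
  shows "\<mu> \<star> return borel (0::real) = \<mu>"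
proof (rule measure_eqI)
  interpret prob_space \<mu> by fact
  interpret R: prob_space "return borel (0::real)" by (rule prob_space_return) simp
  have [measurable_cong]: "sets \<mu> = sets borel" by fact
  fix A assume "A \<in> sets (\<mu> \<star> return borel 0)"
  then have [measurable]: "A \<in> sets borel" by simp
  have "emeasure (\<mu> \<star> return borel 0) A = (\<integral>\<^sup>+x. \<integral>\<^sup>+y. indicator A (x + y) \<partial>return borel 0 \<partial>\<mu>)"
    using assms by (intro convolution_emeasure') (auto intro: finite_measure_axioms R.finite_measure_axioms)
  also have "\<dots> = (\<integral>\<^sup>+x. indicator A x \<partial>\<mu>)"
    by (simp add: nn_integral_return)
  also have "\<dots> = emeasure \<mu> A" using assms(2) by (subst nn_integral_indicator) auto
  finally show "emeasure (\<mu> \<star> return borel 0) A = emeasure \<mu> A" .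
qed (use assms in simp)

text \<open>For positive \<open>x\<close> the substitution \<open>y = x * t\<close> separates a
  factor \<open>K\<close> depending on \<open>x\<close> from the Beta integral in \<open>t\<close>,
  and the Beta function is a quotient of Gamma values. For other \<open>x\<close> one of the two
  densities is always zero.\<close>

lemma gamma_density_convolution:
  assumes \<alpha>: "\<alpha> > 0" and \<alpha>': "\<alpha>' > 0" and \<beta>: "\<beta> > 0"
  shows "(\<integral>\<^sup>+y. ennreal (gamma_density \<alpha> \<beta> (x - y)) * ennreal (gamma_density \<alpha>' \<beta> y) \<partial>lborel)
    = ennreal (gamma_density (\<alpha> + \<alpha>') \<beta> x)"
proof (cases "x > 0")
  case False
  then have "ennreal (gamma_density \<alpha> \<beta> (x - y)) * ennreal (gamma_density \<alpha>' \<beta> y) = 0" for y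
    by (auto simp: gamma_density_def)
  then have "(\<integral>\<^sup>+y. ennreal (gamma_density \<alpha> \<beta> (x - y)) * ennreal (gamma_density \<alpha>' \<beta> y) \<partial>lborel) = 0"
    by (simp only: nn_integral_const) simp
  then show ?thesis using False by (simp add: gamma_density_def)
next
  case x: True
  define B where "B t = indicator {0..1} t * (t powr (\<alpha>' - 1) * (1 - t) powr (\<alpha> - 1))" for t :: real
  define K where "K = \<beta> powr \<alpha> / Gamma \<alpha> * (\<beta> powr \<alpha>' / Gamma \<alpha>') * x powr (\<alpha> + \<alpha>' - 2) * exp (- \<beta> * x)"
  have G: "Gamma \<alpha> > 0" "Gamma \<alpha>' > 0" "Gamma (\<alpha> + \<alpha>') > 0" using \<alpha> \<alpha>' by (auto intro: Gamma_real_pos)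
  have K: "K \<ge> 0" using G by (simp add: K_def)
  have eq: "gamma_density \<alpha> \<beta> (x - (0 + x * t)) * gamma_density \<alpha>' \<beta> (0 + x * t) = K * B t" for t
  proof (cases "0 < t \<and> t < 1")
    case True
    then have "x - x * t > 0" "x * t > 0" "x - x * t = x * (1 - t)" using x by (auto simp: algebra_simps)
    moreover have "exp (- \<beta> * (x * (1 - t))) * exp (- \<beta> * (x * t)) = exp (- \<beta> * x)"
      by (simp add: exp_add[symmetric] algebra_simps)
    moreover have "x powr (\<alpha> - 1) * x powr (\<alpha>' - 1) = x powr (\<alpha> + \<alpha>' - 2)"
      using x by (simp add: powr_add[symmetric])
    moreover have "gamma_density \<alpha> \<beta> (x * (1 - t)) * gamma_density \<alpha>' \<beta> (x * t) =
      \<beta> powr \<alpha> / Gamma \<alpha> * (\<beta> powr \<alpha>' / Gamma \<alpha>') * (x powr (\<alpha> - 1) * x powr (\<alpha>' - 1)) *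
       (exp (- \<beta> * (x * (1 - t))) * exp (- \<beta> * (x * t))) * (t powr (\<alpha>' - 1) * (1 - t) powr (\<alpha> - 1))"
      using True x by (simp add: gamma_density_def powr_mult mult_le_0_iff)
    ultimately show ?thesis using True by (simp add: B_def K_def)
  \<comment> \<open>At \<open>t = 0\<close> and \<open>t = 1\<close> both sides are 0, on the right
    because \<open>0 powr _ = 0\<close>.\<close>
  next
    case False
    then have "t \<le> 0 \<or> x \<le> x * t" "t < 0 \<or> t = 0 \<or> t = 1 \<or> t > 1" using x by (auto simp: mult_le_cancel_left1)
    then show ?thesis using x by (auto simp: gamma_density_def B_def mult_le_0_iff)
  qed
  have "(\<integral>\<^sup>+y. ennreal (gamma_density \<alpha> \<beta> (x - y)) * ennreal (gamma_density \<alpha>' \<beta> y) \<partial>lborel)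
    = ennreal \<bar>x\<bar> * (\<integral>\<^sup>+t. ennreal (gamma_density \<alpha> \<beta> (x - (0 + x * t))) * ennreal (gamma_density \<alpha>' \<beta> (0 + x * t)) \<partial>lborel)"
    using x by (intro nn_integral_real_affine) auto
  also have "\<dots> = ennreal x * (\<integral>\<^sup>+t. ennreal K * ennreal (B t) \<partial>lborel)"
    using x K by (simp only: eq ennreal_mult'[symmetric] gamma_density_nonneg[OF \<alpha>] abs_of_pos)
  also have "\<dots> = ennreal x * (ennreal K * (\<integral>\<^sup>+t. ennreal (B t) \<partial>lborel))"
    by (subst nn_integral_cmult) (auto simp: B_def[abs_def])
  also have "(\<integral>\<^sup>+t. ennreal (B t) \<partial>lborel) = ennreal (Beta \<alpha>' \<alpha>)"
  proof (rule nn_integral_has_integral_lborel)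
    show "B \<in> borel_measurable borel" unfolding B_def[abs_def] by measurable
    show "B t \<ge> 0" for t by (simp add: B_def)
    have "((\<lambda>t. if t \<in> {0..1} then t powr (\<alpha>' - 1) * (1 - t) powr (\<alpha> - 1) else 0) has_integral Beta \<alpha>' \<alpha>) UNIV"
      unfolding has_integral_restrict_UNIV by (rule has_integral_Beta_real[OF \<alpha>' \<alpha>])
    then show "(B has_integral Beta \<alpha>' \<alpha>) UNIV"
      by (rule has_integral_eq[rotated]) (auto simp: B_def)
  qed
  also have "ennreal x * (ennreal K * ennreal (Beta \<alpha>' \<alpha>)) = ennreal (x * (K * Beta \<alpha>' \<alpha>))"
    using x K by (simp add: ennreal_mult')
  also have "x * (K * Beta \<alpha>' \<alpha>) = gamma_density (\<alpha> + \<alpha>') \<beta> x"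
  proof -
    have "x powr (\<alpha> + \<alpha>' - 1) = x * x powr (\<alpha> + \<alpha>' - 2)"
      using x powr_add[of x 1 "\<alpha> + \<alpha>' - 2"] by simp
    moreover have "\<beta> powr (\<alpha> + \<alpha>') = \<beta> powr \<alpha> * \<beta> powr \<alpha>'" by (rule powr_add)
    ultimately show ?thesis
      using x G by (simp add: K_def gamma_density_def Beta_def field_simps)
  qed
  finally show ?thesis .
qed

lemma gamma_distribution_convolution:
  assumes \<alpha>: "\<alpha> \<ge> 0" and \<alpha>': "\<alpha>' \<ge> 0" and \<beta>: "\<beta> > 0"
  shows "gamma_distribution \<alpha> \<beta> \<star> gamma_distribution \<alpha>' \<beta> = gamma_distribution (\<alpha> + \<alpha>') \<beta>"
proof -
  have p: "prob_space (gamma_distribution \<alpha> \<beta>)" "prob_space (gamma_distribution \<alpha>' \<beta>)"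
    using assms by (auto intro: prob_space_gamma_distribution)
  then have fin: "finite_measure (gamma_distribution \<alpha> \<beta>)" "finite_measure (gamma_distribution \<alpha>' \<beta>)"
    by (auto simp: prob_space_def)
  consider "\<alpha>' = 0" | "\<alpha> = 0" | "\<alpha> > 0" "\<alpha>' > 0" using \<alpha> \<alpha>' by linarith
  then show ?thesis
  proof cases
    case 1
    then show ?thesis using convolution_return_0[OF p(1)] by (simp add: gamma_distribution_def)
  next
    case 2
    then show ?thesis
      using convolution_return_0[OF p(2)] convolution_commutative[OF fin]
      by (simp add: gamma_distribution_def)
  next
    case 3
    have "gamma_distribution \<alpha> \<beta> \<star> gamma_distribution \<alpha>' \<beta> =
      density lborel (\<lambda>x. \<integral>\<^sup>+y. ennreal (gamma_density \<alpha> \<beta> (x - y)) * ennreal (gamma_density \<alpha>' \<beta> y) \<partial>lborel)"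
      using 3 fin unfolding gamma_distribution_def by (simp add: convolution_density)
    then show ?thesis using 3 by (simp add: gamma_density_convolution[OF 3 \<beta>] gamma_distribution_def)
  qed
qed

text \<open>Shape one is the exponential law. With antiderivative
  \<open>F v = - exp (- \<beta> * v) * h v\<close> the boundary term at 0 gives \<open>h 0\<close>,
  and the one at infinity vanishes because \<open>h\<close> grows polynomially.\<close>

lemma exponential_integration_by_parts:
  assumes \<beta>: "\<beta> > 0"
    and h: "\<And>x. (h has_real_derivative h' x) (at x)" "continuous_on UNIV h'" "poly_growth h" "poly_growth h'"
  shows "(\<integral>v. h v \<partial>gamma_distribution 1 \<beta>) = h 0 + 1 / \<beta> * (\<integral>v. h' v \<partial>gamma_distribution 1 \<beta>)"
proof -
  note am = all_moments_gamma_distribution[of 1 \<beta>, OF _ \<beta>]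
  have ch: "continuous_on UNIV h"
    using h(1) by (auto intro!: continuous_at_imp_continuous_on DERIV_isCont)
  have m[measurable]: "h \<in> borel_measurable borel" "h' \<in> borel_measurable borel"
    using ch h(2) by (auto intro: borel_measurable_continuous_onI)
  define F where "F v = - exp (- \<beta> * v) * h v" for v
  define k where "k v = \<beta> * exp (- \<beta> * v) * h v - exp (- \<beta> * v) * h' v" for v
  have int: "integrable (gamma_distribution 1 \<beta>) h" "integrable (gamma_distribution 1 \<beta>) h'"
    using h by (auto intro!: all_moments_integrable am)
  have k_eq: "indicator {0<..} v * k v = gamma_density 1 \<beta> v * h v - 1 / \<beta> * (gamma_density 1 \<beta> v * h' v)" for v
    using \<beta> by (simp add: k_def gamma_density_def indicator_def)
  have int': "integrable lborel (\<lambda>v. gamma_density 1 \<beta> v * h v)" "integrable lborel (\<lambda>v. gamma_density 1 \<beta> v * h' v)"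
    using int by (simp_all add: integral_gamma_distribution)
  have "(LBINT v=0..\<infinity>. k v) = 0 - (- h 0)"
  proof (rule interval_integral_FTC_integrable)
    show "(F has_vector_derivative k v) (at v)" for v
      unfolding F_def k_def has_real_derivative_iff_has_vector_derivative[symmetric]
      by (auto intro!: derivative_eq_intros h(1))
    show "isCont k v" for v
      using ch h(2) unfolding k_def by (auto intro!: continuous_intros simp: continuous_on_eq_continuous_at)
    have "einterval 0 \<infinity> = {0::real<..}" by (auto simp: einterval_def)
    then show "set_integrable lborel (einterval 0 \<infinity>) k"
      using int' by (simp add: set_integrable_def k_eq)
    have "isCont F 0"
      using ch unfolding F_def by (auto intro!: continuous_intros simp: continuous_on_eq_continuous_at)
    then have "(F \<longlongrightarrow> F 0) (at_right 0)"
      unfolding isCont_def by (rule tendsto_mono[rotated]) (simp add: at_le)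
    then show "((F \<circ> real_of_ereal) \<longlongrightarrow> - h 0) (at_right 0)"
      by (simp add: zero_ereal_def ereal_tendsto_simps F_def)
    obtain C r where C: "C \<ge> 0" "\<And>x. \<bar>h x\<bar> \<le> C * (1 + \<bar>x\<bar>) ^ r"
      using poly_growthE[OF h(3)] by metis
    have "(F \<longlongrightarrow> 0) at_top"
    proof (rule Lim_null_comparison)
      show "((\<lambda>v. C * (1 + v) ^ r * exp (- \<beta> * v)) \<longlongrightarrow> 0) at_top"
        using \<beta> by real_asymp
      show "eventually (\<lambda>v. norm (F v) \<le> C * (1 + v) ^ r * exp (- \<beta> * v)) at_top"
        using eventually_ge_at_top[of 0]
      proof eventually_elim
        case (elim v)
        then show ?case using C(2)[of v] by (simp add: F_def abs_mult mult.commute)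
      qed
    qed
    then show "((F \<circ> real_of_ereal) \<longlongrightarrow> 0) (at_left \<infinity>)"
      by (simp add: ereal_tendsto_simps)
  qed simp
  moreover have "(LBINT v=0..\<infinity>. k v) = (\<integral>v. indicator {0<..} v * k v \<partial>lborel)"
  proof -
    have "einterval 0 \<infinity> = {0::real<..}" by (auto simp: einterval_def)
    then show ?thesis by (simp add: interval_lebesgue_integral_def set_lebesgue_integral_def)
  qed
  moreover have "(\<integral>v. indicator {0<..} v * k v \<partial>lborel) =
     (\<integral>v. gamma_density 1 \<beta> v * h v \<partial>lborel) - 1 / \<beta> * (\<integral>v. gamma_density 1 \<beta> v * h' v \<partial>lborel)"
    unfolding k_eq using int' by (subst Bochner_Integration.integral_diff) auto
  ultimately show ?thesis by (simp add: integral_gamma_distribution)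
qed

text \<open>Size biasing raises the shape by one, Gamma additivity turns the extra unit of shape
  into an independent exponential summand, and integration by parts in that summand yields
  \<open>h x\<close> plus a term in \<open>h'\<close>. The \<open>h x\<close> part is exactly what
  the centring \<open>\<alpha> / \<beta>\<close> removes.\<close>

lemma gamma_stein_identity:
  assumes \<alpha>: "\<alpha> \<ge> 0" and \<beta>: "\<beta> > 0"
    and h: "\<And>x. (h has_real_derivative h' x) (at x)" "continuous_on UNIV h'" "poly_growth h" "poly_growth h'"
  shows "(\<integral>x. (x - \<alpha> / \<beta>) * h x \<partial>gamma_distribution \<alpha> \<beta>) =
    \<alpha> / \<beta>\<^sup>2 * (\<integral>x. (\<integral>v. h' (x + v) \<partial>gamma_distribution 1 \<beta>) \<partial>gamma_distribution \<alpha> \<beta>)"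
proof -
  let ?E = "gamma_distribution 1 \<beta>" and ?G = "gamma_distribution \<alpha> \<beta>"
  have m[measurable]: "h \<in> borel_measurable borel" "h' \<in> borel_measurable borel"
    using h(1,2) by (auto intro!: borel_measurable_continuous_onI continuous_at_imp_continuous_on DERIV_isCont)
  have am: "all_moments ?G" "all_moments ?E" "all_moments (gamma_distribution (\<alpha> + 1) \<beta>)"
    using \<alpha> \<beta> by (auto intro!: all_moments_gamma_distribution)
  have iG: "integrable ?G h" "integrable ?G (\<lambda>x. x * h x)"
    using h by (auto intro!: all_moments_integrable[OF am(1)] poly_growth_mult poly_growth_ident)
  have iv: "(\<integral>v. h (x + v) \<partial>?E) = h x + 1 / \<beta> * (\<integral>v. h' (x + v) \<partial>?E)" for x
  proof -
    have "((\<lambda>v. h (x + v)) has_real_derivative h' (x + v)) (at v)" for v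
      using DERIV_shift[of h "h' (x + v)" v x] h(1) by (simp add: add.commute)
    moreover have "continuous_on UNIV (\<lambda>v. h' (x + v))"
      by (intro continuous_on_compose2[OF h(2)] continuous_intros) auto
    moreover have "poly_growth (\<lambda>v. h (x + v))" "poly_growth (\<lambda>v. h' (x + v))"
      using poly_growth_affine[OF h(3), of x 1] poly_growth_affine[OF h(4), of x 1] by simp_all
    ultimately show ?thesis
      using exponential_integration_by_parts[OF \<beta>, of "\<lambda>v. h (x + v)" "\<lambda>v. h' (x + v)"] by simp
  qed
  have cm: "(\<lambda>x. \<integral>v. h' (x + v) \<partial>?E) \<in> borel_measurable borel"
  proof -
    interpret prob_space ?E using am(2) by (simp add: all_moments_def)
    show ?thesis by measurable
  qed
  have iG': "integrable ?G (\<lambda>x. \<integral>v. h' (x + v) \<partial>?E)"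
    using poly_growth_average[OF am(2) h(4) m(2), of 1] cm by (intro all_moments_integrable[OF am(1)]) auto
  have "(\<integral>x. x * h x \<partial>?G) = \<alpha> / \<beta> * (\<integral>x. h x \<partial>gamma_distribution (\<alpha> + 1) \<beta>)"
    by (rule gamma_distribution_size_bias(1)[OF \<alpha> \<beta>]) measurable
  also have "gamma_distribution (\<alpha> + 1) \<beta> = (?G \<star> ?E)"
    using gamma_distribution_convolution[OF \<alpha> _ \<beta>, of 1] by simp
  also have "(\<integral>x. h x \<partial>(?G \<star> ?E)) = (\<integral>x. h x + 1 / \<beta> * (\<integral>v. h' (x + v) \<partial>?E) \<partial>?G)"
    unfolding integral_convolution[OF am(1,2) h(3) m(1)] iv ..
  also have "\<dots> = (\<integral>x. h x \<partial>?G) + 1 / \<beta> * (\<integral>x. (\<integral>v. h' (x + v) \<partial>?E) \<partial>?G)"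
    using iG iG' by simp
  finally have "(\<integral>x. x * h x \<partial>?G) = \<alpha> / \<beta> * (\<integral>x. h x \<partial>?G) + \<alpha> / \<beta>\<^sup>2 * (\<integral>x. (\<integral>v. h' (x + v) \<partial>?E) \<partial>?G)"
    by (simp add: algebra_simps power2_eq_square)
  moreover have "(\<integral>x. (x - \<alpha> / \<beta>) * h x \<partial>?G) = (\<integral>x. x * h x \<partial>?G) - \<alpha> / \<beta> * (\<integral>x. h x \<partial>?G)"
    using iG by (simp add: left_diff_distrib)
  ultimately show ?thesis by simp
qed

section \<open>Linear combinations of independent Gamma variables\<close>

lemma power_le_weight:
  assumes "\<bar>s\<bar> \<le> B * w" "w \<ge> 1" "B \<ge> (0::real)"
  shows "(1 + \<bar>s\<bar>) ^ r \<le> (1 + B) ^ r * w ^ r"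
proof -
  have "1 + \<bar>s\<bar> \<le> (1 + B) * w" using assms by (simp add: algebra_simps)
  then show ?thesis by (subst power_mult_distrib[symmetric]) (auto intro!: power_mono)
qed

text \<open>The shapes are constrained at every index, also outside \<open>I\<close>, because the
  product measure is built from a family of probability spaces indexed by all naturals.\<close>

locale gamma_family =
  fixes I :: "nat set" and \<alpha> :: "nat \<Rightarrow> real" and \<beta> :: real
  assumes finite_I: "finite I" and \<alpha>_pos: "\<And>i. \<alpha> i > 0" and \<beta>_pos: "\<beta> > 0"
begin

definition P :: "(nat \<Rightarrow> real) measure" where
  "P = Pi\<^sub>M I (\<lambda>i. gamma_distribution (\<alpha> i) \<beta>)"

definition S :: "(nat \<Rightarrow> real) \<Rightarrow> (nat \<Rightarrow> real) \<Rightarrow> real" where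
  "S c x = (\<Sum>i\<in>I. c i * (x i - \<alpha> i / \<beta>))"

text \<open>The common dominating weight: being a product of one-variable functions, all its powers
  are integrable under the product measure.\<close>

definition W :: "(nat \<Rightarrow> real) \<Rightarrow> real" where
  "W x = (\<Prod>i\<in>I. 1 + \<bar>x i\<bar>)"

text \<open>A weighted l1 norm of the scale vector, chosen so that
  \<open>\<bar>S c x\<bar> \<le> bnd c * W x\<close>.\<close>

definition bnd :: "(nat \<Rightarrow> real) \<Rightarrow> real" where
  "bnd c = (\<Sum>i\<in>I. \<bar>c i\<bar> * (1 + \<alpha> i / \<beta>))"

sublocale prod: product_prob_space "\<lambda>i. gamma_distribution (\<alpha> i) \<beta>" I
  using \<alpha>_pos \<beta>_pos
  by (intro product_prob_spaceI prob_space_gamma_distribution) (auto simp: less_imp_le)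

lemma all_moments_factor: "all_moments (gamma_distribution (\<alpha> i) \<beta>)"
  using \<alpha>_pos \<beta>_pos by (auto intro: all_moments_gamma_distribution less_imp_le)

lemma measurable_component[measurable]: "i \<in> I \<Longrightarrow> (\<lambda>x. x i) \<in> borel_measurable P"
  using measurable_component_singleton[of i I "\<lambda>i. gamma_distribution (\<alpha> i) \<beta>"]
  unfolding P_def by (simp cong: measurable_cong_sets)

lemma measurable_S[measurable]: "S c \<in> borel_measurable P"
  unfolding S_def by measurable

lemma W_ge_1: "W x \<ge> 1"
  unfolding W_def by (intro prod_ge_1) auto

lemma integrable_W_power: "integrable P (\<lambda>x. W x ^ r)"
  unfolding P_def W_def prod_power_distrib
  using all_moments_factor finite_I
  by (intro prod.product_integrable_prod) (auto simp: all_moments_def)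

lemma abs_le_W: "i \<in> I \<Longrightarrow> \<bar>x i - \<alpha> i / \<beta>\<bar> \<le> (1 + \<alpha> i / \<beta>) * W x"
proof -
  assume i: "i \<in> I"
  have "1 * (1 + \<bar>x i\<bar>) \<le> (\<Prod>j\<in>I - {i}. 1 + \<bar>x j\<bar>) * (1 + \<bar>x i\<bar>)"
    by (intro mult_right_mono prod_ge_1) auto
  also have "\<dots> = W x"
    using i finite_I unfolding W_def by (simp add: prod.remove[of I i] mult.commute)
  finally have "1 + \<bar>x i\<bar> \<le> W x" by simp
  moreover have "0 \<le> \<alpha> i / \<beta>" using \<alpha>_pos[of i] \<beta>_pos by simp
  moreover have "\<bar>x i - \<alpha> i / \<beta>\<bar> \<le> (1 + \<alpha> i / \<beta>) * (1 + \<bar>x i\<bar>)"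
  proof -
    have "0 \<le> \<alpha> i / \<beta> * \<bar>x i\<bar>" using calculation(2) by (rule mult_nonneg_nonneg) simp
    moreover have "(1 + \<alpha> i / \<beta>) * (1 + \<bar>x i\<bar>) = 1 + \<alpha> i / \<beta> + \<bar>x i\<bar> + \<alpha> i / \<beta> * \<bar>x i\<bar>"
      by (simp add: algebra_simps)
    ultimately show ?thesis using \<open>0 \<le> \<alpha> i / \<beta>\<close> by linarith
  qed
  ultimately show ?thesis
    by (meson add_nonneg_nonneg mult_left_mono order_trans zero_le_one)
qed

lemma bnd_nonneg: "bnd c \<ge> 0"
  unfolding bnd_def using \<alpha>_pos \<beta>_pos
  by (intro sum_nonneg mult_nonneg_nonneg add_nonneg_nonneg divide_nonneg_nonneg) (auto simp: less_imp_le)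

lemma abs_S_le: "\<bar>S c x\<bar> \<le> bnd c * W x"
  unfolding S_def bnd_def sum_distrib_right
  by (rule order_trans[OF sum_abs])
    (auto simp: abs_mult mult.assoc intro!: sum_mono mult_left_mono abs_le_W)

lemma bnd_mono: "(\<And>i. i \<in> I \<Longrightarrow> \<bar>c i\<bar> \<le> \<bar>d i\<bar>) \<Longrightarrow> bnd c \<le> bnd d"
  unfolding bnd_def using \<alpha>_pos \<beta>_pos
  by (intro sum_mono mult_right_mono) (auto simp: less_imp_le add_nonneg_nonneg)

lemma integrable_S:
  assumes h: "poly_growth h" "h \<in> borel_measurable borel"
  shows "integrable P (\<lambda>x. h (S c x))"
    and "j \<in> I \<Longrightarrow> integrable P (\<lambda>x. (x j - \<alpha> j / \<beta>) * h (S c x))"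
proof -
  note h(2)[measurable]
  obtain C r where C: "C \<ge> 0" "\<And>x. \<bar>h x\<bar> \<le> C * (1 + \<bar>x\<bar>) ^ r"
    using poly_growthE[OF h(1)] by metis
  have b: "\<bar>h (S c x)\<bar> \<le> C * ((1 + bnd c) ^ r * W x ^ r)" for x
    using C(1) by (intro order_trans[OF C(2)] mult_left_mono power_le_weight abs_S_le W_ge_1 bnd_nonneg)
  have W0: "0 \<le> W x" for x using W_ge_1[of x] by simp
  show "integrable P (\<lambda>x. h (S c x))"
  proof (rule Bochner_Integration.integrable_bound)
    show "integrable P (\<lambda>x. C * ((1 + bnd c) ^ r * W x ^ r))"
      using integrable_W_power by simp
    show "AE x in P. norm (h (S c x)) \<le> norm (C * ((1 + bnd c) ^ r * W x ^ r))"
      using b by (intro AE_I2) (metis abs_ge_self order_trans real_norm_def)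
  qed measurable
  assume j: "j \<in> I"
  show "integrable P (\<lambda>x. (x j - \<alpha> j / \<beta>) * h (S c x))"
  proof (rule Bochner_Integration.integrable_bound)
    show "integrable P (\<lambda>x. (1 + \<alpha> j / \<beta>) * C * (1 + bnd c) ^ r * W x ^ (Suc r))"
      by (rule integrable_mult_right) (rule integrable_W_power)
    have "\<bar>(x j - \<alpha> j / \<beta>) * h (S c x)\<bar> \<le> (1 + \<alpha> j / \<beta>) * C * (1 + bnd c) ^ r * W x ^ (Suc r)" for x
    proof -
      have "\<bar>x j - \<alpha> j / \<beta>\<bar> * \<bar>h (S c x)\<bar> \<le> ((1 + \<alpha> j / \<beta>) * W x) * (C * ((1 + bnd c) ^ r * W x ^ r))"
        using j \<alpha>_pos[of j] \<beta>_pos W0 by (intro mult_mono abs_le_W b) (auto simp: add_nonneg_nonneg less_imp_le)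
      then show ?thesis by (simp add: abs_mult mult_ac)
    qed
    then show "AE x in P. norm ((x j - \<alpha> j / \<beta>) * h (S c x)) \<le> norm ((1 + \<alpha> j / \<beta>) * C * (1 + bnd c) ^ r * W x ^ (Suc r))"
      by (intro AE_I2) (metis abs_ge_self order_trans real_norm_def)
  qed (use j in measurable)
qed

text \<open>Fubini isolates coordinate \<open>j\<close>; the others, together with its centring,
  become a fixed shift \<open>d x\<close>. The Stein identity for
  \<open>y \<mapsto> f' (d x + c j * y)\<close> produces the factor \<open>c j\<close> by the chain
  rule, and Fubini then reassembles the full combination.\<close>

lemma stein_component:
  assumes f: "convex_C2 f f' f''" and j: "j \<in> I"
  shows "(\<integral>x. (x j - \<alpha> j / \<beta>) * f' (S c x) \<partial>P) =
    \<alpha> j / \<beta>\<^sup>2 * c j * (\<integral>x. (\<integral>v. f'' (S c x + c j * v) \<partial>gamma_distribution 1 \<beta>) \<partial>P)"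
proof -
  let ?E = "gamma_distribution 1 \<beta>" and ?G = "gamma_distribution (\<alpha> j) \<beta>"
  let ?H = "\<lambda>y. \<integral>v. f'' (y + c j * v) \<partial>?E"
  define J where "J = I - {j}"
  have I: "I = insert j J" "finite J" "j \<notin> J" using j finite_I by (auto simp: J_def)
  have pg: "poly_growth f'" "poly_growth f''" and cvx: "convex_on UNIV f''"
    using f by (auto simp: convex_C2_def)
  note m = convex_C2_measurable[OF f]
  have am: "all_moments ?E" using \<beta>_pos by (intro all_moments_gamma_distribution) auto
  have Hpg: "poly_growth ?H" by (rule poly_growth_average[OF am pg(2) m(3)])
  have Hm: "?H \<in> borel_measurable borel"
    using convex_on_continuous[OF open_UNIV convex_on_average(1)[OF am pg(2) cvx]]
    by (rule borel_measurable_continuous_onI)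
  define d where "d x = (\<Sum>i\<in>J. c i * (x i - \<alpha> i / \<beta>)) - c j * (\<alpha> j / \<beta>)" for x
  have S_upd: "S c (x(j := y)) = d x + c j * y" for x y
  proof -
    have "(\<Sum>i\<in>J. c i * ((x(j := y)) i - \<alpha> i / \<beta>)) = (\<Sum>i\<in>J. c i * (x i - \<alpha> i / \<beta>))"
      using I(3) by (intro sum.cong) auto
    moreover have "S c z = c j * (z j - \<alpha> j / \<beta>) + (\<Sum>i\<in>J. c i * (z i - \<alpha> i / \<beta>))" for z
      unfolding S_def J_def by (rule sum.remove[OF finite_I j])
    ultimately have "S c (x(j := y)) = c j * (y - \<alpha> j / \<beta>) + (\<Sum>i\<in>J. c i * (x i - \<alpha> i / \<beta>))"
      by (simp only: fun_upd_same)
    then show ?thesis by (simp add: d_def right_diff_distrib)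
  qed
  have inner: "(\<integral>y. (y - \<alpha> j / \<beta>) * f' (d x + c j * y) \<partial>?G) = \<alpha> j / \<beta>\<^sup>2 * c j * (\<integral>y. ?H (d x + c j * y) \<partial>?G)" for x
  proof -
    have "((\<lambda>y. f' (d x + c j * y)) has_real_derivative c j * f'' (d x + c j * y)) (at y)" for y
    proof -
      have "((\<lambda>y. d x + c j * y) has_real_derivative c j) (at y)"
        by (auto intro!: derivative_eq_intros)
      from DERIV_chain2[OF _ this, of f' "f'' (d x + c j * y)"] f show ?thesis
        by (simp add: mult.commute convex_C2_def)
    qed
    moreover have "continuous_on UNIV (\<lambda>y. c j * f'' (d x + c j * y))"
      by (intro continuous_on_mult_left continuous_on_compose2[OF m(6)] continuous_intros) auto
    ultimately have "(\<integral>y. (y - \<alpha> j / \<beta>) * f' (d x + c j * y) \<partial>?G) =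
       \<alpha> j / \<beta>\<^sup>2 * (\<integral>y. (\<integral>v. c j * f'' (d x + c j * (y + v)) \<partial>?E) \<partial>?G)"
      using \<alpha>_pos[of j] \<beta>_pos pg
      by (intro gamma_stein_identity) (auto intro!: poly_growth_affine poly_growth_cmult)
    then show ?thesis by (simp add: distrib_left add.assoc)
  qed
  have "(\<integral>x. (x j - \<alpha> j / \<beta>) * f' (S c x) \<partial>P) =
     (\<integral>x. (\<integral>y. (y - \<alpha> j / \<beta>) * f' (d x + c j * y) \<partial>?G) \<partial>Pi\<^sub>M J (\<lambda>i. gamma_distribution (\<alpha> i) \<beta>))"
    using prod.product_integral_insert[OF I(2,3), of "\<lambda>x. (x j - \<alpha> j / \<beta>) * f' (S c x)"]
      integrable_S(2)[OF pg(1) m(2) j, of c] by (simp add: P_def I(1)[symmetric] S_upd)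
  also have "\<dots> = \<alpha> j / \<beta>\<^sup>2 * c j * (\<integral>x. (\<integral>y. ?H (d x + c j * y) \<partial>?G) \<partial>Pi\<^sub>M J (\<lambda>i. gamma_distribution (\<alpha> i) \<beta>))"
    unfolding inner by simp
  also have "(\<integral>x. (\<integral>y. ?H (d x + c j * y) \<partial>?G) \<partial>Pi\<^sub>M J (\<lambda>i. gamma_distribution (\<alpha> i) \<beta>)) = (\<integral>x. ?H (S c x) \<partial>P)"
    using prod.product_integral_insert[OF I(2,3), of "\<lambda>x. ?H (S c x)"]
      integrable_S(1)[OF Hpg Hm, of c] by (simp add: P_def I(1)[symmetric] S_upd)
  finally show ?thesis .
qed

lemma S_diff: "S c x - S d x = S (\<lambda>i. c i - d i) x"
  by (simp add: S_def left_diff_distrib sum_subtractf)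

text \<open>Chain rule under the integral sign. The work lies in a dominating function for
  increments of \<open>f (S (c t) x)\<close> that does not depend on \<open>t\<close>.\<close>

lemma has_real_derivative_expectation:
  assumes f: "convex_C2 f f' f''"
    and c: "\<And>i. i \<in> I \<Longrightarrow> ((\<lambda>t. c t i) has_real_derivative c' i) (at t0)"
  shows "((\<lambda>t. \<integral>x. f (S (c t) x) \<partial>P) has_real_derivative
     (\<integral>x. (\<Sum>i\<in>I. c' i * ((x i - \<alpha> i / \<beta>) * f' (S (c t0) x))) \<partial>P)) (at t0)"
proof -
  have pg: "poly_growth f" "poly_growth f'" and d: "\<And>x. (f has_real_derivative f' x) (at x)"
    using f by (auto simp: convex_C2_def)
  note m = convex_C2_measurable[OF f]
  obtain C r where C: "C \<ge> 0" "\<And>x. \<bar>f' x\<bar> \<le> C * (1 + \<bar>x\<bar>) ^ r"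
    using poly_growthE[OF pg(2)] by metis
  \<comment> \<open>Near \<open>t0\<close> each difference quotient is within 1 of its limit, which
    gives a Lipschitz bound for the scales at \<open>t0\<close>; finiteness of \<open>I\<close>
    makes it simultaneous.\<close>
  have "\<forall>i\<in>I. eventually (\<lambda>t. \<bar>c t i - c t0 i\<bar> \<le> (\<bar>c' i\<bar> + 1) * \<bar>t - t0\<bar>) (nhds t0)"
  proof
    fix i assume "i \<in> I"
    from c[OF this] have "eventually (\<lambda>t. dist ((c t i - c t0 i) / (t - t0)) (c' i) < 1) (at t0)"
      unfolding has_field_derivative_iff by (rule tendstoD) simp
    then have "eventually (\<lambda>t. \<bar>c t i - c t0 i\<bar> \<le> (\<bar>c' i\<bar> + 1) * \<bar>t - t0\<bar>) (at t0)"
    proof eventually_elim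
      case (elim t)
      show ?case
      proof (cases "t = t0")
        case False
        have "\<bar>(c t i - c t0 i) / (t - t0)\<bar> \<le> \<bar>c' i\<bar> + 1"
          using elim unfolding dist_real_def by linarith
        then show ?thesis using False by (simp add: abs_divide divide_le_eq)
      qed simp
    qed
    then show "eventually (\<lambda>t. \<bar>c t i - c t0 i\<bar> \<le> (\<bar>c' i\<bar> + 1) * \<bar>t - t0\<bar>) (nhds t0)"
      unfolding eventually_at_filter by (rule eventually_mono) auto
  qed
  then have "eventually (\<lambda>t. \<forall>i\<in>I. \<bar>c t i - c t0 i\<bar> \<le> (\<bar>c' i\<bar> + 1) * \<bar>t - t0\<bar>) (nhds t0)"
    using finite_I by (rule eventually_ball_finite[rotated])
  then obtain T0 where T0: "open T0" "t0 \<in> T0"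
    "\<And>t i. t \<in> T0 \<Longrightarrow> i \<in> I \<Longrightarrow> \<bar>c t i - c t0 i\<bar> \<le> (\<bar>c' i\<bar> + 1) * \<bar>t - t0\<bar>"
    unfolding eventually_nhds by blast
  \<comment> \<open>Radius 1 bounds the increments of the scales by
    \<open>\<bar>c' i\<bar> + 1\<close>, so \<open>B\<close> controls all scale vectors met in
    \<open>T\<close>, while \<open>K\<close> is the Lipschitz constant of the combination.\<close>
  define T where "T = T0 \<inter> ball t0 1"
  define K where "K = bnd (\<lambda>i. \<bar>c' i\<bar> + 1)"
  define B where "B = bnd (\<lambda>i. \<bar>c t0 i\<bar> + (\<bar>c' i\<bar> + 1))"
  have KB: "K \<ge> 0" "B \<ge> 0" by (auto simp: K_def B_def bnd_nonneg)
  have W0: "0 \<le> W x" for x using W_ge_1[of x] by simp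
  have "((\<lambda>t. \<integral>x. f (S (c t) x) \<partial>P) has_real_derivative
     (\<integral>x. (f' (S (c t0) x) * (\<Sum>i\<in>I. c' i * (x i - \<alpha> i / \<beta>))) \<partial>P)) (at t0)"
  proof (rule has_real_derivative_integral(2))
    show "integrable P (\<lambda>x. f (S (c t) x))" for t by (rule integrable_S(1)[OF pg(1) m(1)])
    show "open T" "t0 \<in> T" using T0 by (auto simp: T_def)
    show "((\<lambda>t. f (S (c t) x)) has_real_derivative
         f' (S (c t0) x) * (\<Sum>i\<in>I. c' i * (x i - \<alpha> i / \<beta>))) (at t0)" for x
      using c unfolding S_def by (intro DERIV_chain2[OF d] DERIV_sum DERIV_cmult_right) auto
    show "integrable P (\<lambda>x. K * C * (1 + 2 * B) ^ r * W x ^ Suc r)"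
      by (rule integrable_mult_right) (rule integrable_W_power)
    fix t x assume t: "t \<in> T"
    have ct: "\<bar>c t i - c t0 i\<bar> \<le> (\<bar>c' i\<bar> + 1) * \<bar>t - t0\<bar>" "\<bar>t - t0\<bar> \<le> 1" if "i \<in> I" for i
      using t T0(3)[of t i] that by (auto simp: T_def dist_real_def)
    have "\<bar>c t i - c t0 i\<bar> \<le> \<bar>c' i\<bar> + 1" if "i \<in> I" for i
      using ct[OF that] mult_left_mono[of "\<bar>t - t0\<bar>" 1 "\<bar>c' i\<bar> + 1"] by simp
    then have "bnd (c t) \<le> B" "bnd (c t0) \<le> B"
      unfolding B_def by (intro bnd_mono; force)+
    then have "\<bar>S (c t) x\<bar> \<le> B * W x" "\<bar>S (c t0) x\<bar> \<le> B * W x"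
      using W0 by (auto intro: order_trans[OF abs_S_le mult_right_mono])
    then have "\<bar>\<bar>S (c t) x\<bar> + \<bar>S (c t0) x\<bar>\<bar> \<le> 2 * B * W x" by simp
    from power_le_weight[OF this W_ge_1, of r] KB
    have p: "(1 + \<bar>S (c t) x\<bar> + \<bar>S (c t0) x\<bar>) ^ r \<le> (1 + 2 * B) ^ r * W x ^ r" by (simp add: add.assoc)
    have "\<bar>S (c t) x - S (c t0) x\<bar> \<le> bnd (\<lambda>i. c t i - c t0 i) * W x"
      unfolding S_diff by (rule abs_S_le)
    also have "\<dots> \<le> bnd (\<lambda>i. (\<bar>c' i\<bar> + 1) * \<bar>t - t0\<bar>) * W x"
      using ct(1) W0 by (intro mult_right_mono bnd_mono) (auto simp: abs_mult)
    also have "bnd (\<lambda>i. (\<bar>c' i\<bar> + 1) * \<bar>t - t0\<bar>) = \<bar>t - t0\<bar> * K"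
      by (simp add: K_def bnd_def sum_distrib_left abs_mult mult_ac)
    finally have q: "\<bar>S (c t) x - S (c t0) x\<bar> \<le> \<bar>t - t0\<bar> * K * W x" .
    have "\<bar>f (S (c t) x) - f (S (c t0) x)\<bar> \<le>
       \<bar>S (c t) x - S (c t0) x\<bar> * (C * (1 + \<bar>S (c t) x\<bar> + \<bar>S (c t0) x\<bar>) ^ r)"
      by (rule poly_growth_lipschitz[OF d C])
    also have "\<dots> \<le> (\<bar>t - t0\<bar> * K * W x) * (C * ((1 + 2 * B) ^ r * W x ^ r))"
      using q p C(1) KB W0 by (intro mult_mono mult_left_mono) auto
    finally show "\<bar>f (S (c t) x) - f (S (c t0) x)\<bar> \<le> \<bar>t - t0\<bar> * (K * C * (1 + 2 * B) ^ r * W x ^ Suc r)"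
      by (simp add: mult_ac)
  qed
  then show ?thesis by (simp add: sum_distrib_left mult_ac)
qed

text \<open>Dominated convergence, with the scales uniformly bounded on the compact parameter set.
  It carries monotonicity from the open path to its ends.\<close>

lemma continuous_on_expectation:
  fixes c :: "real \<Rightarrow> nat \<Rightarrow> real"
  assumes f: "convex_C2 f f' f''" and K: "compact K"
    and c: "\<And>i. i \<in> I \<Longrightarrow> continuous_on K (\<lambda>t. c t i)"
  shows "continuous_on K (\<lambda>t. \<integral>x. f (S (c t) x) \<partial>P)"
proof (rule continuous_on_sequentiallyI)
  fix u :: "nat \<Rightarrow> real" and t assume t: "t \<in> K" and u: "\<forall>n. u n \<in> K" "u \<longlonglongrightarrow> t"
  have pg: "poly_growth f" using f by (auto simp: convex_C2_def)
  note m = convex_C2_measurable[OF f]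
  obtain C r where C: "C \<ge> 0" "\<And>x. \<bar>f x\<bar> \<le> C * (1 + \<bar>x\<bar>) ^ r"
    using poly_growthE[OF pg] by metis
  have "\<forall>i\<in>I. \<exists>b. \<forall>t\<in>K. \<bar>c t i\<bar> \<le> b"
  proof
    fix i assume "i \<in> I"
    from compact_imp_bounded[OF compact_continuous_image[OF c[OF this] K]]
    show "\<exists>b. \<forall>t\<in>K. \<bar>c t i\<bar> \<le> b" unfolding bounded_iff by simp
  qed
  from bchoice[OF this] obtain b where b: "\<forall>i\<in>I. \<forall>t\<in>K. \<bar>c t i\<bar> \<le> b i" ..
  have bt: "bnd (c t) \<le> bnd b" if "t \<in> K" for t
  proof (rule bnd_mono)
    fix i assume "i \<in> I"
    then have "\<bar>c t i\<bar> \<le> b i" using b that by blast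
    then show "\<bar>c t i\<bar> \<le> \<bar>b i\<bar>" by linarith
  qed
  have W0: "0 \<le> W x" for x using W_ge_1[of x] by simp
  show "(\<lambda>n. \<integral>x. f (S (c (u n)) x) \<partial>P) \<longlonglongrightarrow> (\<integral>x. f (S (c t) x) \<partial>P)"
  proof (rule integral_dominated_convergence)
    show "(\<lambda>x. f (S (c t) x)) \<in> borel_measurable P" "(\<lambda>x. f (S (c (u n)) x)) \<in> borel_measurable P" for n
      by (rule measurable_compose[OF measurable_S m(1)])+
    show "integrable P (\<lambda>x. C * ((1 + bnd b) ^ r * W x ^ r))"
      using integrable_W_power by simp
    show "AE x in P. (\<lambda>n. f (S (c (u n)) x)) \<longlonglongrightarrow> f (S (c t) x)"
    proof (rule AE_I2)
      fix x
      have "(\<lambda>n. c (u n) i) \<longlonglongrightarrow> c t i" if "i \<in> I" for i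
        using u t by (intro continuous_on_tendsto_compose[OF c[OF that]]) auto
      then have "(\<lambda>n. S (c (u n)) x) \<longlonglongrightarrow> S (c t) x"
        unfolding S_def by (intro tendsto_sum tendsto_mult_right)
      then show "(\<lambda>n. f (S (c (u n)) x)) \<longlonglongrightarrow> f (S (c t) x)"
        by (rule continuous_on_tendsto_compose[OF m(4)]) auto
    qed
    show "AE x in P. norm (f (S (c (u n)) x)) \<le> C * ((1 + bnd b) ^ r * W x ^ r)" for n
    proof (rule AE_I2)
      fix x
      have "\<bar>S (c (u n)) x\<bar> \<le> bnd b * W x"
        using bt[of "u n"] u(1) W0 by (intro order_trans[OF abs_S_le mult_right_mono]) auto
      then show "norm (f (S (c (u n)) x)) \<le> C * ((1 + bnd b) ^ r * W x ^ r)"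
        unfolding real_norm_def
        by (intro order_trans[OF C(2)] mult_left_mono power_le_weight W_ge_1 bnd_nonneg C(1))
    qed
  qed
qed

text \<open>By the Stein identity the derivative is the average, with weights
  \<open>\<alpha>\<^sub>i c\<^sub>i c\<^sub>i'\<close>, of the convex function \<open>c \<mapsto> \<bbbE> f''(S + c V)\<close> (with \<open>V\<close> exponential)
  at the points \<open>c\<^sub>i\<close>; so its sign is decided by a Jensen inequality.\<close>

lemma expectation_derivative_nonpos:
  assumes f: "convex_C2 f f' f''"
    and c: "\<And>i. i \<in> I \<Longrightarrow> ((\<lambda>t. c t i) has_real_derivative c' i) (at t0)"
    and jensen: "\<And>\<phi>. convex_on UNIV \<phi> \<Longrightarrow> (\<Sum>i\<in>I. \<alpha> i * c t0 i * c' i * \<phi> (c t0 i)) \<le> 0"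
  shows "\<exists>D. ((\<lambda>t. \<integral>x. f (S (c t) x) \<partial>P) has_real_derivative D) (at t0) \<and> D \<le> 0"
proof -
  let ?E = "gamma_distribution 1 \<beta>"
  define H where "H c y = (\<integral>v. f'' (y + c * v) \<partial>?E)" for c y
  have pg: "poly_growth f'" "poly_growth f''" and cvx: "convex_on UNIV f''"
    using f by (auto simp: convex_C2_def)
  note m = convex_C2_measurable[OF f]
  have am: "all_moments ?E" using \<beta>_pos by (intro all_moments_gamma_distribution) auto
  have Hpg: "poly_growth (H c)" for c
    unfolding H_def by (rule poly_growth_average[OF am pg(2) m(3)])
  have Hm: "H c \<in> borel_measurable borel" for c
    unfolding H_def using convex_on_continuous[OF open_UNIV convex_on_average(1)[OF am pg(2) cvx]]
    by (rule borel_measurable_continuous_onI)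
  have "(\<integral>x. (\<Sum>i\<in>I. c' i * ((x i - \<alpha> i / \<beta>) * f' (S (c t0) x))) \<partial>P) =
    (\<Sum>i\<in>I. c' i * (\<integral>x. (x i - \<alpha> i / \<beta>) * f' (S (c t0) x) \<partial>P))"
    using integrable_S(2)[OF pg(1) m(2)] by (subst Bochner_Integration.integral_sum) auto
  also have "\<dots> = (\<Sum>i\<in>I. c' i * (\<alpha> i / \<beta>\<^sup>2 * c t0 i * (\<integral>x. H (c t0 i) (S (c t0) x) \<partial>P)))"
    unfolding H_def using stein_component[OF f] by (intro sum.cong) auto
  also have "\<dots> = (\<integral>x. (\<Sum>i\<in>I. c' i * (\<alpha> i / \<beta>\<^sup>2 * c t0 i * H (c t0 i) (S (c t0) x))) \<partial>P)"
    using integrable_S(1)[OF Hpg Hm] by (subst Bochner_Integration.integral_sum) auto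
  \<comment> \<open>Jensen is used outcome by outcome: with \<open>S (c t0) x\<close> frozen,
    \<open>H\<close> is convex in its scale argument.\<close>
  also have "\<dots> \<le> (\<integral>x. 0 \<partial>P)"
  proof (rule integral_mono)
    fix x
    have "(\<Sum>i\<in>I. c' i * (\<alpha> i / \<beta>\<^sup>2 * c t0 i * H (c t0 i) (S (c t0) x))) =
       1 / \<beta>\<^sup>2 * (\<Sum>i\<in>I. \<alpha> i * c t0 i * c' i * H (c t0 i) (S (c t0) x))"
      by (simp add: sum_distrib_left mult_ac)
    moreover have "(\<Sum>i\<in>I. \<alpha> i * c t0 i * c' i * H (c t0 i) (S (c t0) x)) \<le> 0"
      unfolding H_def by (rule jensen[OF convex_on_average(2)[OF am pg(2) cvx]])
    ultimately show "(\<Sum>i\<in>I. c' i * (\<alpha> i / \<beta>\<^sup>2 * c t0 i * H (c t0 i) (S (c t0) x))) \<le> 0"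
      by (simp add: divide_nonpos_nonneg)
  qed (use integrable_S(1)[OF Hpg Hm] in auto)
  finally show ?thesis
    using has_real_derivative_expectation[where c = c and c' = c', OF f c] by (intro exI conjI) simp_all
qed

end

section \<open>Paths with constant second and third moments\<close>

text \<open>Along the path the weighted second and third moments stay constant: writing
  \<open>y = \<surd>D cos \<theta> / \<surd>\<alpha>\<close> and \<open>z = - \<surd>D sin \<theta> / \<surd>\<gamma>\<close> takes care of the second, and the
  third then determines \<open>\<theta>\<close> through \<open>H \<theta> = J x\<close>.\<close>

lemma moment_preserving_path:
  fixes a :: real
  assumes a: "0 < a" "a < 1"
  defines "\<alpha> \<equiv> a\<^sup>2 * (1 + a) / 4" and "\<gamma> \<equiv> a\<^sup>2 * (1 - a) / 4"
  defines "k \<equiv> 1 / 2 - \<alpha>"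
  obtains y z :: "real \<Rightarrow> real"
  where "continuous_on {0..a} y" "continuous_on {0..a} z"
    "y a = a" "z a = 0" "y 0 = 1" "z 0 = -1"
    "\<And>x. 0 < x \<Longrightarrow> x < a \<Longrightarrow> a \<le> y x \<and> z x \<le> 0"
    "\<And>x. 0 < x \<Longrightarrow> x < a \<Longrightarrow> \<exists>y' z'. (y has_real_derivative y') (at x) \<and>
       (z has_real_derivative z') (at x) \<and>
       k * x + \<alpha> * y x * y' + \<gamma> * z x * z' = 0 \<and>
       k * x * x + \<alpha> * y x * y' * y x + \<gamma> * z x * z' * z x = 0"
proof -
  have a2: "a\<^sup>2 < 1" "0 < a\<^sup>2" using a by (auto simp: power_less_one_iff)
  have pos: "\<alpha> > 0" "\<gamma> > 0" using a a2 by (auto simp: \<alpha>_def \<gamma>_def)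
  have "a\<^sup>2 * (1 + a) < 1 * 2" using a a2 by (intro mult_strict_mono) auto
  then have k: "k > 0" unfolding k_def \<alpha>_def by linarith
  have sum: "\<alpha> + \<gamma> = a\<^sup>2 / 2" and diff: "\<alpha> - \<gamma> = a ^ 3 / 2"
    by (simp_all add: \<alpha>_def \<gamma>_def field_simps power2_eq_square power3_eq_cube)
  \<comment> \<open>What the second and third moments leave for \<open>y\<close> and
    \<open>z\<close>. The totals \<open>a\<^sup>2 / 2\<close> and \<open>a ^ 3 / 2\<close> are the
    common values at the two end vectors, by \<open>sum\<close>, \<open>diff\<close> and
    \<open>k + \<alpha> = 1 / 2\<close>.\<close>
  define D where "D x = a\<^sup>2 / 2 - k * x\<^sup>2" for x
  define N where "N x = a ^ 3 / 2 - k * x ^ 3" for x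
  define s where "s x = sqrt (D x)" for x
  \<comment> \<open>\<open>J\<close> is the scale-free ratio of third moment to second moment
    required at \<open>x\<close>; \<open>H\<close> is the ratio attained at angle \<open>t\<close>
    on the ellipse fixed by the second moment.\<close>
  define J where "J x = N x / s x ^ 3" for x
  define H where "H t = cos t ^ 3 / sqrt \<alpha> - sin t ^ 3 / sqrt \<gamma>" for t
  define H' where "H' t = - (3 * (cos t)\<^sup>2 * sin t / sqrt \<alpha> + 3 * (sin t)\<^sup>2 * cos t / sqrt \<gamma>)" for t
  \<comment> \<open>The angle of the end vector \<open>(y, z) = (1, -1)\<close>, where
    \<open>s = sqrt (\<alpha> + \<gamma>)\<close>; angle 0 belongs to \<open>(a, 0)\<close>.\<close>
  define t1 where "t1 = arccos (sqrt (\<alpha> / (\<alpha> + \<gamma>)))"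
  have sq: "sqrt \<alpha> > 0" "sqrt \<gamma> > 0" "(sqrt \<alpha>)\<^sup>2 = \<alpha>" "(sqrt \<gamma>)\<^sup>2 = \<gamma>" using pos by auto

  have D: "D x > 0" if "0 \<le> x" "x \<le> a" for x
  proof -
    have "x\<^sup>2 \<le> a\<^sup>2" using that by (intro power_mono) auto
    then have "D x \<ge> a\<^sup>2 / 2 - k * a\<^sup>2" using k by (simp add: D_def)
    also have "a\<^sup>2 / 2 - k * a\<^sup>2 = \<alpha> * a\<^sup>2" by (simp add: k_def algebra_simps)
    finally show ?thesis using pos a2 by (meson less_le_trans mult_pos_pos)
  qed
  have s: "s x > 0" "(s x)\<^sup>2 = D x" if "0 \<le> x" "x \<le> a" for x
    using D[OF that] by (auto simp: s_def)
  have sderiv: "(s has_real_derivative - k * x / s x) (at x)" if "0 \<le> x" "x \<le> a" for x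
    unfolding s_def D_def using D[OF that]
    by (auto intro!: derivative_eq_intros simp: D_def divide_simps)
  have Jderiv: "(J has_real_derivative 3 * k * x * (N x - x * D x) / s x ^ 5) (at x)"
    if "0 \<le> x" "x \<le> a" for x
  proof -
    have "(N has_real_derivative - 3 * k * x\<^sup>2) (at x)"
      unfolding N_def by (auto intro!: derivative_eq_intros)
    moreover have "((\<lambda>x. s x ^ 3) has_real_derivative 3 * (s x)\<^sup>2 * (- k * x / s x)) (at x)"
      using sderiv[OF that] by (auto intro!: derivative_eq_intros)
    ultimately have "(J has_real_derivative (- 3 * k * x\<^sup>2 * s x ^ 3 - N x * (3 * (s x)\<^sup>2 * (- k * x / s x))) / (s x ^ 3 * s x ^ 3)) (at x)"
      unfolding J_def using s(1)[OF that] by (intro DERIV_divide) auto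
    also have "(- 3 * k * x\<^sup>2 * s x ^ 3 - N x * (3 * (s x)\<^sup>2 * (- k * x / s x))) / (s x ^ 3 * s x ^ 3)
       = 3 * k * x * (N x - x * (s x)\<^sup>2) / s x ^ 5"
      using s(1)[OF that] by (simp add: divide_simps) (simp add: algebra_simps power_numeral_reduce)
    finally show ?thesis using s(2)[OF that] by simp
  qed
  have Jcont: "continuous_on {0..a} J"
    using Jderiv by (auto intro!: continuous_at_imp_continuous_on DERIV_isCont)
  \<comment> \<open>The terms with \<open>k\<close> cancel in \<open>N x - x * D x\<close>, leaving
    \<open>a\<^sup>2 * (a - x) / 2\<close>. So \<open>J\<close> increases, while \<open>H\<close>
    decreases on \<open>{0..t1}\<close>, and \<open>H \<theta> = J x\<close> is uniquely
    solvable.\<close>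
  have Jpos: "3 * k * x * (N x - x * D x) / s x ^ 5 > 0" if "0 < x" "x < a" for x
  proof -
    have "N x - x * D x = a\<^sup>2 * (a - x) / 2"
      by (simp add: N_def D_def algebra_simps power2_eq_square power3_eq_cube)
    moreover have "a\<^sup>2 * (a - x) > 0" using that a2 by (intro mult_pos_pos) auto
    ultimately have "N x - x * D x > 0" by linarith
    then show ?thesis using that k s(1)[of x] by simp
  qed
  have Jmono: "J u < J v" if "0 \<le> u" "u < v" "v \<le> a" for u v
  proof (rule DERIV_pos_imp_increasing_open[OF that(2)])
    show "\<exists>d. (J has_real_derivative d) (at x) \<and> d > 0" if "u < x" "x < v" for x
      using that \<open>0 \<le> u\<close> \<open>v \<le> a\<close> Jderiv[of x] Jpos[of x] by auto
    show "continuous_on {u..v} J" using that by (intro continuous_on_subset[OF Jcont]) auto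
  qed

  have t1: "0 < t1" "t1 < pi / 2" "cos t1 = sqrt \<alpha> / sqrt (\<alpha> + \<gamma>)" "sin t1 = sqrt \<gamma> / sqrt (\<alpha> + \<gamma>)"
  proof -
    let ?r = "sqrt (\<alpha> / (\<alpha> + \<gamma>))"
    have r: "0 < ?r" "?r < 1" using pos by (auto simp: real_sqrt_lt_1_iff)
    show "0 < t1"
      unfolding t1_def by (rule arccos_lt_bounded[THEN conjunct1]) (use r in linarith)+
    show "t1 < pi / 2"
      unfolding t1_def using r arccos_less_arccos[of 0 ?r] by auto
    show "cos t1 = sqrt \<alpha> / sqrt (\<alpha> + \<gamma>)"
      unfolding t1_def using r by (subst cos_arccos) (linarith, linarith, simp add: real_sqrt_divide)
    have "sin t1 = sqrt (1 - ?r\<^sup>2)" unfolding t1_def using r by (intro sin_arccos) linarith+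
    also have "1 - ?r\<^sup>2 = \<gamma> / (\<alpha> + \<gamma>)" using pos by (simp add: field_simps)
    finally show "sin t1 = sqrt \<gamma> / sqrt (\<alpha> + \<gamma>)" by (simp add: real_sqrt_divide)
  qed
  have Hderiv: "(H has_real_derivative H' t) (at t)" for t
  proof -
    have "((\<lambda>t. cos t ^ 3) has_real_derivative - (3 * (cos t)\<^sup>2 * sin t)) (at t)"
      "((\<lambda>t. sin t ^ 3) has_real_derivative 3 * (sin t)\<^sup>2 * cos t) (at t)"
      by (auto intro!: derivative_eq_intros)
    from DERIV_diff[OF DERIV_cdivide[OF this(1)] DERIV_cdivide[OF this(2)]]
    show ?thesis unfolding H_def H'_def by (rule DERIV_cong) simp
  qed
  have Hcont: "continuous_on A H" for A
    using Hderiv by (auto intro!: continuous_at_imp_continuous_on DERIV_isCont)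
  have Hneg: "H' t < 0" if "0 < t" "t < pi / 2" for t
  proof -
    have "cos t > 0" "sin t > 0" using that by (auto intro: cos_gt_zero sin_gt_zero2)
    then have "0 < 3 * (cos t)\<^sup>2 * sin t / sqrt \<alpha>" "0 < 3 * (sin t)\<^sup>2 * cos t / sqrt \<gamma>"
      using sq(1,2) by (auto intro!: divide_pos_pos mult_pos_pos)
    then show ?thesis unfolding H'_def by linarith
  qed
  have Hmono: "H v < H u" if "0 \<le> u" "u < v" "v \<le> t1" for u v
  proof (rule DERIV_neg_imp_decreasing_open[OF that(2)])
    show "\<exists>d. (H has_real_derivative d) (at x) \<and> d < 0" if "u < x" "x < v" for x
      using that \<open>0 \<le> u\<close> \<open>v \<le> t1\<close> t1 Hderiv[of x] Hneg[of x] by auto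
  qed (rule Hcont)
  have Hinj: "inj_on H {0..t1}"
    using Hmono by (intro linorder_inj_onI') (force simp: less_le)
  have Himg: "H ` {0..t1} = {H t1..H 0}"
  proof
    show "H ` {0..t1} \<subseteq> {H t1..H 0}"
    proof clarify
      fix t assume t: "t \<in> {0..t1}"
      then have "H t1 \<le> H t" using Hmono[of t t1] by (cases "t = t1") auto
      moreover have "H t \<le> H 0" using Hmono[of 0 t] t by (cases "t = 0") auto
      ultimately show "H t \<in> {H t1..H 0}" by simp
    qed
    show "{H t1..H 0} \<subseteq> H ` {0..t1}"
    proof
      fix w assume "w \<in> {H t1..H 0}"
      then obtain t where "0 \<le> t" "t \<le> t1" "H t = w"
        using IVT2'[of H t1 w 0] t1(1) Hcont by auto
      then show "w \<in> H ` {0..t1}" by auto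
    qed
  qed
  define g where "g = the_inv_into {0..t1} H"
  have gH: "g (H t) = t" if "t \<in> {0..t1}" for t
    unfolding g_def using Hinj that by (rule the_inv_into_f_f)
  have Hg: "H (g w) = w" "g w \<in> {0..t1}" if "w \<in> {H t1..H 0}" for w
    using that Hinj f_the_inv_into_f[OF Hinj, of w] the_inv_into_into[OF Hinj, of w "{0..t1}"]
    unfolding g_def Himg by auto
  have gcont: "continuous_on {H t1..H 0} g"
    unfolding Himg[symmetric] using gH by (intro continuous_on_inv Hcont) auto

  have D0: "D 0 = \<alpha> + \<gamma>" "N 0 = \<alpha> - \<gamma>" by (simp_all add: D_def N_def sum diff)
  have J0: "J 0 = H t1"
  proof -
    define q where "q = sqrt (\<alpha> + \<gamma>)"
    have q: "q > 0" using pos by (simp add: q_def)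
    have "H t1 = (sqrt \<alpha> / q) ^ 3 / sqrt \<alpha> - (sqrt \<gamma> / q) ^ 3 / sqrt \<gamma>"
      by (simp add: H_def t1 q_def)
    also have "\<dots> = ((sqrt \<alpha>)\<^sup>2 - (sqrt \<gamma>)\<^sup>2) / q ^ 3"
      using sq q by (simp add: power_divide diff_divide_distrib power_numeral_reduce)
    also have "\<dots> = J 0" by (simp add: J_def s_def D0 q_def[symmetric] sq)
    finally show ?thesis ..
  qed
  have sa: "s a = sqrt \<alpha> * a" "N a = \<alpha> * a ^ 3"
  proof -
    have "D a = \<alpha> * a\<^sup>2" by (simp add: D_def k_def algebra_simps)
    then show "s a = sqrt \<alpha> * a" using a by (simp add: s_def real_sqrt_mult)
    show "N a = \<alpha> * a ^ 3" by (simp add: N_def k_def algebra_simps)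
  qed
  have Ja: "J a = H 0"
  proof -
    have "J a = (sqrt \<alpha>)\<^sup>2 * a ^ 3 / (sqrt \<alpha> * a) ^ 3" using sq by (simp add: J_def sa)
    also have "\<dots> = 1 / sqrt \<alpha>" using a sq(1) by (simp add: power_mult_distrib power_numeral_reduce)
    finally show ?thesis by (simp add: H_def)
  qed
  have Jrange: "J x \<in> {H t1..H 0}" if "x \<in> {0..a}" for x
    using Jmono[of 0 x] Jmono[of x a] that J0 Ja
    by (cases "x = 0"; cases "x = a") (auto simp: less_imp_le)
  define th where "th x = g (J x)" for x
  have th_cont: "continuous_on {0..a} th"
    unfolding th_def by (rule continuous_on_compose2[OF gcont Jcont]) (use Jrange in auto)
  have th: "H (th x) = J x" "th x \<in> {0..t1}" if "x \<in> {0..a}" for x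
    using Hg[OF Jrange[OF that]] by (auto simp: th_def)
  have th_deriv: "\<exists>d. (th has_real_derivative d) (at x)" if x: "0 < x" "x < a" for x
  proof -
    have J: "H t1 < J x" "J x < H 0" using Jmono[of 0 x] Jmono[of x a] x J0 Ja by auto
    have x': "x \<in> {0..a}" using x by simp
    have "th x \<noteq> 0" "th x \<noteq> t1" using th(1)[OF x'] J by auto
    then have "0 < th x" "th x < pi / 2" using th(2)[OF x'] t1 by auto
    then have "H' (th x) < 0" by (rule Hneg)
    moreover have "isCont g (J x)"
      using J gcont by (auto intro: continuous_on_interior)
    ultimately have "(g has_real_derivative inverse (H' (th x))) (at (J x))"
      using Hg(1) J
      by (intro DERIV_inverse_function[where f = H and a = "H t1" and b = "H 0"])
        (auto simp: th_def Hderiv)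
    from DERIV_chain2[OF this Jderiv[of x]] x show ?thesis
      unfolding th_def[abs_def] by auto
  qed

  define y where "y x = s x * cos (th x) / sqrt \<alpha>" for x
  define z where "z x = - (s x * sin (th x) / sqrt \<gamma>)" for x
  have s_cont: "continuous_on {0..a} s"
    using sderiv by (auto intro!: continuous_at_imp_continuous_on DERIV_isCont)
  have trig: "cos (th x) \<ge> 0" "sin (th x) \<ge> 0" if "x \<in> {0..a}" for x
    using th(2)[OF that] t1 by (auto intro!: cos_ge_zero sin_ge_zero)
  have m2: "\<alpha> * (y x)\<^sup>2 + \<gamma> * (z x)\<^sup>2 = D x" if "x \<in> {0..a}" for x
  proof -
    have "\<alpha> * (y x)\<^sup>2 + \<gamma> * (z x)\<^sup>2 = (s x)\<^sup>2 * (cos (th x))\<^sup>2 + (s x)\<^sup>2 * (sin (th x))\<^sup>2"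
      using pos by (simp add: y_def z_def power_divide power_mult_distrib)
    also have "\<dots> = (s x)\<^sup>2 * ((cos (th x))\<^sup>2 + (sin (th x))\<^sup>2)"
      by (rule distrib_left[symmetric])
    finally show ?thesis using s(2)[of x] that by simp
  qed
  have m3: "\<alpha> * y x ^ 3 + \<gamma> * z x ^ 3 = N x" if "x \<in> {0..a}" for x
  proof -
    have "\<alpha> * y x ^ 3 + \<gamma> * z x ^ 3 = (sqrt \<alpha>)\<^sup>2 * y x ^ 3 + (sqrt \<gamma>)\<^sup>2 * z x ^ 3"
      using sq by simp
    also have "\<dots> = s x ^ 3 * H (th x)"
      using sq(1,2) by (simp add: y_def z_def H_def field_simps power_numeral_reduce)
    also have "\<dots> = N x" using th(1)[OF that] s(1)[of x] that by (simp add: J_def)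
    finally show ?thesis .
  qed
  show thesis
  proof (rule that)
    show "continuous_on {0..a} y" "continuous_on {0..a} z"
      unfolding y_def z_def using sq by (auto intro!: continuous_intros s_cont th_cont)
    have "th a = 0" using gH[of 0] t1 by (simp add: th_def Ja)
    then show "y a = a" "z a = 0" using sq by (simp_all add: y_def z_def sa)
    have "th 0 = t1" using gH[of t1] t1 by (simp add: th_def J0)
    then show "y 0 = 1" "z 0 = -1" using sq pos by (simp_all add: y_def z_def t1 s_def D0)
  next
    fix x assume x: "0 < x" "x < a"
    then have x': "x \<in> {0..a}" by simp
    have z: "z x \<le> 0" using trig[OF x'] s(1)[of x] x sq by (simp add: z_def)
    have y: "0 \<le> y x" using trig[OF x'] s(1)[of x] x sq by (simp add: y_def)
    \<comment> \<open>The order of the scales comes from the third moment: as \<open>z x\<close> is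
      nonpositive and \<open>x < a\<close>, \<open>\<alpha> * y x ^ 3\<close> is at least
      \<open>N x\<close>, hence at least \<open>\<alpha> * a ^ 3\<close>.\<close>
    have "z x ^ 3 = z x * (z x)\<^sup>2" by (simp add: power2_eq_square power3_eq_cube)
    then have "z x ^ 3 \<le> 0" using z by (simp add: mult_nonpos_nonneg)
    then have "\<gamma> * z x ^ 3 \<le> 0" using pos by (simp add: mult_nonneg_nonpos)
    moreover have "k * x ^ 3 \<le> k * a ^ 3" using x k by (intro mult_left_mono power_mono) auto
    moreover have "a ^ 3 / 2 - k * a ^ 3 = \<alpha> * a ^ 3" by (simp add: k_def algebra_simps)
    ultimately have "\<alpha> * a ^ 3 \<le> \<alpha> * y x ^ 3" using m3[OF x'] by (simp add: N_def)
    then have "a ^ 3 \<le> y x ^ 3" using pos by simp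
    then have "a \<le> y x" using y by (rule power_le_imp_le_base[of a 2 "y x", simplified])
    with z show "a \<le> y x \<and> z x \<le> 0" by simp
    obtain d where d: "(th has_real_derivative d) (at x)" using th_deriv x by blast
    have sd: "(s has_real_derivative - k * x / s x) (at x)" using sderiv x by simp
    have "\<exists>y'. (y has_real_derivative y') (at x)" "\<exists>z'. (z has_real_derivative z') (at x)"
      unfolding y_def z_def using d sd sq by (auto intro!: exI derivative_eq_intros)
    then obtain y' z' where y': "(y has_real_derivative y') (at x)" and z': "(z has_real_derivative z') (at x)"
      by blast
    have open_ev: "open {0<..<a}" "x \<in> {0<..<a}" using x by auto
    \<comment> \<open>Differentiating the conserved second moment, and below the third, gives the
      two linear relations. \<open>m2\<close> and \<open>m3\<close> hold on \<open>{0..a}\<close>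
      only, so the derivatives are transferred on the open interval.\<close>
    have "((\<lambda>x. \<alpha> * (y x)\<^sup>2 + \<gamma> * (z x)\<^sup>2) has_real_derivative 2 * \<alpha> * y x * y' + 2 * \<gamma> * z x * z') (at x)"
      using y' z' by (auto intro!: derivative_eq_intros)
    from has_field_derivative_transform_within_open[OF this open_ev, of D] m2
    have "(D has_real_derivative 2 * \<alpha> * y x * y' + 2 * \<gamma> * z x * z') (at x)" by auto
    moreover have "(D has_real_derivative - 2 * k * x) (at x)"
      unfolding D_def by (auto intro!: derivative_eq_intros)
    ultimately have 1: "2 * \<alpha> * y x * y' + 2 * \<gamma> * z x * z' = - 2 * k * x" by (rule DERIV_unique)
    have "((\<lambda>x. \<alpha> * y x ^ 3 + \<gamma> * z x ^ 3) has_real_derivative 3 * \<alpha> * (y x)\<^sup>2 * y' + 3 * \<gamma> * (z x)\<^sup>2 * z') (at x)"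
      using y' z' by (auto intro!: derivative_eq_intros)
    from has_field_derivative_transform_within_open[OF this open_ev, of N] m3
    have "(N has_real_derivative 3 * \<alpha> * (y x)\<^sup>2 * y' + 3 * \<gamma> * (z x)\<^sup>2 * z') (at x)" by auto
    moreover have "(N has_real_derivative - 3 * k * x\<^sup>2) (at x)"
      unfolding N_def by (auto intro!: derivative_eq_intros)
    ultimately have 2: "3 * \<alpha> * (y x)\<^sup>2 * y' + 3 * \<gamma> * (z x)\<^sup>2 * z' = - 3 * k * x\<^sup>2" by (rule DERIV_unique)
    show "\<exists>y' z'. (y has_real_derivative y') (at x) \<and> (z has_real_derivative z') (at x) \<and>
       k * x + \<alpha> * y x * y' + \<gamma> * z x * z' = 0 \<and>
       k * x * x + \<alpha> * y x * y' * y x + \<gamma> * z x * z' * z x = 0"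
      using y' z' 1 2 by (intro exI[of _ y'] exI[of _ z']) (auto simp: power2_eq_square algebra_simps)
  qed
qed

text \<open>Zero mass and zero mean determine the outer weights: they are \<open>- w\<close> times
  the barycentric coordinates of \<open>x\<close> between \<open>z\<close> and \<open>y\<close>.
  What remains is the chord inequality for \<open>\<phi>\<close>.\<close>

lemma jensen_two_point:
  fixes \<phi> :: "real \<Rightarrow> real"
  assumes \<phi>: "convex_on UNIV \<phi>" and ord: "z < x" "x < y" and w: "w \<ge> 0"
    and mass: "w + u + v = 0" and mean: "w * x + u * y + v * z = 0"
  shows "w * \<phi> x + u * \<phi> y + v * \<phi> z \<le> 0"
proof -
  define p q where "p = (x - z) / (y - z)" and "q = (y - x) / (y - z)"
  have pq: "0 \<le> p" "p \<le> 1" "1 - p = q" and x: "z + p * (y - z) = x"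
    using ord by (simp_all add: p_def q_def field_simps)
  have "u * (y - z) = - w * (x - z)" "v * (y - z) = - w * (y - x)"
    using mass mean by algebra+
  then have uv: "u = - w * p" "v = - w * q"
    using ord by (simp_all add: p_def q_def field_simps)
  have "(1 - p) *\<^sub>R z + p *\<^sub>R y = x" using x by (simp add: algebra_simps)
  then have "\<phi> x \<le> q * \<phi> z + p * \<phi> y"
    using convex_onD[OF \<phi>, of p z y] pq by simp
  from mult_left_mono[OF this w] show ?thesis unfolding uv by (simp add: algebra_simps)
qed

section \<open>Comparison for a single coordinate\<close>

lemma (in prob_space) distr_sum_indep:
  fixes X :: "'i \<Rightarrow> 'a \<Rightarrow> real"
  assumes "finite I" "i \<notin> I" "indep_vars (\<lambda>_. borel) X (insert i I)"
  shows "distr M borel (\<lambda>\<omega>. \<Sum>j\<in>insert i I. X j \<omega>) =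
    (distr M borel (X i) \<star> distr M borel (\<lambda>\<omega>. \<Sum>j\<in>I. X j \<omega>))"
proof -
  have ind: "indep_var borel (X i) borel (\<lambda>\<omega>. \<Sum>j\<in>I. X j \<omega>)"
    by (rule indep_vars_sum[OF assms])
  from sum_indep_random_variable[OF this indep_var_rv1[OF ind] indep_var_rv2[OF ind]]
  show ?thesis using assms(1,2) by simp
qed

lemma (in prob_space) distr_constant: "distr M borel (\<lambda>_. c) = return borel (c :: real)"
  by (rule measure_eqI) (simp_all add: emeasure_distr measure_return emeasure_space_1 indicator_def)

section \<open>Algebra of centred Gamma laws and their differences\<close>

lemma distr_affine_convolution:
  assumes \<mu>: "all_moments \<mu>" and \<nu>: "all_moments \<nu>"
  shows "(distr \<mu> borel (\<lambda>x. d + c * x) \<star> distr \<nu> borel (\<lambda>x. e + c * x)) =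
    distr (\<mu> \<star> \<nu>) borel (\<lambda>x. (d + e) + c * x)"
proof -
  have [measurable_cong]: "sets \<mu> = sets borel" "sets \<nu> = sets borel"
    using \<mu> \<nu> by (auto simp: all_moments_def)
  have "prob_space (distr \<nu> borel (\<lambda>x. e + c * x))"
    using all_moments_distr[OF \<nu>] by (simp add: all_moments_def)
  then have eq: "distr \<mu> borel (\<lambda>x. d + c * x) \<Otimes>\<^sub>M distr \<nu> borel (\<lambda>x. e + c * x) =
      distr (\<mu> \<Otimes>\<^sub>M \<nu>) (borel \<Otimes>\<^sub>M borel) (\<lambda>(x, y). (d + c * x, e + c * y))"
    by (intro pair_measure_distr prob_space_imp_sigma_finite) measurable
  show ?thesis
    unfolding convolution_def eq
    by (simp add: distr_distr comp_def case_prod_beta' algebra_simps)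
qed

text \<open>The law of \<open>c * (X - 2 * \<alpha>)\<close> with \<open>X\<close> of mean
  \<open>2 * \<alpha>\<close>, written as offset plus multiple to fit the affine image
  lemmas.\<close>

definition centered_gamma :: "real \<Rightarrow> real \<Rightarrow> real measure" where
  "centered_gamma c \<alpha> = distr (gamma_distribution \<alpha> (1 / 2)) borel (\<lambda>x. - (2 * c * \<alpha>) + c * x)"

text \<open>With shapes \<open>(1 + \<delta>) / 4\<close> and \<open>(1 - \<delta>) / 4\<close> this
  is the law of \<open>Z\<close>.\<close>

definition gamma_difference :: "real \<Rightarrow> real \<Rightarrow> real measure" where
  "gamma_difference \<alpha> \<gamma> = (centered_gamma 1 \<alpha> \<star> centered_gamma (-1) \<gamma>)"

lemma all_moments_centered_gamma: "\<alpha> \<ge> 0 \<Longrightarrow> all_moments (centered_gamma c \<alpha>)"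
  unfolding centered_gamma_def by (intro all_moments_distr all_moments_gamma_distribution) auto

lemma all_moments_gamma_difference: "\<alpha> \<ge> 0 \<Longrightarrow> \<gamma> \<ge> 0 \<Longrightarrow> all_moments (gamma_difference \<alpha> \<gamma>)"
  unfolding gamma_difference_def by (intro all_moments_convolution all_moments_centered_gamma)

lemma centered_gamma_0_left: "\<alpha> \<ge> 0 \<Longrightarrow> centered_gamma 0 \<alpha> = return borel 0"
  unfolding centered_gamma_def
  using prob_space.distr_constant[OF prob_space_gamma_distribution[of \<alpha> "1 / 2"], of 0] by simp

lemma centered_gamma_0_right: "centered_gamma c 0 = return borel 0"
  by (simp add: centered_gamma_def gamma_distribution_def distr_return)

lemma centered_gamma_convolution:
  assumes "\<alpha> \<ge> 0" "\<alpha>' \<ge> 0"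
  shows "(centered_gamma c \<alpha> \<star> centered_gamma c \<alpha>') = centered_gamma c (\<alpha> + \<alpha>')"
  unfolding centered_gamma_def
  using assms by (subst distr_affine_convolution)
    (auto simp: gamma_distribution_convolution algebra_simps intro!: all_moments_gamma_distribution)

lemma all_moments_return_0: "all_moments (return borel 0)"
  using all_moments_centered_gamma[of 0 0] by (simp add: centered_gamma_0_right)

lemma convolution_return_0_right: "all_moments \<mu> \<Longrightarrow> (\<mu> \<star> return borel 0) = \<mu>"
  by (rule convolution_return_0) (auto simp: all_moments_def)

lemma all_moments_convolution_commute: "all_moments \<mu> \<Longrightarrow> all_moments \<nu> \<Longrightarrow> (\<mu> \<star> \<nu>) = (\<nu> \<star> \<mu>)"
  by (rule convolution_commutative) (auto simp: all_moments_def prob_space_def)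

lemma all_moments_convolution_assoc:
  "all_moments \<mu> \<Longrightarrow> all_moments \<nu> \<Longrightarrow> all_moments \<kappa> \<Longrightarrow> (\<mu> \<star> (\<nu> \<star> \<kappa>)) = ((\<mu> \<star> \<nu>) \<star> \<kappa>)"
  by (rule convolution_associative) (auto simp: all_moments_def prob_space_def)

lemma convolution_return_0_left: "all_moments \<mu> \<Longrightarrow> (return borel 0 \<star> \<mu>) = \<mu>"
  using all_moments_convolution_commute[OF all_moments_return_0, of \<mu>] convolution_return_0_right[of \<mu>] by simp

text \<open>Regrouping puts equal scales side by side, where Gamma additivity applies; the
  per-coordinate differences can thus be merged into one.\<close>

lemma gamma_difference_convolution:
  assumes "\<alpha> \<ge> 0" "\<gamma> \<ge> 0" "\<alpha>' \<ge> 0" "\<gamma>' \<ge> 0"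
  shows "(gamma_difference \<alpha> \<gamma> \<star> gamma_difference \<alpha>' \<gamma>') = gamma_difference (\<alpha> + \<alpha>') (\<gamma> + \<gamma>')"
proof -
  let ?A = "centered_gamma 1 \<alpha>" and ?B = "centered_gamma (-1) \<gamma>"
    and ?A' = "centered_gamma 1 \<alpha>'" and ?B' = "centered_gamma (-1) \<gamma>'"
  have m: "all_moments ?A" "all_moments ?B" "all_moments ?A'" "all_moments ?B'"
    using assms by (auto intro: all_moments_centered_gamma)
  note c = all_moments_convolution
  have "((?A \<star> ?B) \<star> (?A' \<star> ?B')) = (?A \<star> (?B \<star> (?A' \<star> ?B')))"
    using m by (subst all_moments_convolution_assoc) (auto intro: c)
  also have "(?B \<star> (?A' \<star> ?B')) = ((?B \<star> ?A') \<star> ?B')"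
    using m by (intro all_moments_convolution_assoc)
  also have "(?B \<star> ?A') = (?A' \<star> ?B)"
    using m by (intro all_moments_convolution_commute)
  also have "((?A' \<star> ?B) \<star> ?B') = (?A' \<star> (?B \<star> ?B'))"
    using m by (intro all_moments_convolution_assoc[symmetric])
  also have "(?A \<star> (?A' \<star> (?B \<star> ?B'))) = ((?A \<star> ?A') \<star> (?B \<star> ?B'))"
    using m by (intro all_moments_convolution_assoc c)
  finally show ?thesis
    using assms by (simp add: gamma_difference_def centered_gamma_convolution)
qed

lemma C2_convex_le_refl: "all_moments \<mu> \<Longrightarrow> C2_convex_le \<mu> \<mu>"
  by (simp add: C2_convex_le_def)

lemma C2_convex_le_reflect:
  assumes "C2_convex_le \<mu> \<nu>"
  shows "C2_convex_le (distr \<mu> borel (\<lambda>x. 0 + (-1) * x)) (distr \<nu> borel (\<lambda>x. 0 + (-1) * x))"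
proof -
  have m: "all_moments \<mu>" "all_moments \<nu>" using assms by (auto simp: C2_convex_le_def)
  have [measurable_cong]: "sets \<mu> = sets borel" "sets \<nu> = sets borel"
    using m by (auto simp: all_moments_def)
  have "integral\<^sup>L (distr \<mu> borel (\<lambda>x. 0 + (-1) * x)) f \<le> integral\<^sup>L (distr \<nu> borel (\<lambda>x. 0 + (-1) * x)) f"
    if f: "convex_C2 f f' f''" for f f' f''
  proof -
    note [measurable] = convex_C2_measurable(1)[OF f]
    have "integral\<^sup>L \<mu> (\<lambda>x. f (0 + (-1) * x)) \<le> integral\<^sup>L \<nu> (\<lambda>x. f (0 + (-1) * x))"
      using assms convex_C2_affine[OF f, of 0 "-1"] unfolding C2_convex_le_def by blast
    then show ?thesis by (subst (1 2) integral_distr) auto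
  qed
  then show ?thesis using m all_moments_distr unfolding C2_convex_le_def by blast
qed

lemma centered_gamma_reflect:
  "distr (centered_gamma c \<alpha>) borel (\<lambda>x. 0 + (-1) * x) = centered_gamma (- c) \<alpha>"
  unfolding centered_gamma_def by (subst distr_distr) (auto simp: comp_def intro!: distr_cong)

lemma gamma_difference_reflect:
  assumes "\<alpha> \<ge> 0" "\<gamma> \<ge> 0"
  shows "distr (gamma_difference \<alpha> \<gamma>) borel (\<lambda>x. 0 + (-1) * x) = gamma_difference \<gamma> \<alpha>"
proof -
  have "distr (gamma_difference \<alpha> \<gamma>) borel (\<lambda>x. 0 + (-1) * x) =
     (distr (centered_gamma 1 \<alpha>) borel (\<lambda>x. 0 + (-1) * x) \<star> distr (centered_gamma (-1) \<gamma>) borel (\<lambda>x. 0 + (-1) * x))"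
    using assms by (subst distr_affine_convolution) (auto simp: gamma_difference_def intro!: all_moments_centered_gamma)
  also have "\<dots> = (centered_gamma (-1) \<alpha> \<star> centered_gamma 1 \<gamma>)"
    unfolding centered_gamma_reflect by simp
  also have "\<dots> = gamma_difference \<gamma> \<alpha>"
    unfolding gamma_difference_def using assms
    by (intro all_moments_convolution_commute all_moments_centered_gamma)
  finally show ?thesis .
qed

section \<open>Laws of the linear combinations\<close>

context gamma_family
begin

lemma prob_space_P: "prob_space P"
  unfolding P_def by (rule prod.prob_space_axioms)

text \<open>Independence is read off the joint law: the tuple of coordinates is the identity on the
  space of \<open>P\<close>, so its law is the product of the marginals.\<close>

lemma indep_components:
  assumes "I \<noteq> {}"
  shows "prob_space.indep_vars P (\<lambda>_. borel) (\<lambda>i x. c i * (x i - \<alpha> i / \<beta>)) I"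
proof -
  interpret P: prob_space P by (rule prob_space_P)
  let ?M = "\<lambda>i. gamma_distribution (\<alpha> i) \<beta>"
  have rv: "P.random_variable (?M i) (\<lambda>x. x i)" if "i \<in> I" for i
    using that unfolding P_def by (rule measurable_component_singleton)
  have "distr P (Pi\<^sub>M I ?M) (\<lambda>x. \<lambda>i\<in>I. x i) = distr P P (\<lambda>x. x)"
    unfolding P_def by (rule distr_cong) (auto simp: space_PiM PiE_def extensional_restrict)
  also have "\<dots> = Pi\<^sub>M I ?M" by (simp add: P_def)
  also have "\<dots> = Pi\<^sub>M I (\<lambda>i. distr P (?M i) (\<lambda>x. x i))"
    unfolding P_def using prod.M.prob_space_axioms by (intro PiM_cong refl distr_PiM_component[symmetric])
  finally have "P.indep_vars ?M (\<lambda>i x. x i) I"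
    using P.indep_vars_iff_distr_eq_PiM'[OF assms rv] by simp
  then show ?thesis
    by (rule P.indep_vars_compose2) (simp cong: measurable_cong_sets)
qed

lemma distr_component:
  assumes "i \<in> I"
  shows "distr P borel (\<lambda>x. c * (x i - \<alpha> i / \<beta>)) =
    distr (gamma_distribution (\<alpha> i) \<beta>) borel (\<lambda>x. - (c * \<alpha> i / \<beta>) + c * x)"
proof -
  let ?M = "\<lambda>i. gamma_distribution (\<alpha> i) \<beta>"
  have m: "(\<lambda>x. x i) \<in> measurable P (?M i)"
    using assms unfolding P_def by (rule measurable_component_singleton)
  have m2: "(\<lambda>x. - (c * \<alpha> i / \<beta>) + c * x) \<in> borel_measurable (?M i)"
    by (subst measurable_cong_sets[OF sets_gamma_distribution refl]) simp
  have "distr P borel (\<lambda>x. c * (x i - \<alpha> i / \<beta>)) = distr (distr P (?M i) (\<lambda>x. x i)) borel (\<lambda>x. - (c * \<alpha> i / \<beta>) + c * x)"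
    by (subst distr_distr[OF m2 m]) (simp add: comp_def algebra_simps)
  also have "distr P (?M i) (\<lambda>x. x i) = ?M i"
    unfolding P_def using assms prod.M.prob_space_axioms by (intro distr_PiM_component)
  finally show ?thesis .
qed

end

text \<open>The middle index is written \<open>Suc 0\<close>, the form to which the simplifier
  normalises it.\<close>

lemma gamma_family_law:
  assumes "\<And>i. \<alpha> i > 0"
  shows "distr (gamma_family.P {0, Suc 0, 2} \<alpha> (1 / 2)) borel (gamma_family.S {0, Suc 0, 2} \<alpha> (1 / 2) c) =
    (centered_gamma (c 0) (\<alpha> 0) \<star> (centered_gamma (c (Suc 0)) (\<alpha> (Suc 0)) \<star> centered_gamma (c 2) (\<alpha> 2)))"
proof -
  interpret gamma_family "{0, Suc 0, 2}" \<alpha> "1 / 2" using assms by unfold_locales auto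
  interpret P: prob_space P by (rule prob_space_P)
  let ?X = "\<lambda>i x. c i * (x i - \<alpha> i / (1 / 2))"
  have ind: "P.indep_vars (\<lambda>_. borel) ?X J" if "J \<subseteq> {0, Suc 0, 2}" for J
    using P.indep_vars_subset[OF indep_components[of c] that] by simp
  have law: "distr P borel (?X i) = centered_gamma (c i) (\<alpha> i)" if "i \<in> {0, Suc 0, 2}" for i
    unfolding distr_component[OF that] centered_gamma_def by (simp add: mult_ac)
  have m: "all_moments (centered_gamma (c i) (\<alpha> i))" for i
    using assms[of i] by (intro all_moments_centered_gamma) simp
  have "distr P borel (\<lambda>x. \<Sum>i\<in>insert 0 {Suc 0, 2}. ?X i x) =
     (distr P borel (?X 0) \<star> distr P borel (\<lambda>x. \<Sum>i\<in>{Suc 0, 2}. ?X i x))"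
    by (rule P.distr_sum_indep[OF _ _ ind]) auto
  also have "distr P borel (\<lambda>x. \<Sum>i\<in>insert (Suc 0) {2}. ?X i x) =
     (distr P borel (?X (Suc 0)) \<star> distr P borel (\<lambda>x. \<Sum>i\<in>{2}. ?X i x))"
    by (rule P.distr_sum_indep[OF _ _ ind]) auto
  also have "(\<lambda>x. \<Sum>i\<in>{2}. ?X i x) = ?X 2" by simp
  finally show ?thesis using law[of 0] law[of "Suc 0"] law[of 2] by (simp add: S_def[abs_def])
qed

lemma centered_gamma_le_gamma_difference_open:
  assumes a: "0 < a" "a < 1"
  shows "C2_convex_le (centered_gamma a (1 / 2)) (gamma_difference (a\<^sup>2 * (1 + a) / 4) (a\<^sup>2 * (1 - a) / 4))"
proof -
  define \<alpha> \<gamma> where "\<alpha> = a\<^sup>2 * (1 + a) / 4" and "\<gamma> = a\<^sup>2 * (1 - a) / 4"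
  define k where "k = 1 / 2 - \<alpha>"
  have a2: "a\<^sup>2 < 1" "0 < a\<^sup>2" using a by (auto simp: power_less_one_iff)
  have pos: "\<alpha> > 0" "\<gamma> > 0" using a a2 by (auto simp: \<alpha>_def \<gamma>_def)
  have "a\<^sup>2 * (1 + a) < 1 * 2" using a a2 by (intro mult_strict_mono) auto
  then have k: "k > 0" unfolding k_def \<alpha>_def by linarith
  obtain y z where yz: "continuous_on {0..a} y" "continuous_on {0..a} z"
    "y a = a" "z a = 0" "y 0 = 1" "z 0 = -1"
    and le: "\<And>x. 0 < x \<Longrightarrow> x < a \<Longrightarrow> a \<le> y x \<and> z x \<le> 0"
    and der: "\<And>x. 0 < x \<Longrightarrow> x < a \<Longrightarrow> \<exists>y' z'. (y has_real_derivative y') (at x) \<and>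
       (z has_real_derivative z') (at x) \<and>
       k * x + \<alpha> * y x * y' + \<gamma> * z x * z' = 0 \<and>
       k * x * x + \<alpha> * y x * y' * y x + \<gamma> * z x * z' * z x = 0"
    using moment_preserving_path[OF a] unfolding \<alpha>_def[symmetric] \<gamma>_def[symmetric] k_def[symmetric] by blast
  \<comment> \<open>Shapes and scales of the three variables. The scale of the first is the
    parameter itself, so its speed is 1.\<close>
  define s where "s i = (if i = 0 then k else if i = Suc 0 then \<alpha> else \<gamma>)" for i :: nat
  define c where "c x i = (if i = 0 then x else if i = Suc 0 then y x else z x)" for x and i :: nat
  have s_pos: "s i > 0" for i using pos k by (simp add: s_def)
  interpret gamma_family "{0, Suc 0, 2}" s "1 / 2" using s_pos by unfold_locales auto
  have law: "distr P borel (S (c x)) = (centered_gamma x k \<star> (centered_gamma (y x) \<alpha> \<star> centered_gamma (z x) \<gamma>))" for x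
    using gamma_family_law[of s "c x"] s_pos by (simp add: s_def c_def)
  have "integral\<^sup>L (distr P borel (S (c a))) f \<le> integral\<^sup>L (distr P borel (S (c 0))) f"
    if f: "convex_C2 f f' f''" for f f' f''
  proof -
    \<comment> \<open>The expectation decreases in \<open>x\<close>, and the Gaussian side sits at
      the right end \<open>x = a\<close>.\<close>
    have "(\<integral>x. f (S (c a) x) \<partial>P) \<le> (\<integral>x. f (S (c 0) x) \<partial>P)"
    proof (rule DERIV_nonpos_imp_decreasing_open[where f = "\<lambda>t. \<integral>x. f (S (c t) x) \<partial>P"])
      show "continuous_on {0..a} (\<lambda>t. \<integral>x. f (S (c t) x) \<partial>P)"
      proof (rule continuous_on_expectation[OF f])
        show "continuous_on {0..a} (\<lambda>t. c t i)" for i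
          using yz by (cases "i = 0"; cases "i = Suc 0") (simp_all add: c_def continuous_on_id)
      qed simp
      fix x assume x: "0 < x" "x < a"
      obtain y' z' where d: "(y has_real_derivative y') (at x)" "(z has_real_derivative z') (at x)"
        and mass: "k * x + \<alpha> * y x * y' + \<gamma> * z x * z' = 0"
        and mean: "k * x * x + \<alpha> * y x * y' * y x + \<gamma> * z x * z' * z x = 0"
        using der[OF x] by blast
      define c' where "c' i = (if i = 0 then 1 else if i = Suc 0 then y' else z')" for i :: nat
      show "\<exists>D. ((\<lambda>t. \<integral>x. f (S (c t) x) \<partial>P) has_real_derivative D) (at x) \<and> D \<le> 0"
      proof (rule expectation_derivative_nonpos[OF f])
        show "((\<lambda>t. c t i) has_real_derivative c' i) (at x)" for i
          using d by (cases "i = 0"; cases "i = Suc 0") (simp_all add: c_def c'_def)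
        fix \<phi> :: "real \<Rightarrow> real" assume \<phi>: "convex_on UNIV \<phi>"
        have "k * x * \<phi> x + \<alpha> * y x * y' * \<phi> (y x) + \<gamma> * z x * z' * \<phi> (z x) \<le> 0"
          using le[OF x] x k mass mean by (intro jensen_two_point[OF \<phi>]) auto
        then show "(\<Sum>i\<in>{0, Suc 0, 2}. s i * c x i * c' i * \<phi> (c x i)) \<le> 0"
          by (simp add: s_def c_def c'_def)
      qed
    qed (use a in simp)
    moreover have "integral\<^sup>L (distr P borel (S (c t))) f = (\<integral>x. f (S (c t) x) \<partial>P)" for t
      by (rule integral_distr[OF measurable_S convex_C2_measurable(1)[OF f]])
    ultimately show ?thesis by simp
  qed
  \<comment> \<open>At \<open>x = a\<close> the first two variables share the scale \<open>a\<close>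
    and merge into shape \<open>k + \<alpha> = 1 / 2\<close>; the third has scale 0.\<close>
  moreover have "distr P borel (S (c a)) = centered_gamma a (1 / 2)"
  proof -
    have "(centered_gamma a \<alpha> \<star> centered_gamma 0 \<gamma>) = centered_gamma a \<alpha>"
      using pos by (simp add: centered_gamma_0_left convolution_return_0_right all_moments_centered_gamma)
    moreover have "(centered_gamma a k \<star> centered_gamma a \<alpha>) = centered_gamma a (1 / 2)"
      using pos k centered_gamma_convolution[of k \<alpha> a] by (simp add: k_def)
    ultimately show ?thesis using yz by (simp add: law)
  qed
  moreover have "distr P borel (S (c 0)) = gamma_difference \<alpha> \<gamma>"
    using yz pos k by (simp add: law centered_gamma_0_left gamma_difference_def
      convolution_return_0_left all_moments_centered_gamma all_moments_convolution)
  moreover have "all_moments (centered_gamma a (1 / 2))" "all_moments (gamma_difference \<alpha> \<gamma>)"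
    using pos by (auto intro!: all_moments_centered_gamma all_moments_gamma_difference)
  ultimately show ?thesis unfolding \<alpha>_def \<gamma>_def C2_convex_le_def by auto
qed

text \<open>The path covers \<open>0 < a < 1\<close>. For \<open>a = 0\<close> and
  \<open>a = 1\<close> the two laws coincide, and negative \<open>a\<close> follows by reflection,
  which exchanges the two shapes.\<close>

lemma centered_gamma_le_gamma_difference:
  assumes a: "\<bar>a\<bar> \<le> 1"
  shows "C2_convex_le (centered_gamma a (1 / 2)) (gamma_difference (a\<^sup>2 * (1 + a) / 4) (a\<^sup>2 * (1 - a) / 4))"
proof -
  have nonneg: "C2_convex_le (centered_gamma b (1 / 2)) (gamma_difference (b\<^sup>2 * (1 + b) / 4) (b\<^sup>2 * (1 - b) / 4))"
    if b: "0 \<le> b" "b \<le> 1" for b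
  proof -
    consider "b = 0" | "b = 1" | "0 < b" "b < 1" using b by linarith
    then show ?thesis
    proof cases
      case 1
      then show ?thesis
        by (simp add: centered_gamma_0_left centered_gamma_0_right gamma_difference_def
          convolution_return_0_right all_moments_return_0 C2_convex_le_refl)
    next
      case 2
      then show ?thesis
        by (simp add: centered_gamma_0_right gamma_difference_def
          convolution_return_0_right all_moments_centered_gamma C2_convex_le_refl)
    next
      case 3
      then show ?thesis by (rule centered_gamma_le_gamma_difference_open)
    qed
  qed
  show ?thesis
  proof (cases "a \<ge> 0")
    case True
    then show ?thesis using nonneg[of a] a by simp
  next
    case False
    then have "0 \<le> a\<^sup>2 * (1 - a) / 4" "0 \<le> a\<^sup>2 * (1 + a) / 4" using a by auto
    moreover have "C2_convex_le (centered_gamma (- a) (1 / 2)) (gamma_difference (a\<^sup>2 * (1 - a) / 4) (a\<^sup>2 * (1 + a) / 4))"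
      using nonneg[of "- a"] False a by simp
    from C2_convex_le_reflect[OF this] calculation show ?thesis
      by (simp only: centered_gamma_reflect gamma_difference_reflect minus_minus)
  qed
qed

section \<open>Quadratic forms, moments and test functions\<close>

lemma nn_integral_even:
  fixes h :: "real \<Rightarrow> ennreal"
  assumes [measurable]: "h \<in> borel_measurable borel" and even: "\<And>x. h (- x) = h x"
  shows "(\<integral>\<^sup>+x. h x \<partial>lborel) = (\<integral>\<^sup>+x. 2 * h x * indicator {0..} x \<partial>lborel)"
proof -
  have "(\<integral>\<^sup>+x. h x * indicator {..<0} x \<partial>lborel) = (\<integral>\<^sup>+x. h (0 + (-1) * x) * indicator {..<0} (0 + (-1) * x) \<partial>lborel)"
    using nn_integral_real_affine[of "\<lambda>x. h x * indicator {..<0} x" "-1" 0] by simp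
  also have "\<dots> = (\<integral>\<^sup>+x. h x * indicator {0..} x \<partial>lborel)"
  proof (rule nn_integral_cong_AE)
    have "AE x in lborel. x \<noteq> (0::real)" by (rule AE_lborel_singleton)
    then show "AE x in lborel. h (0 + (-1) * x) * indicator {..<0} (0 + (-1) * x) = h x * indicator {0..} x"
      by eventually_elim (auto simp: even indicator_def)
  qed
  finally have neg: "(\<integral>\<^sup>+x. h x * indicator {..<0} x \<partial>lborel) = (\<integral>\<^sup>+x. h x * indicator {0..} x \<partial>lborel)" .
  have "(\<integral>\<^sup>+x. h x \<partial>lborel) = (\<integral>\<^sup>+x. h x * indicator {..<0} x + h x * indicator {0..} x \<partial>lborel)"
    by (intro nn_integral_cong) (auto simp: indicator_def)
  also have "\<dots> = (\<integral>\<^sup>+x. h x * indicator {0..} x \<partial>lborel) + (\<integral>\<^sup>+x. h x * indicator {0..} x \<partial>lborel)"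
    by (subst nn_integral_add) (simp_all add: neg)
  also have "\<dots> = 2 * (\<integral>\<^sup>+x. h x * indicator {0..} x \<partial>lborel)" by (simp add: mult_2)
  also have "\<dots> = (\<integral>\<^sup>+x. 2 * (h x * indicator {0..} x) \<partial>lborel)" by (rule nn_integral_cmult[symmetric]) measurable
  finally show ?thesis by (simp add: mult.assoc)
qed

text \<open>Substitution on the intervals \<open>{0..n}\<close>, whose images
  \<open>{0..n\<^sup>2}\<close> exhaust the half-line, followed by monotone convergence on both
  sides.\<close>

lemma nn_integral_square_substitution:
  fixes f :: "real \<Rightarrow> real"
  assumes [measurable]: "f \<in> borel_measurable borel"
  shows "(\<integral>\<^sup>+x. f x * indicator {0..} x \<partial>lborel) = (\<integral>\<^sup>+x. f (x\<^sup>2) * (2 * x) * indicator {0..} x \<partial>lborel)"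
proof -
  have lim: "(\<lambda>n. \<integral>\<^sup>+x. h x * indicator {0..b n} x \<partial>lborel) \<longlonglongrightarrow> (\<integral>\<^sup>+x. h x * indicator {0..} x \<partial>lborel)"
    if [measurable]: "h \<in> borel_measurable borel" and b: "incseq b" "filterlim b at_top sequentially"
    for h :: "real \<Rightarrow> ennreal" and b :: "nat \<Rightarrow> real"
  proof (rule nn_integral_LIMSEQ)
    show "incseq (\<lambda>n x. h x * indicator {0..b n} x)"
      using b(1) by (auto simp: incseq_def le_fun_def indicator_def dest: order_trans)
    fix x
    have "eventually (\<lambda>n. x \<le> b n) sequentially"
      using b(2) by (simp add: filterlim_at_top)
    then have "eventually (\<lambda>n. h x * indicator {0..} x = h x * indicator {0..b n} x) sequentially"
      by eventually_elim (auto simp: indicator_def)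
    then show "(\<lambda>n. h x * indicator {0..b n} x) \<longlonglongrightarrow> h x * indicator {0..} x"
      by (rule Lim_transform_eventually[OF tendsto_const])
  qed measurable
  have "(\<integral>\<^sup>+x. f x * indicator {0\<^sup>2..(real n)\<^sup>2} x \<partial>lborel) =
      (\<integral>\<^sup>+x. f (x\<^sup>2) * (2 * x) * indicator {0..real n} x \<partial>lborel)" for n
    by (rule nn_integral_substitution)
      (auto intro!: derivative_eq_intros continuous_intros simp: set_borel_measurable_def)
  moreover have ind: "ennreal (u * indicator A x) = ennreal u * indicator A x" for u and A :: "real set" and x
    by (auto simp: indicator_def)
  ultimately have eq: "(\<integral>\<^sup>+x. ennreal (f x) * indicator {0..(real n)\<^sup>2} x \<partial>lborel) =
      (\<integral>\<^sup>+x. ennreal (f (x\<^sup>2) * (2 * x)) * indicator {0..real n} x \<partial>lborel)" for n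
    by (simp only: ind power_zero_numeral)
  have "(\<lambda>n. \<integral>\<^sup>+x. ennreal (f x) * indicator {0..(real n)\<^sup>2} x \<partial>lborel) \<longlonglongrightarrow> (\<integral>\<^sup>+x. ennreal (f x) * indicator {0..} x \<partial>lborel)"
    by (rule lim) (auto simp: incseq_def power_mono intro!: filterlim_pow_at_top filterlim_real_sequentially)
  moreover have "(\<lambda>n. \<integral>\<^sup>+x. ennreal (f (x\<^sup>2) * (2 * x)) * indicator {0..real n} x \<partial>lborel) \<longlonglongrightarrow> (\<integral>\<^sup>+x. ennreal (f (x\<^sup>2) * (2 * x)) * indicator {0..} x \<partial>lborel)"
    by (rule lim) (auto simp: incseq_def intro!: filterlim_real_sequentially)
  ultimately have "(\<integral>\<^sup>+x. ennreal (f x) * indicator {0..} x \<partial>lborel) = (\<integral>\<^sup>+x. ennreal (f (x\<^sup>2) * (2 * x)) * indicator {0..} x \<partial>lborel)"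
    unfolding eq by (rule LIMSEQ_unique)
  then show ?thesis by (simp only: ind)
qed

lemma distr_square_std_normal:
  "distr (density lborel std_normal_density) borel (\<lambda>x. x\<^sup>2) = gamma_distribution (1 / 2) (1 / 2)"
proof (rule measure_eqI)
  fix A assume "A \<in> sets (distr (density lborel std_normal_density) borel (\<lambda>x. x\<^sup>2 :: real))"
  then have A[measurable]: "A \<in> sets borel" by simp
  let ?g = "gamma_density (1 / 2) (1 / 2)"
  \<comment> \<open>The normalising constants agree because \<open>Gamma (1 / 2)\<close> is the
    square root of pi; the factor 2 is the one that folding the even density onto the half-line
    produces.\<close>
  have dens: "?g (x\<^sup>2) * (2 * x) = 2 * std_normal_density x" if "x > 0" for x
  proof -
    have "(x\<^sup>2) powr (1 / 2 - 1) = 1 / x"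
      using that powr_powr[of x 2 "1 / 2 - 1"] by (simp add: powr_minus_divide)
    moreover have "(1 / 2 :: real) powr (1 / 2) = 1 / sqrt 2"
      by (simp add: powr_half_sqrt real_sqrt_divide)
    ultimately show ?thesis
      using that by (simp add: gamma_density_def std_normal_density_def Gamma_one_half_real real_sqrt_mult)
  qed
  have "emeasure (distr (density lborel std_normal_density) borel (\<lambda>x. x\<^sup>2)) A =
    (\<integral>\<^sup>+x. ennreal (std_normal_density x) * indicator A (x\<^sup>2) \<partial>lborel)"
    by (subst emeasure_distr, measurable, subst emeasure_density, measurable)
      (auto intro!: nn_integral_cong simp: indicator_def)
  also have "\<dots> = (\<integral>\<^sup>+x. 2 * (ennreal (std_normal_density x) * indicator A (x\<^sup>2)) * indicator {0..} x \<partial>lborel)"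
    by (rule nn_integral_even) (auto simp: std_normal_density_def)
  also have "\<dots> = (\<integral>\<^sup>+x. (?g (x\<^sup>2) * indicator A (x\<^sup>2)) * (2 * x) * indicator {0..} x \<partial>lborel)"
  \<comment> \<open>The integrands can differ at 0, where the right one contains the factor
    \<open>2 * x\<close>; this point is null.\<close>
  proof (rule nn_integral_cong_AE)
    have "AE x in lborel. x \<noteq> (0::real)" by (rule AE_lborel_singleton)
    then show "AE x in lborel. 2 * (ennreal (std_normal_density x) * indicator A (x\<^sup>2)) * indicator {0..} x =
      ennreal ((?g (x\<^sup>2) * indicator A (x\<^sup>2)) * (2 * x) * indicator {0..} x)"
    proof eventually_elim
      case (elim x)
      show ?case
      proof (cases "x > 0")
        case True
        then have "ennreal (?g (x\<^sup>2) * (2 * x)) = 2 * ennreal (std_normal_density x)"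
          by (subst dens) (simp_all add: ennreal_mult')
        then show ?thesis using True by (auto simp: indicator_def)
      qed (use elim in \<open>auto simp: indicator_def\<close>)
    qed
  qed
  also have "\<dots> = (\<integral>\<^sup>+x. (?g x * indicator A x) * indicator {0..} x \<partial>lborel)"
    by (rule nn_integral_square_substitution[symmetric]) measurable
  also have "\<dots> = (\<integral>\<^sup>+x. ennreal (?g x) * indicator A x \<partial>lborel)"
    by (intro nn_integral_cong) (auto simp: indicator_def gamma_density_def)
  also have "\<dots> = emeasure (gamma_distribution (1 / 2) (1 / 2)) A"
    by (simp add: gamma_distribution_def emeasure_density)
  finally show "emeasure (distr (density lborel std_normal_density) borel (\<lambda>x. x\<^sup>2)) A = \<dots>" .
qed simp

lemma (in prob_space) distr_centered_square_normal:
  assumes "distributed M lborel X std_normal_density"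
  shows "distr M borel (\<lambda>\<omega>. c * ((X \<omega>)\<^sup>2 - 1)) = centered_gamma c (1 / 2)"
proof -
  have X: "X \<in> measurable M lborel" "distr M lborel X = density lborel std_normal_density"
    using assms by (auto simp: distributed_def)
  have "distr M borel (\<lambda>\<omega>. c * ((X \<omega>)\<^sup>2 - 1)) =
     distr (distr (distr M lborel X) borel (\<lambda>x. x\<^sup>2)) borel (\<lambda>x. - (2 * c * (1 / 2)) + c * x)"
    using X(1) by (simp add: distr_distr comp_def algebra_simps)
  then show ?thesis by (simp only: X(2) distr_square_std_normal centered_gamma_def)
qed

text \<open>Induction on the coordinates: independence turns the sum into a convolution, the order
  passes through it, and the shapes add up. The bound on the coefficients keeps all shapes
  nonnegative.\<close>

lemma (in prob_space) quadratic_form_le_gamma_difference: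
  fixes g :: "nat \<Rightarrow> 'a \<Rightarrow> real" and a :: "nat \<Rightarrow> real"
  assumes I: "finite I" and a: "\<And>i. i \<in> I \<Longrightarrow> \<bar>a i\<bar> \<le> 1"
    and ind: "indep_vars (\<lambda>_. borel) g I"
    and g: "\<And>i. i \<in> I \<Longrightarrow> distributed M lborel (g i) std_normal_density"
  shows "C2_convex_le (distr M borel (\<lambda>\<omega>. \<Sum>i\<in>I. a i * ((g i \<omega>)\<^sup>2 - 1)))
    (gamma_difference (\<Sum>i\<in>I. (a i)\<^sup>2 * (1 + a i) / 4) (\<Sum>i\<in>I. (a i)\<^sup>2 * (1 - a i) / 4))"
  using assms
proof (induction I rule: finite_induct)
  case empty
  then show ?case
    by (simp add: distr_constant centered_gamma_0_right gamma_difference_def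
      convolution_return_0_right all_moments_return_0 C2_convex_le_refl)
next
  case (insert i I)
  let ?X = "\<lambda>i \<omega>. a i * ((g i \<omega>)\<^sup>2 - 1)"
  let ?p = "\<lambda>i. (a i)\<^sup>2 * (1 + a i) / 4" and ?q = "\<lambda>i. (a i)\<^sup>2 * (1 - a i) / 4"
  have nonneg: "0 \<le> ?p j" "0 \<le> ?q j" if "j \<in> insert i I" for j
    using insert.prems(1)[OF that] by (auto intro!: mult_nonneg_nonneg divide_nonneg_nonneg)
  have "indep_vars (\<lambda>_. borel) ?X (insert i I)"
    using indep_vars_compose2[OF insert.prems(2), of "\<lambda>i x. a i * (x\<^sup>2 - 1)" "\<lambda>_. borel"] by simp
  then have law: "distr M borel (\<lambda>\<omega>. \<Sum>j\<in>insert i I. ?X j \<omega>) =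
      (distr M borel (?X i) \<star> distr M borel (\<lambda>\<omega>. \<Sum>j\<in>I. ?X j \<omega>))"
    using insert.hyps by (intro distr_sum_indep)
  have "C2_convex_le (distr M borel (?X i)) (gamma_difference (?p i) (?q i))"
    using centered_gamma_le_gamma_difference[of "a i"] insert.prems
    by (subst distr_centered_square_normal) auto
  moreover have "C2_convex_le (distr M borel (\<lambda>\<omega>. \<Sum>j\<in>I. ?X j \<omega>)) (gamma_difference (\<Sum>j\<in>I. ?p j) (\<Sum>j\<in>I. ?q j))"
    using insert.prems by (intro insert.IH) (auto intro: indep_vars_subset)
  ultimately have "C2_convex_le (distr M borel (\<lambda>\<omega>. \<Sum>j\<in>insert i I. ?X j \<omega>))
      (gamma_difference (?p i) (?q i) \<star> gamma_difference (\<Sum>j\<in>I. ?p j) (\<Sum>j\<in>I. ?q j))"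
    unfolding law by (rule C2_convex_le_convolution)
  also have "(gamma_difference (?p i) (?q i) \<star> gamma_difference (\<Sum>j\<in>I. ?p j) (\<Sum>j\<in>I. ?q j)) =
      gamma_difference (\<Sum>j\<in>insert i I. ?p j) (\<Sum>j\<in>insert i I. ?q j)"
  proof -
    have "0 \<le> (\<Sum>j\<in>I. ?p j)" "0 \<le> (\<Sum>j\<in>I. ?q j)" using nonneg by (auto intro!: sum_nonneg)
    then show ?thesis
      using nonneg[of i] insert.hyps by (subst gamma_difference_convolution) auto
  qed
  finally show ?case .
qed

lemma (in prob_space) distr_gamma_difference:
  assumes ind: "indep_var borel A borel B"
    and A: "distr M borel A = gamma_distribution \<alpha> (1 / 2)"
    and B: "distr M borel B = gamma_distribution \<gamma> (1 / 2)"
  shows "distr M borel (\<lambda>\<omega>. A \<omega> - B \<omega> - 2 * (\<alpha> - \<gamma>)) = gamma_difference \<alpha> \<gamma>"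
proof -
  have [measurable]: "random_variable borel A" "random_variable borel B"
    using indep_var_rv1[OF ind] indep_var_rv2[OF ind] by auto
  let ?f = "\<lambda>x. - (2 * 1 * \<alpha>) + 1 * x" and ?h = "\<lambda>x. - (2 * (-1) * \<gamma>) + (-1) * x"
  have "indep_var borel (?f \<circ> A) borel (?h \<circ> B)"
    by (rule indep_var_compose[OF ind]) measurable
  then have "distr M borel (\<lambda>x. (?f \<circ> A) x + (?h \<circ> B) x) = (distr M borel (?f \<circ> A) \<star> distr M borel (?h \<circ> B))"
    by (rule sum_indep_random_variable) (auto simp: comp_def)
  also have "distr M borel (?f \<circ> A) = centered_gamma 1 \<alpha>"
    unfolding centered_gamma_def A[symmetric] by (subst distr_distr) auto
  also have "distr M borel (?h \<circ> B) = centered_gamma (-1) \<gamma>"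
    unfolding centered_gamma_def B[symmetric] by (subst distr_distr) auto
  finally show ?thesis by (simp add: gamma_difference_def comp_def algebra_simps)
qed

section \<open>Moments up to order three\<close>

lemma gamma_distribution_moments:
  assumes "\<alpha> \<ge> 0"
  shows "(\<integral>x. x \<partial>gamma_distribution \<alpha> (1 / 2)) = 2 * \<alpha>"
    and "(\<integral>x. x\<^sup>2 \<partial>gamma_distribution \<alpha> (1 / 2)) = 4 * \<alpha> * (\<alpha> + 1)"
    and "(\<integral>x. x ^ 3 \<partial>gamma_distribution \<alpha> (1 / 2)) = 8 * \<alpha> * (\<alpha> + 1) * (\<alpha> + 2)"
proof -
  \<comment> \<open>Size biasing lowers the exponent by one and raises the shape by one, so every
    moment reduces to total mass.\<close>
  have step: "(\<integral>x. x ^ Suc r \<partial>gamma_distribution \<gamma> (1 / 2)) = 2 * \<gamma> * (\<integral>x. x ^ r \<partial>gamma_distribution (\<gamma> + 1) (1 / 2))"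
    if "\<gamma> \<ge> 0" for \<gamma> r
    using gamma_distribution_size_bias(1)[of \<gamma> "1 / 2" "\<lambda>x. x ^ r"] that by simp
  have zero: "(\<integral>x. x ^ 0 \<partial>gamma_distribution \<gamma> (1 / 2)) = 1" if "\<gamma> \<ge> 0" for \<gamma>
    using prob_space.prob_space[OF prob_space_gamma_distribution[of \<gamma> "1 / 2"]] that by simp
  have 1: "(\<integral>x. x ^ Suc 0 \<partial>gamma_distribution \<gamma> (1 / 2)) = 2 * \<gamma>" if "\<gamma> \<ge> 0" for \<gamma>
    using step[OF that, of 0] zero[of "\<gamma> + 1"] that by simp
  have 2: "(\<integral>x. x ^ Suc (Suc 0) \<partial>gamma_distribution \<gamma> (1 / 2)) = 4 * \<gamma> * (\<gamma> + 1)" if "\<gamma> \<ge> 0" for \<gamma>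
    using step[OF that, of "Suc 0"] 1[of "\<gamma> + 1"] that by (simp add: algebra_simps)
  have 3: "(\<integral>x. x ^ Suc (Suc (Suc 0)) \<partial>gamma_distribution \<gamma> (1 / 2)) = 8 * \<gamma> * (\<gamma> + 1) * (\<gamma> + 2)" if "\<gamma> \<ge> 0" for \<gamma>
    using step[OF that, of "Suc (Suc 0)"] 2[of "\<gamma> + 1"] that by (simp add: algebra_simps)
  show "(\<integral>x. x \<partial>gamma_distribution \<alpha> (1 / 2)) = 2 * \<alpha>" using 1[OF assms] by simp
  show "(\<integral>x. x\<^sup>2 \<partial>gamma_distribution \<alpha> (1 / 2)) = 4 * \<alpha> * (\<alpha> + 1)"
    using 2[OF assms] by (simp add: numeral_2_eq_2)
  show "(\<integral>x. x ^ 3 \<partial>gamma_distribution \<alpha> (1 / 2)) = 8 * \<alpha> * (\<alpha> + 1) * (\<alpha> + 2)"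
    using 3[OF assms] by (simp add: numeral_3_eq_3)
qed

lemma all_moments_power_integrable: "all_moments \<mu> \<Longrightarrow> integrable \<mu> (\<lambda>x. x ^ k)"
  by (rule all_moments_integrable) (auto intro: poly_growth_power)

lemma all_moments_power_integrable':
  assumes "all_moments \<mu>"
  shows "integrable \<mu> (\<lambda>x. x)" "integrable \<mu> (\<lambda>x. x\<^sup>2)" "integrable \<mu> (\<lambda>x. x ^ 3)"
    "integrable \<mu> (\<lambda>x. b :: real)"
proof -
  show "integrable \<mu> (\<lambda>x. x)" using all_moments_power_integrable[OF assms, of 1] by simp
  show "integrable \<mu> (\<lambda>x. b)" by (rule all_moments_integrable[OF assms poly_growth_const]) simp
qed (rule all_moments_power_integrable[OF assms])+

lemma all_moments_integral_const: "all_moments \<mu> \<Longrightarrow> (\<integral>x. c \<partial>\<mu>) = (c :: real)"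
  by (simp add: all_moments_def prob_space.prob_space)

lemma centered_gamma_moments:
  assumes \<alpha>: "\<alpha> \<ge> 0"
  shows "(\<integral>x. x \<partial>centered_gamma c \<alpha>) = 0"
    and "(\<integral>x. x\<^sup>2 \<partial>centered_gamma c \<alpha>) = 4 * c\<^sup>2 * \<alpha>"
    and "(\<integral>x. x ^ 3 \<partial>centered_gamma c \<alpha>) = 16 * c ^ 3 * \<alpha>"
proof -
  let ?G = "gamma_distribution \<alpha> (1 / 2)"
  have am: "all_moments ?G" using \<alpha> by (intro all_moments_gamma_distribution) auto
  note c1 = all_moments_integral_const[OF am]
  note i = all_moments_power_integrable'[OF am]
  have "(\<integral>x. x \<partial>centered_gamma c \<alpha>) = (\<integral>x. - (2 * c * \<alpha>) + c * x \<partial>?G)"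
    unfolding centered_gamma_def by (rule integral_distr) measurable
  then show "(\<integral>x. x \<partial>centered_gamma c \<alpha>) = 0"
    using i c1 by (simp add: gamma_distribution_moments[OF \<alpha>])
  have "(\<integral>x. x\<^sup>2 \<partial>centered_gamma c \<alpha>) = (\<integral>x. (- (2 * c * \<alpha>) + c * x)\<^sup>2 \<partial>?G)"
    unfolding centered_gamma_def by (rule integral_distr) measurable
  also have "\<dots> = (\<integral>x. 4 * c\<^sup>2 * \<alpha>\<^sup>2 + (- 4 * c\<^sup>2 * \<alpha> * x + c\<^sup>2 * x\<^sup>2) \<partial>?G)"
    by (rule Bochner_Integration.integral_cong[OF refl]) algebra
  also have "\<dots> = 4 * c\<^sup>2 * \<alpha>\<^sup>2 + (- 4 * c\<^sup>2 * \<alpha> * (2 * \<alpha>) + c\<^sup>2 * (4 * \<alpha> * (\<alpha> + 1)))"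
    using i c1 by (simp add: gamma_distribution_moments[OF \<alpha>])
  also have "\<dots> = 4 * c\<^sup>2 * \<alpha>" by algebra
  finally show "(\<integral>x. x\<^sup>2 \<partial>centered_gamma c \<alpha>) = 4 * c\<^sup>2 * \<alpha>" .
  have "(\<integral>x. x ^ 3 \<partial>centered_gamma c \<alpha>) = (\<integral>x. (- (2 * c * \<alpha>) + c * x) ^ 3 \<partial>?G)"
    unfolding centered_gamma_def by (rule integral_distr) measurable
  also have "\<dots> = (\<integral>x. - 8 * c ^ 3 * \<alpha> ^ 3 + (12 * c ^ 3 * \<alpha>\<^sup>2 * x + (- 6 * c ^ 3 * \<alpha> * x\<^sup>2 + c ^ 3 * x ^ 3)) \<partial>?G)"
    by (rule Bochner_Integration.integral_cong[OF refl]) algebra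
  also have "\<dots> = - 8 * c ^ 3 * \<alpha> ^ 3 + (12 * c ^ 3 * \<alpha>\<^sup>2 * (2 * \<alpha>) + (- 6 * c ^ 3 * \<alpha> * (4 * \<alpha> * (\<alpha> + 1)) + c ^ 3 * (8 * \<alpha> * (\<alpha> + 1) * (\<alpha> + 2))))"
    using i c1 by (simp add: gamma_distribution_moments[OF \<alpha>])
  also have "\<dots> = 16 * c ^ 3 * \<alpha>" by algebra
  finally show "(\<integral>x. x ^ 3 \<partial>centered_gamma c \<alpha>) = 16 * c ^ 3 * \<alpha>" .
qed

text \<open>For centred laws the second and third moments are cumulants and hence additive: each
  mixed term contains a mean as a factor.\<close>

lemma convolution_centered_moments:
  assumes \<mu>: "all_moments \<mu>" "(\<integral>x. x \<partial>\<mu>) = 0" and \<nu>: "all_moments \<nu>" "(\<integral>x. x \<partial>\<nu>) = 0"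
  shows "(\<integral>x. x \<partial>(\<mu> \<star> \<nu>)) = 0"
    and "(\<integral>x. x\<^sup>2 \<partial>(\<mu> \<star> \<nu>)) = (\<integral>x. x\<^sup>2 \<partial>\<mu>) + (\<integral>x. x\<^sup>2 \<partial>\<nu>)"
    and "(\<integral>x. x ^ 3 \<partial>(\<mu> \<star> \<nu>)) = (\<integral>x. x ^ 3 \<partial>\<mu>) + (\<integral>x. x ^ 3 \<partial>\<nu>)"
proof -
  note i = all_moments_power_integrable'
  note c = all_moments_integral_const[OF \<mu>(1)] all_moments_integral_const[OF \<nu>(1)]
  have conv: "(\<integral>x. x ^ k \<partial>(\<mu> \<star> \<nu>)) = (\<integral>x. (\<integral>y. (x + y) ^ k \<partial>\<nu>) \<partial>\<mu>)" for k
    by (rule integral_convolution[OF \<mu>(1) \<nu>(1) poly_growth_power]) measurable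
  show "(\<integral>x. x \<partial>(\<mu> \<star> \<nu>)) = 0"
    using conv[of 1] i[OF \<mu>(1)] i[OF \<nu>(1)] c \<mu>(2) \<nu>(2) by simp
  have "(\<integral>y. (x + y)\<^sup>2 \<partial>\<nu>) = x\<^sup>2 + (\<integral>y. y\<^sup>2 \<partial>\<nu>)" for x
  proof -
    have "(\<integral>y. (x + y)\<^sup>2 \<partial>\<nu>) = (\<integral>y. x\<^sup>2 + (2 * x * y + y\<^sup>2) \<partial>\<nu>)"
      by (rule Bochner_Integration.integral_cong[OF refl]) algebra
    then show ?thesis using i[OF \<nu>(1)] c \<nu>(2) by simp
  qed
  then show "(\<integral>x. x\<^sup>2 \<partial>(\<mu> \<star> \<nu>)) = (\<integral>x. x\<^sup>2 \<partial>\<mu>) + (\<integral>x. x\<^sup>2 \<partial>\<nu>)"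
    using conv[of 2] i[OF \<mu>(1)] c by simp
  have "(\<integral>y. (x + y) ^ 3 \<partial>\<nu>) = x ^ 3 + (3 * (\<integral>y. y\<^sup>2 \<partial>\<nu>) * x + (\<integral>y. y ^ 3 \<partial>\<nu>))" for x
  proof -
    have "(\<integral>y. (x + y) ^ 3 \<partial>\<nu>) = (\<integral>y. x ^ 3 + (3 * x\<^sup>2 * y + (3 * x * y\<^sup>2 + y ^ 3)) \<partial>\<nu>)"
      by (rule Bochner_Integration.integral_cong[OF refl]) algebra
    then show ?thesis using i[OF \<nu>(1)] c \<nu>(2) by simp
  qed
  then show "(\<integral>x. x ^ 3 \<partial>(\<mu> \<star> \<nu>)) = (\<integral>x. x ^ 3 \<partial>\<mu>) + (\<integral>x. x ^ 3 \<partial>\<nu>)"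
    using conv[of 3] i[OF \<mu>(1)] c \<mu>(2) by simp
qed

lemma gamma_difference_moments:
  assumes "\<alpha> \<ge> 0" "\<gamma> \<ge> 0"
  shows "(\<integral>x. x \<partial>gamma_difference \<alpha> \<gamma>) = 0"
    and "(\<integral>x. x\<^sup>2 \<partial>gamma_difference \<alpha> \<gamma>) = 4 * (\<alpha> + \<gamma>)"
    and "(\<integral>x. x ^ 3 \<partial>gamma_difference \<alpha> \<gamma>) = 16 * (\<alpha> - \<gamma>)"
  using assms unfolding gamma_difference_def
  by (simp_all add: convolution_centered_moments all_moments_centered_gamma centered_gamma_moments)

text \<open>Up to degree three a monomial has an affine second derivative, so it and its negative
  are both tests. This gives the moments of \<open>Q\<close> from those of \<open>Z\<close>, with no
  computation on the Gaussian side.\<close>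

lemma C2_convex_le_moments_eq:
  assumes le: "C2_convex_le \<mu> \<nu>" and k: "k \<in> {1, 2, 3}"
  shows "(\<integral>x. x ^ k \<partial>\<mu>) = (\<integral>x. x ^ k \<partial>\<nu>)"
proof -
  \<comment> \<open>For \<open>k = 1\<close> the truncated \<open>k - 2\<close> does no harm, since
    the factor \<open>real (k - 1)\<close> is 0.\<close>
  have "convex_C2 (\<lambda>x. c * x ^ k) (\<lambda>x. c * real k * x ^ (k - 1)) (\<lambda>x. c * real k * real (k - 1) * x ^ (k - 2))" for c :: real
  proof -
    have "((\<lambda>x. c * x ^ k) has_real_derivative c * real k * x ^ (k - 1)) (at x)" for x
      by (auto intro!: derivative_eq_intros)
    moreover have "((\<lambda>x. c * real k * x ^ (k - 1)) has_real_derivative c * real k * real (k - 1) * x ^ (k - 2)) (at x)" for x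
      by (auto intro!: derivative_eq_intros simp: diff_diff_left numeral_2_eq_2)
    moreover have "convex_on UNIV (\<lambda>x. c * real k * real (k - 1) * x ^ (k - 2))"
      using k convex_on_affine_comp[OF convex_on_ident[THEN iffD2, OF convex_UNIV], of 0 "6 * c"]
      by (auto simp: convex_on_const)
    ultimately show ?thesis
      by (auto simp: convex_C2_def intro!: poly_growth_cmult poly_growth_power)
  qed
  then have "(\<integral>x. c * x ^ k \<partial>\<mu>) \<le> (\<integral>x. c * x ^ k \<partial>\<nu>)" for c
    using le unfolding C2_convex_le_def by blast
  from this[of 1] this[of "-1"] show ?thesis by simp
qed

section \<open>Absolute powers as test functions\<close>

lemma has_real_derivative_abs_powr:
  assumes "q > 1"
  shows "((\<lambda>x. \<bar>x\<bar> powr q) has_real_derivative q * (sgn x * \<bar>x\<bar> powr (q - 1))) (at x)"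
    and "((\<lambda>x. sgn x * \<bar>x\<bar> powr q) has_real_derivative q * \<bar>x\<bar> powr (q - 1)) (at x)"
proof -
  have ev: "eventually (\<lambda>y. sgn y = sgn x \<and> \<bar>y\<bar> = sgn x * y) (nhds x)" if "x \<noteq> 0"
  proof (cases "x > 0")
    case True
    then have "eventually (\<lambda>y. y \<in> {0<..}) (nhds x)" by (intro eventually_nhds_in_open) auto
    then show ?thesis by (rule eventually_mono) (use True in auto)
  next
    case False
    then have "eventually (\<lambda>y. y \<in> {..<0}) (nhds x)" using that by (intro eventually_nhds_in_open) auto
    then show ?thesis by (rule eventually_mono) (use False that in auto)
  qed
  have base: "((\<lambda>y. (sgn x * y) powr q) has_real_derivative q * (sgn x * \<bar>x\<bar> powr (q - 1))) (at x)" if "x \<noteq> 0"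
    using that by (auto intro!: derivative_eq_intros simp: sgn_if)
  \<comment> \<open>At the origin both difference quotients are bounded by
    \<open>\<bar>h\<bar> powr (q - 1)\<close>, which tends to 0 because \<open>q > 1\<close>; away
    from it the sign is locally constant.\<close>
  have lim0: "((\<lambda>h. \<bar>h\<bar> powr (q - 1)) \<longlongrightarrow> 0) (at (0::real))"
    using assms by (auto intro!: tendsto_eq_intros)
  show "((\<lambda>x. \<bar>x\<bar> powr q) has_real_derivative q * (sgn x * \<bar>x\<bar> powr (q - 1))) (at x)"
  proof (cases "x = 0")
    case False
    show ?thesis
      by (rule DERIV_cong_ev[THEN iffD1, OF refl _ refl base[OF False]])
        (use ev[OF False] in \<open>auto elim!: eventually_mono\<close>)
  next
    case True
    have "((\<lambda>h. \<bar>h\<bar> powr q / h) \<longlongrightarrow> 0) (at (0::real))"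
    proof (rule Lim_null_comparison[OF _ lim0])
      show "eventually (\<lambda>h. norm (\<bar>h\<bar> powr q / h) \<le> \<bar>h\<bar> powr (q - 1)) (at 0)"
        unfolding eventually_at_filter by (rule always_eventually) (auto simp: powr_diff)
    qed
    then show ?thesis using True assms by (simp add: has_field_derivative_iff)
  qed
  show "((\<lambda>x. sgn x * \<bar>x\<bar> powr q) has_real_derivative q * \<bar>x\<bar> powr (q - 1)) (at x)"
  proof (cases "x = 0")
    case False
    have "((\<lambda>y. sgn x * (sgn x * y) powr q) has_real_derivative sgn x * (q * (sgn x * \<bar>x\<bar> powr (q - 1)))) (at x)"
      by (rule DERIV_cmult[OF base[OF False]])
    moreover have "sgn x * (q * (sgn x * \<bar>x\<bar> powr (q - 1))) = q * \<bar>x\<bar> powr (q - 1)"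
      using False by (simp add: sgn_if)
    ultimately have D: "((\<lambda>y. sgn x * (sgn x * y) powr q) has_real_derivative q * \<bar>x\<bar> powr (q - 1)) (at x)" by simp
    show ?thesis
      by (rule DERIV_cong_ev[THEN iffD1, OF refl _ refl D])
        (use ev[OF False] in \<open>auto elim!: eventually_mono\<close>)
  next
    case True
    have "((\<lambda>h. sgn h * \<bar>h\<bar> powr q / h) \<longlongrightarrow> 0) (at (0::real))"
    proof (rule Lim_null_comparison[OF _ lim0])
      show "eventually (\<lambda>h. norm (sgn h * \<bar>h\<bar> powr q / h) \<le> \<bar>h\<bar> powr (q - 1)) (at 0)"
        unfolding eventually_at_filter by (rule always_eventually) (auto simp: powr_diff abs_mult abs_sgn_eq)
    qed
    then show ?thesis using True assms by (simp add: has_field_derivative_iff)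
  qed
qed

text \<open>For \<open>q > 1\<close> the derivative is monotone. The exponent 1, where the
  derivative at 0 is missing, needs the triangle inequality; it is the exponent that
  \<open>p = 3\<close> leads to.\<close>

lemma convex_on_abs_powr:
  assumes "q \<ge> (1 :: real)"
  shows "convex_on UNIV (\<lambda>x. \<bar>x\<bar> powr q)"
proof (cases "q = 1")
  case True
  have "convex_on UNIV (\<lambda>x :: real. \<bar>x\<bar>)"
  proof (rule convex_onI)
    fix t x y :: real assume "0 < t" "t < 1"
    then show "\<bar>(1 - t) *\<^sub>R x + t *\<^sub>R y\<bar> \<le> (1 - t) * \<bar>x\<bar> + t * \<bar>y\<bar>"
      using abs_triangle_ineq[of "(1 - t) * x" "t * y"] by (simp add: abs_mult)
  qed simp
  then show ?thesis using True by simp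
next
  case False
  show ?thesis
  proof (rule convex_on_realI)
    show "((\<lambda>x. \<bar>x\<bar> powr q) has_real_derivative q * (sgn x * \<bar>x\<bar> powr (q - 1))) (at x)" for x
      using False assms by (intro has_real_derivative_abs_powr) simp
    fix x y :: real assume "x \<le> y"
    moreover have "\<bar>x\<bar> powr (q - 1) \<le> \<bar>y\<bar> powr (q - 1)" if "0 \<le> x" "x \<le> y"
      using that assms by (intro powr_mono2) auto
    moreover have "\<bar>y\<bar> powr (q - 1) \<le> \<bar>x\<bar> powr (q - 1)" if "y \<le> 0" "x \<le> y"
      using that assms by (intro powr_mono2) auto
    ultimately have "sgn x * \<bar>x\<bar> powr (q - 1) \<le> sgn y * \<bar>y\<bar> powr (q - 1)"
      by (auto simp: sgn_if intro: order_trans[of _ 0])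
    then show "q * (sgn x * \<bar>x\<bar> powr (q - 1)) \<le> q * (sgn y * \<bar>y\<bar> powr (q - 1))"
      using assms by (intro mult_left_mono) auto
  qed simp
qed

lemma abs_powr_le_power:
  fixes x :: real
  assumes "q \<ge> 0"
  shows "\<bar>x\<bar> powr q \<le> (1 + \<bar>x\<bar>) ^ nat \<lceil>q\<rceil>"
proof -
  have "\<bar>x\<bar> powr q \<le> (1 + \<bar>x\<bar>) powr q" using assms by (intro powr_mono2) auto
  also have "\<dots> \<le> (1 + \<bar>x\<bar>) powr real (nat \<lceil>q\<rceil>)" using assms by (intro powr_mono) (auto simp: of_nat_ceiling)
  also have "\<dots> = (1 + \<bar>x\<bar>) ^ nat \<lceil>q\<rceil>" by (rule powr_realpow) simp
  finally show ?thesis .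
qed

text \<open>Trades the real exponent of a growth hypothesis for its ceiling, since the weights used
  here have natural exponents.\<close>

lemma poly_growth_powr_bound:
  assumes "\<And>x. \<bar>f x\<bar> \<le> C * (1 + \<bar>x\<bar> powr q)" "q \<ge> 0"
  shows "poly_growth f"
proof -
  have "C \<ge> 0"
  proof -
    have "0 \<le> C * (1 + \<bar>0\<bar> powr q)" using assms(1)[of 0] by linarith
    then show ?thesis by (simp split: if_splits)
  qed
  have "\<bar>f x\<bar> \<le> (2 * C) * (1 + \<bar>x\<bar>) ^ nat \<lceil>q\<rceil>" for x
  proof -
    have "1 + \<bar>x\<bar> powr q \<le> 2 * (1 + \<bar>x\<bar>) ^ nat \<lceil>q\<rceil>"
      using abs_powr_le_power[OF assms(2), of x] one_le_power[of "1 + \<bar>x\<bar>" "nat \<lceil>q\<rceil>"] by linarith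
    from mult_left_mono[OF this \<open>C \<ge> 0\<close>] show ?thesis using assms(1)[of x] by (simp add: mult_ac)
  qed
  then show ?thesis unfolding poly_growth_def by blast
qed

text \<open>The second derivative is a positive multiple of
  \<open>\<bar>x\<bar> powr (p - 2)\<close>, and \<open>p \<ge> 3\<close> is what makes that
  exponent at least 1 and the function convex.\<close>

lemma convex_C2_abs_powr:
  assumes p: "p \<ge> 3"
  shows "convex_C2 (\<lambda>x. \<bar>x\<bar> powr p) (\<lambda>x. p * (sgn x * \<bar>x\<bar> powr (p - 1)))
    (\<lambda>x. p * (p - 1) * \<bar>x\<bar> powr (p - 2))"
proof -
  have "((\<lambda>x. p * (sgn x * \<bar>x\<bar> powr (p - 1))) has_real_derivative p * (p - 1) * \<bar>x\<bar> powr (p - 2)) (at x)" for x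
    using DERIV_cmult[OF has_real_derivative_abs_powr(2)[of "p - 1" x], of p] p by (simp add: mult.assoc)
  moreover have "convex_on UNIV (\<lambda>x. p * (p - 1) * \<bar>x\<bar> powr (p - 2))"
    using p by (intro convex_on_cmul convex_on_abs_powr) auto
  moreover have pg: "poly_growth (\<lambda>x. \<bar>x\<bar> powr q)" "poly_growth (\<lambda>x. sgn x * \<bar>x\<bar> powr q)" if "q \<ge> 0" for q
    using that by (auto intro!: poly_growth_powr_bound[where C = 1 and q = q] simp: abs_mult abs_sgn_eq)
  ultimately show ?thesis
    using has_real_derivative_abs_powr(1)[of p] p by (auto simp: convex_C2_def intro!: poly_growth_cmult pg)
qed

theorem theorem2p1:
  fixes M :: "'a measure" and N :: "'b measure"
    and n :: nat and a :: "nat \<Rightarrow> real" and g :: "nat \<Rightarrow> 'a \<Rightarrow> real"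
    and Q :: "'a \<Rightarrow> real" and \<delta> :: real
    and A B Z :: "'b \<Rightarrow> real"
  assumes "prob_space M" and "prob_space N"
    and "n \<ge> 1"
    and "(\<Sum>i=1..n. (a i)\<^sup>2) = 1"
    and "prob_space.indep_vars M (\<lambda>_. borel) g {1..n}"
    and "\<And>i. i \<in> {1..n} \<Longrightarrow> distributed M lborel (g i) std_normal_density"
  defines "Q \<equiv> \<lambda>\<omega>. \<Sum>i=1..n. a i * ((g i \<omega>)\<^sup>2 - 1)"
    and "\<delta> \<equiv> \<Sum>i=1..n. (a i) ^ 3"
  assumes "prob_space.indep_var N borel A borel B"
    and "distr N borel A = gamma_distribution ((1 + \<delta>) / 4) (1 / 2)"
    and "distr N borel B = gamma_distribution ((1 - \<delta>) / 4) (1 / 2)"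
  defines "Z \<equiv> \<lambda>\<omega>. A \<omega> - B \<omega> - \<delta>"
  shows "\<delta> \<in> {-1..1} \<and>
    (\<forall>(f :: real \<Rightarrow> real) f' f'' (C :: real) (m :: real).
       (\<forall>x. (f has_real_derivative f' x) (at x)) \<longrightarrow>
       (\<forall>x. (f' has_real_derivative f'' x) (at x)) \<longrightarrow>
       continuous_on UNIV f'' \<longrightarrow>
       convex_on UNIV f'' \<longrightarrow>
       C > 0 \<longrightarrow> m > 0 \<longrightarrow>
       (\<forall>x. \<bar>f x\<bar> + \<bar>f' x\<bar> + \<bar>f'' x\<bar> \<le> C * (1 + \<bar>x\<bar> powr m)) \<longrightarrow>
       integrable M (\<lambda>\<omega>. f (Q \<omega>)) \<and> integrable N (\<lambda>\<omega>. f (Z \<omega>)) \<and>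
       (\<integral>\<omega>. f (Q \<omega>) \<partial>M) \<le> (\<integral>\<omega>. f (Z \<omega>) \<partial>N)) \<and>
    (integrable M Q \<and> (\<integral>\<omega>. Q \<omega> \<partial>M) = 0) \<and>
    (integrable N Z \<and> (\<integral>\<omega>. Z \<omega> \<partial>N) = 0) \<and>
    (integrable M (\<lambda>\<omega>. (Q \<omega>)\<^sup>2) \<and> (\<integral>\<omega>. (Q \<omega>)\<^sup>2 \<partial>M) = 2) \<and>
    (integrable N (\<lambda>\<omega>. (Z \<omega>)\<^sup>2) \<and> (\<integral>\<omega>. (Z \<omega>)\<^sup>2 \<partial>N) = 2) \<and>
    (integrable M (\<lambda>\<omega>. (Q \<omega>) ^ 3) \<and> (\<integral>\<omega>. (Q \<omega>) ^ 3 \<partial>M) = 8 * \<delta>) \<and>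
    (integrable N (\<lambda>\<omega>. (Z \<omega>) ^ 3) \<and> (\<integral>\<omega>. (Z \<omega>) ^ 3 \<partial>N) = 8 * \<delta>) \<and>
    (\<forall>p :: real. p \<ge> 3 \<longrightarrow>
       integrable M (\<lambda>\<omega>. \<bar>Q \<omega>\<bar> powr p) \<and> integrable N (\<lambda>\<omega>. \<bar>Z \<omega>\<bar> powr p) \<and>
       (\<integral>\<omega>. \<bar>Q \<omega>\<bar> powr p \<partial>M) \<le> (\<integral>\<omega>. \<bar>Z \<omega>\<bar> powr p \<partial>N))"
proof -
  interpret M: prob_space M by fact
  interpret N: prob_space N by fact
  have a_le: "\<bar>a i\<bar> \<le> 1" if "i \<in> {1..n}" for i
  proof -
    have "(a i)\<^sup>2 \<le> (\<Sum>i=1..n. (a i)\<^sup>2)" using that by (intro member_le_sum) auto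
    then show ?thesis using assms(4) by (simp add: abs_square_le_1)
  qed
  have "(\<Sum>i=1..n. (a i)\<^sup>2 * (1 + a i)) = (\<Sum>i=1..n. (a i)\<^sup>2) + \<delta>"
    "(\<Sum>i=1..n. (a i)\<^sup>2 * (1 - a i)) = (\<Sum>i=1..n. (a i)\<^sup>2) - \<delta>"
    by (simp_all add: \<delta>_def distrib_left right_diff_distrib sum.distrib sum_subtractf
      power2_eq_square power3_eq_cube)
  \<comment> \<open>Normalisation of the squares and the definition of \<open>\<delta>\<close> turn
    the accumulated shapes into those of \<open>A\<close> and \<open>B\<close>. Their nonnegativity
    then bounds \<open>\<delta>\<close>.\<close>
  then have sums: "(\<Sum>i=1..n. (a i)\<^sup>2 * (1 + a i) / 4) = (1 + \<delta>) / 4"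
    "(\<Sum>i=1..n. (a i)\<^sup>2 * (1 - a i) / 4) = (1 - \<delta>) / 4"
    unfolding sum_divide_distrib[symmetric] using assms(4) by simp_all
  have "0 \<le> (\<Sum>i=1..n. (a i)\<^sup>2 * (1 + a i) / 4)" "0 \<le> (\<Sum>i=1..n. (a i)\<^sup>2 * (1 - a i) / 4)"
    using a_le by (auto intro!: sum_nonneg mult_nonneg_nonneg simp: abs_le_iff) (force simp: abs_le_iff)+
  then have \<delta>: "0 \<le> (1 + \<delta>) / 4" "0 \<le> (1 - \<delta>) / 4" by (simp_all only: sums)
  let ?\<mu> = "distr M borel Q" and ?\<nu> = "distr N borel Z"
  have "distr N borel (\<lambda>\<omega>. A \<omega> - B \<omega> - 2 * ((1 + \<delta>) / 4 - (1 - \<delta>) / 4)) = gamma_difference ((1 + \<delta>) / 4) ((1 - \<delta>) / 4)"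
    using assms(9-11) by (rule N.distr_gamma_difference)
  moreover have "2 * ((1 + \<delta>) / 4 - (1 - \<delta>) / 4) = \<delta>" by (simp add: field_simps)
  ultimately have \<nu>: "?\<nu> = gamma_difference ((1 + \<delta>) / 4) ((1 - \<delta>) / 4)" by (simp only: Z_def)
  have le: "C2_convex_le ?\<mu> ?\<nu>"
    using M.quadratic_form_le_gamma_difference[where I = "{1..n}" and a = a, OF _ a_le assms(5,6)] by (simp only: \<nu> Q_def sums finite_atLeastAtMost)
  have [measurable]: "Q \<in> borel_measurable M"
  proof -
    have [measurable]: "g i \<in> borel_measurable M" if "i \<in> {1..n}" for i
      using assms(6)[OF that] by (simp add: distributed_def)
    show ?thesis unfolding Q_def by measurable
  qed
  have [measurable]: "Z \<in> borel_measurable N"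
    using N.indep_var_rv1[OF assms(9)] N.indep_var_rv2[OF assms(9)] unfolding Z_def by measurable
  have am: "all_moments ?\<mu>" "all_moments ?\<nu>" using le by (auto simp: C2_convex_le_def)
  have int: "integrable M (\<lambda>\<omega>. f (Q \<omega>))" "integrable N (\<lambda>\<omega>. f (Z \<omega>))"
    and eq: "(\<integral>\<omega>. f (Q \<omega>) \<partial>M) = integral\<^sup>L ?\<mu> f" "(\<integral>\<omega>. f (Z \<omega>) \<partial>N) = integral\<^sup>L ?\<nu> f"
    if "poly_growth f" and [measurable]: "f \<in> borel_measurable borel" for f
    using all_moments_integrable[OF am(1) that] all_moments_integrable[OF am(2) that]
    by (simp_all add: integrable_distr_eq integral_distr)
  have main: "integrable M (\<lambda>\<omega>. f (Q \<omega>)) \<and> integrable N (\<lambda>\<omega>. f (Z \<omega>)) \<and>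
      (\<integral>\<omega>. f (Q \<omega>) \<partial>M) \<le> (\<integral>\<omega>. f (Z \<omega>) \<partial>N)" if f: "convex_C2 f f' f''" for f f' f''
  proof -
    have pg: "poly_growth f" using f by (simp add: convex_C2_def)
    note m = convex_C2_measurable(1)[OF f]
    have "integral\<^sup>L ?\<mu> f \<le> integral\<^sup>L ?\<nu> f" using le f unfolding C2_convex_le_def by blast
    then show ?thesis using int[OF pg m] eq[OF pg m] by simp
  qed
  have pow: "integrable M (\<lambda>\<omega>. Q \<omega> ^ k) \<and> integrable N (\<lambda>\<omega>. Z \<omega> ^ k) \<and>
      (\<integral>\<omega>. Q \<omega> ^ k \<partial>M) = (\<integral>x. x ^ k \<partial>?\<nu>) \<and> (\<integral>\<omega>. Z \<omega> ^ k \<partial>N) = (\<integral>x. x ^ k \<partial>?\<nu>)"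
    if "k \<in> {1, 2, 3}" for k
    using int[OF poly_growth_power, of k] eq[OF poly_growth_power, of k] C2_convex_le_moments_eq[OF le that] by simp
  \<comment> \<open>The shapes have sum 1/2 and difference \<open>\<delta> / 2\<close>, so the
    second moment is \<open>4 * (1 / 2) = 2\<close> and the third is
    \<open>16 * (\<delta> / 2) = 8 * \<delta>\<close>.\<close>
  note mom = gamma_difference_moments[OF \<delta>, folded \<nu>]
  show ?thesis
  proof (intro conjI allI impI)
    show "\<delta> \<in> {-1..1}" using \<delta> by simp
  next
    fix f f' f'' :: "real \<Rightarrow> real" and C m :: real
    assume d: "\<forall>x. (f has_real_derivative f' x) (at x)" "\<forall>x. (f' has_real_derivative f'' x) (at x)"
      "convex_on UNIV f''" and m: "0 < m"
      and bound: "\<forall>x. \<bar>f x\<bar> + \<bar>f' x\<bar> + \<bar>f'' x\<bar> \<le> C * (1 + \<bar>x\<bar> powr m)"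
    have b: "\<bar>f x\<bar> \<le> C * (1 + \<bar>x\<bar> powr m)" "\<bar>f' x\<bar> \<le> C * (1 + \<bar>x\<bar> powr m)"
      "\<bar>f'' x\<bar> \<le> C * (1 + \<bar>x\<bar> powr m)" for x
      using bound[rule_format, of x] by linarith+
    have f: "convex_C2 f f' f''"
      using d m poly_growth_powr_bound[OF b(1)] poly_growth_powr_bound[OF b(2)] poly_growth_powr_bound[OF b(3)]
      by (simp add: convex_C2_def)
    show "integrable M (\<lambda>\<omega>. f (Q \<omega>))" "integrable N (\<lambda>\<omega>. f (Z \<omega>))"
      "(\<integral>\<omega>. f (Q \<omega>) \<partial>M) \<le> (\<integral>\<omega>. f (Z \<omega>) \<partial>N)"
      using main[OF f] by simp_all
  next
    fix p :: real assume "3 \<le> p"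
    from main[OF convex_C2_abs_powr[OF this]]
    show "integrable M (\<lambda>\<omega>. \<bar>Q \<omega>\<bar> powr p)" "integrable N (\<lambda>\<omega>. \<bar>Z \<omega>\<bar> powr p)"
      "(\<integral>\<omega>. \<bar>Q \<omega>\<bar> powr p \<partial>M) \<le> (\<integral>\<omega>. \<bar>Z \<omega>\<bar> powr p \<partial>N)"
      by simp_all
  qed (use pow[of 1] pow[of 2] pow[of 3] mom in \<open>simp_all add: field_simps\<close>)
qed

end
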